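(* Let $-\infty\le a<b\le+\infty$, $m\ge 1$, and consider the singular continuous linear Hamiltonian system $$Jy'(t)=(P(t)+\lambda W(t))y(t),\quad t\in(a,b),\qquad J=\begin{pmatrix}0&-I_m\\ I_m&0\end{pmatrix},\qquad (\ast)$$ where $W(t),P(t)$ are $2m\times 2m$ Hermitian matrices for each $t\in(a,b)$, $W,P\in L_{loc}(a,b)$, and $W\ge 0$ on $(a,b)$. Assume that for each subinterval $(a',b')\subset(a,b)$: if $y$ satisfies $Jy'-Py=W\hat f$ and $Wy=0$ on $(a',b')$ for some $\hat f\in\hat L^2_W(a',b')$, then $y=0$ on $(a',b')$. Assume that $(\ast)$ is in the limit circle case at both endpoints $a$ and $b$. Let $M,N$ be $2m\times 2m$ complex matrices with $\operatorname{rank}(M,N)=2m$ and $MJM^*=NJN^*$, and let $H_D$ be the self-adjoint operator (the restriction of the maximal operator $H$ to $D$) with domain $$D=\left\{y\in D(H): M\begin{pmatrix}(y,\phi_1)_c(a)\\ \vdots\\ (y,\phi_{2m})_c(a)\end{pmatrix}-N\begin{pmatrix}(y,\phi_1)_c(b)\\ \vdots\\ (y,\phi_{2m})_c(b)\end{pmatrix}=0\right\}.$$ Let $\lambda_0$ be an eigenvalue of $H_D$. Then the analytic multiplicity of $\lambda_0$ (its order as a zero of the entire function $\Gamma_c(\lambda)=\det(M\Phi_\lambda(a)-N\Phi_\lambda(b))$) and the geometric multiplicity of $\lambda_0$ (the number of linearly independent eigenfunctions of $H_D$ for $\lambda_0$) are equal.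
   Context: Spaces. For an interval $(a',b')\subset(a,b)$, $\hat L^2_W(a',b')$ is the set of (measurable, $\mathbb{C}^{2m}$-valued) functions $\hat f$ with $\int_{a'}^{b'}\hat f^*(t)W(t)\hat f(t)\,dt<\infty$; on $\hat L^2_W(a,b)$ the semi-inner product is $\langle\hat f,\hat g\rangle_c=\int_a^b\hat g^*W\hat f\,dt$ with seminorm $\|\cdot\|_c$, and $L^2_W(a,b)=\hat L^2_W(a,b)/\{\hat y:\|\hat y\|_c=0\}$. Here $^*$ is the conjugate transpose. Maximal operator. With $\mathcal{L}(\hat y)=J\hat y'-P\hat y$, $D(H)$ is the set of $y\in L^2_W(a,b)$ for which there is a representative $\hat y\in y$, locally absolutely continuous on $(a,b)$, such that $\mathcal{L}(\hat y)(t)=W(t)\hat f(t)$ on $(a,b)$ for some $f\in L^2_W(a,b)$ and any representative $\hat f\in f$; then $Hy=f$. Under the stated assumption on subintervals, $H$ is well-defined and the representative $\hat y$ is unique, and $y\in D(H)$ is identified with it. For every $\lambda\in\mathbb{C}$ and every nontrivial solution $y$ of $(\ast)$ one has $\int_{a'}^{b'}y^*Wy\,ds>0$. The minimal operator $H_0$ is the closure of the restriction of $H$ to those $y\in D(H)$ whose representative has compact support in $(a,b)$. For $f,g\in D(H)$ put $(f,g)_c(t)=g^*(t)Jf(t)$, $t\in(a,b)$; the limits $(f,g)_c(a)=\lim_{t\to a^+}(f,g)_c(t)$ and $(f,g)_c(b)=\lim_{t\to b^-}(f,g)_c(t)$ exist and are finite. Limit circle. Fix $c_0\in(a,b)$.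 $(\ast)$ is in the limit circle case at $a$ (resp. at $b$) if the minimal operator associated with $(\ast)$ on $(a,c_0)$ (resp. on $(c_0,b)$) has both defect indices equal to $2m$, i.e. for all $\lambda\in\mathbb{C}\setminus\mathbb{R}$ all solutions of $(\ast)$ are in $\hat L^2_W(a,c_0)$ (resp. $\hat L^2_W(c_0,b)$). When both endpoints are in the limit circle case, for every $\lambda\in\mathbb{C}$ all solutions of $(\ast)$ lie in $\hat L^2_W(a,b)$. Fundamental solutions. With $c_0\in(a,b)$ fixed, $\phi_{i,\lambda}$, $1\le i\le 2m$, are the solutions of $(\ast)$ with $(\phi_{1,\lambda}(c_0),\dots,\phi_{2m,\lambda}(c_0))=I_{2m}$, and $\phi_i=\phi_{i,0}$. For $t\in[a,b]$, $\Phi_\lambda(t)$ is the $2m\times 2m$ matrix whose $(j,i)$ entry is $(\phi_{i,\lambda},\phi_j)_c(t)$; for each fixed $t\in[a,b]$ its entries are entire functions of $\lambda$. Known facts. The domains $D$ of the form in the claim are exactly the self-adjoint extension domains of $H_0$; the spectrum of $H_D$ consists of isolated eigenvalues; $\lambda\in\mathbb{C}$ is an eigenvalue of $H_D$ if and only if $\Gamma_c(\lambda)=0$. *)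

theory Defs
  imports "HOL-Complex_Analysis.Complex_Analysis" "HOL-Library.Extended_Nat"
begin

section \<open>Complex vectors and matrices\<close>

text \<open>Vectors in $\mathbb{C}^{2m}$ are indexed by \<open>'m + 'm\<close>, with \<open>CARD('m) = m\<close>.\<close>

definition cdot :: "complex ^ 'n \<Rightarrow> complex ^ 'n \<Rightarrow> complex"  \<comment> \<open>$g^* f$, conjugate-linear in \<open>g\<close>\<close>
  where "cdot g f = (\<Sum>i\<in>UNIV. cnj (g $ i) * f $ i)"

definition ctranspose :: "complex ^ 'n ^ 'k \<Rightarrow> complex ^ 'k ^ 'n"
  where "ctranspose A = (\<chi> i j. cnj (A $ j $ i))"

definition hermitian :: "complex ^ 'n ^ 'n \<Rightarrow> bool"
  where "hermitian A \<longleftrightarrow> ctranspose A = A"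

definition nonneg_matrix :: "complex ^ 'n ^ 'n \<Rightarrow> bool"
  where "nonneg_matrix A \<longleftrightarrow> hermitian A \<and> (\<forall>v. 0 \<le> Re (cdot v (A *v v)))"

definition symp_J :: "complex ^ ('m::finite + 'm) ^ ('m + 'm)"
  where "symp_J = (\<chi> p q. case (p, q) of
             (Inl i, Inr j) \<Rightarrow> if i = j then - 1 else 0
           | (Inr i, Inl j) \<Rightarrow> if i = j then 1 else 0
           | _ \<Rightarrow> 0)"

definition hcat :: "complex ^ 'n::finite ^ 'k \<Rightarrow> complex ^ 'l::finite ^ 'k \<Rightarrow> complex ^ ('n + 'l) ^ 'k"
  where "hcat M N = (\<chi> i q. case q of Inl j \<Rightarrow> M $ i $ j | Inr j \<Rightarrow> N $ i $ j)"

section \<open>Function classes on an interval\<close>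

definition locally_integrable :: "ereal \<Rightarrow> ereal \<Rightarrow> (real \<Rightarrow> 'a::euclidean_space) \<Rightarrow> bool"
  where "locally_integrable a b f \<longleftrightarrow>
           (\<forall>c d. a < ereal c \<and> ereal d < b \<longrightarrow> set_integrable lebesgue {c..d} f)"

text \<open>The sets \<open>D\<close> below are the finite families of non-overlapping compact subintervals of \<open>S\<close>.\<close>

definition absolutely_cont_on :: "real set \<Rightarrow> (real \<Rightarrow> 'a::real_normed_vector) \<Rightarrow> bool"
  where "absolutely_cont_on S f \<longleftrightarrow>
           (\<forall>e>0. \<exists>d>0. \<forall>D T. D division_of T \<and> T \<subseteq> S \<and> (\<Sum>K\<in>D. Sup K - Inf K) < d \<longrightarrow>
              (\<Sum>K\<in>D. norm (f (Sup K) - f (Inf K))) < e)"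

definition locally_absolutely_cont :: "ereal \<Rightarrow> ereal \<Rightarrow> (real \<Rightarrow> 'a::real_normed_vector) \<Rightarrow> bool"
  where "locally_absolutely_cont a b f \<longleftrightarrow>
           (\<forall>c d. a < ereal c \<and> ereal d < b \<longrightarrow> absolutely_cont_on {c..d} f)"

section \<open>The space \<open>L\<^sup>2\<^sub>W(a,b)\<close>\<close>

text \<open>
  Functions on $(a,b)$ are represented by functions on \<open>\<real>\<close> whose values off $(a,b)$ are
  immaterial: they are invisible to the seminorm, so the quotient does not depend on them.
\<close>

definition L2hat :: "ereal \<Rightarrow> ereal \<Rightarrow> (real \<Rightarrow> complex ^ 'n ^ 'n) \<Rightarrow> (real \<Rightarrow> complex ^ 'n) set"
  where "L2hat a b W = {f. set_borel_measurable lebesgue (einterval a b) f \<and>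
           set_integrable lebesgue (einterval a b) (\<lambda>t. cdot (f t) (W t *v f t))}"

definition inner_c :: "ereal \<Rightarrow> ereal \<Rightarrow> (real \<Rightarrow> complex ^ 'n ^ 'n) \<Rightarrow>
    (real \<Rightarrow> complex ^ 'n) \<Rightarrow> (real \<Rightarrow> complex ^ 'n) \<Rightarrow> complex"
  where "inner_c a b W f g = (LINT t:einterval a b|lebesgue. cdot (g t) (W t *v f t))"

definition seminorm_c :: "ereal \<Rightarrow> ereal \<Rightarrow> (real \<Rightarrow> complex ^ 'n ^ 'n) \<Rightarrow> (real \<Rightarrow> complex ^ 'n) \<Rightarrow> real"
  where "seminorm_c a b W f = sqrt (Re (inner_c a b W f f))"

definition L2_rel :: "ereal \<Rightarrow> ereal \<Rightarrow> (real \<Rightarrow> complex ^ 'n ^ 'n) \<Rightarrow>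
    ((real \<Rightarrow> complex ^ 'n) \<times> (real \<Rightarrow> complex ^ 'n)) set"
  where "L2_rel a b W = {(f, g). f \<in> L2hat a b W \<and> g \<in> L2hat a b W \<and>
           seminorm_c a b W (\<lambda>t. f t - g t) = 0}"

definition L2_space :: "ereal \<Rightarrow> ereal \<Rightarrow> (real \<Rightarrow> complex ^ 'n ^ 'n) \<Rightarrow> (real \<Rightarrow> complex ^ 'n) set set"
  where "L2_space a b W = L2hat a b W // L2_rel a b W"

definition L2_zero :: "ereal \<Rightarrow> ereal \<Rightarrow> (real \<Rightarrow> complex ^ 'n ^ 'n) \<Rightarrow> (real \<Rightarrow> complex ^ 'n) set"
  where "L2_zero a b W = L2_rel a b W `` {\<lambda>t. 0}"

definition L2_scale :: "ereal \<Rightarrow> ereal \<Rightarrow> (real \<Rightarrow> complex ^ 'n ^ 'n) \<Rightarrow> complex \<Rightarrow>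
    (real \<Rightarrow> complex ^ 'n) set \<Rightarrow> (real \<Rightarrow> complex ^ 'n) set"
  where "L2_scale a b W c y = (\<Union>f\<in>y. L2_rel a b W `` {\<lambda>t. c *s f t})"

text \<open>Linear independence in \<open>L\<^sup>2\<^sub>W(a,b)\<close> of a finite set \<open>B\<close> of classes; \<open>r\<close> picks representatives.\<close>

definition L2_independent :: "ereal \<Rightarrow> ereal \<Rightarrow> (real \<Rightarrow> complex ^ 'n ^ 'n) \<Rightarrow>
    (real \<Rightarrow> complex ^ 'n) set set \<Rightarrow> bool"
  where "L2_independent a b W B \<longleftrightarrow>
           (\<forall>c r. (\<forall>y\<in>B. r y \<in> y) \<and> L2_rel a b W `` {\<lambda>t. \<Sum>y\<in>B. c y *s r y t} = L2_zero a b W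
              \<longrightarrow> (\<forall>y\<in>B. c y = 0))"

section \<open>The Hamiltonian system and its maximal operator\<close>

text \<open>Differential equations are required to hold almost everywhere.\<close>

definition ham_eq :: "ereal \<Rightarrow> ereal \<Rightarrow> (real \<Rightarrow> complex ^ ('m::finite + 'm) ^ ('m + 'm)) \<Rightarrow>
    (real \<Rightarrow> complex ^ ('m + 'm) ^ ('m + 'm)) \<Rightarrow>
    (real \<Rightarrow> complex ^ ('m + 'm)) \<Rightarrow> (real \<Rightarrow> complex ^ ('m + 'm)) \<Rightarrow> bool"
  where "ham_eq a b P W y f \<longleftrightarrow>
           (AE t in lebesgue. t \<in> einterval a b \<longrightarrow>
              (\<exists>y'. (y has_vector_derivative y') (at t) \<and>
                    symp_J *v y' - P t *v y t = W t *v f t))"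

definition ham_solution :: "ereal \<Rightarrow> ereal \<Rightarrow> (real \<Rightarrow> complex ^ ('m::finite + 'm) ^ ('m + 'm)) \<Rightarrow>
    (real \<Rightarrow> complex ^ ('m + 'm) ^ ('m + 'm)) \<Rightarrow> complex \<Rightarrow> (real \<Rightarrow> complex ^ ('m + 'm)) \<Rightarrow> bool"
  where "ham_solution a b P W l y \<longleftrightarrow> locally_absolutely_cont a b y \<and>
           (AE t in lebesgue. t \<in> einterval a b \<longrightarrow>
              (\<exists>y'. (y has_vector_derivative y') (at t) \<and>
                    symp_J *v y' = (P t + mat l ** W t) *v y t))"

text \<open>The assumption on subintervals $(a',b') \subseteq (a,b)$.\<close>

definition definite_on_subintervals :: "ereal \<Rightarrow> ereal \<Rightarrow>
    (real \<Rightarrow> complex ^ ('m::finite + 'm) ^ ('m + 'm)) \<Rightarrow>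
    (real \<Rightarrow> complex ^ ('m + 'm) ^ ('m + 'm)) \<Rightarrow> bool"
  where "definite_on_subintervals a b P W \<longleftrightarrow>
           (\<forall>a' b' y f. a \<le> a' \<and> a' < b' \<and> b' \<le> b \<and> f \<in> L2hat a' b' W \<and>
              locally_absolutely_cont a' b' y \<and> ham_eq a' b' P W y f \<and>
              (AE t in lebesgue. t \<in> einterval a' b' \<longrightarrow> W t *v y t = 0)
              \<longrightarrow> (\<forall>t\<in>einterval a' b'. y t = 0))"

text \<open>
  Limit circle case, i.e. defect indices \<open>2 * CARD('m)\<close> on $(a,c_0)$ resp. $(c_0,b)$: for every
  non-real parameter all solutions are square integrable near the endpoint.
\<close>

definition limit_circle_left :: "ereal \<Rightarrow> ereal \<Rightarrow> (real \<Rightarrow> complex ^ ('m::finite + 'm) ^ ('m + 'm)) \<Rightarrow>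
    (real \<Rightarrow> complex ^ ('m + 'm) ^ ('m + 'm)) \<Rightarrow> real \<Rightarrow> bool"
  where "limit_circle_left a b P W c0 \<longleftrightarrow>
           (\<forall>l y. l \<notin> \<real> \<and> ham_solution a b P W l y \<longrightarrow> y \<in> L2hat a (ereal c0) W)"

definition limit_circle_right :: "ereal \<Rightarrow> ereal \<Rightarrow> (real \<Rightarrow> complex ^ ('m::finite + 'm) ^ ('m + 'm)) \<Rightarrow>
    (real \<Rightarrow> complex ^ ('m + 'm) ^ ('m + 'm)) \<Rightarrow> real \<Rightarrow> bool"
  where "limit_circle_right a b P W c0 \<longleftrightarrow>
           (\<forall>l y. l \<notin> \<real> \<and> ham_solution a b P W l y \<longrightarrow> y \<in> L2hat (ereal c0) b W)"

text \<open>\<open>max_graph a b P W y yh f\<close>: the class \<open>f\<close> is \<open>H y\<close>, as witnessed by the representative \<open>yh\<close> of \<open>y\<close>.\<close>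

definition max_graph :: "ereal \<Rightarrow> ereal \<Rightarrow> (real \<Rightarrow> complex ^ ('m::finite + 'm) ^ ('m + 'm)) \<Rightarrow>
    (real \<Rightarrow> complex ^ ('m + 'm) ^ ('m + 'm)) \<Rightarrow>
    (real \<Rightarrow> complex ^ ('m + 'm)) set \<Rightarrow> (real \<Rightarrow> complex ^ ('m + 'm)) \<Rightarrow>
    (real \<Rightarrow> complex ^ ('m + 'm)) set \<Rightarrow> bool"
  where "max_graph a b P W y yh f \<longleftrightarrow>
           y \<in> L2_space a b W \<and> f \<in> L2_space a b W \<and> yh \<in> y \<and> locally_absolutely_cont a b yh \<and>
           (\<forall>fh\<in>f. ham_eq a b P W yh fh)"

definition max_dom :: "ereal \<Rightarrow> ereal \<Rightarrow> (real \<Rightarrow> complex ^ ('m::finite + 'm) ^ ('m + 'm)) \<Rightarrow>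
    (real \<Rightarrow> complex ^ ('m + 'm) ^ ('m + 'm)) \<Rightarrow> (real \<Rightarrow> complex ^ ('m + 'm)) set set"
  where "max_dom a b P W = {y. \<exists>yh f. max_graph a b P W y yh f}"

definition max_op :: "ereal \<Rightarrow> ereal \<Rightarrow> (real \<Rightarrow> complex ^ ('m::finite + 'm) ^ ('m + 'm)) \<Rightarrow>
    (real \<Rightarrow> complex ^ ('m + 'm) ^ ('m + 'm)) \<Rightarrow>
    (real \<Rightarrow> complex ^ ('m + 'm)) set \<Rightarrow> (real \<Rightarrow> complex ^ ('m + 'm)) set"
  where "max_op a b P W y = (THE f. \<exists>yh. max_graph a b P W y yh f)"

text \<open>
  The locally absolutely continuous representative with which \<open>y\<close> in the maximal domain is
  identified. It is unique on $(a,b)$; the choice operator only fixes its values elsewhere.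
\<close>

definition max_rep :: "ereal \<Rightarrow> ereal \<Rightarrow> (real \<Rightarrow> complex ^ ('m::finite + 'm) ^ ('m + 'm)) \<Rightarrow>
    (real \<Rightarrow> complex ^ ('m + 'm) ^ ('m + 'm)) \<Rightarrow>
    (real \<Rightarrow> complex ^ ('m + 'm)) set \<Rightarrow> real \<Rightarrow> complex ^ ('m + 'm)"
  where "max_rep a b P W y = (SOME yh. \<exists>f. max_graph a b P W y yh f)"

section \<open>Boundary values and the operator \<open>H\<^sub>D\<close>\<close>

definition bracket :: "(real \<Rightarrow> complex ^ ('m::finite + 'm)) \<Rightarrow> (real \<Rightarrow> complex ^ ('m + 'm)) \<Rightarrow> real \<Rightarrow> complex"
  where "bracket f g t = cdot (g t) (symp_J *v f t)"

text \<open>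
  Endpoints are extended reals, so the one-sided limits are taken in \<^typ>\<open>ereal\<close>; for a finite
  endpoint this is the usual one-sided limit, for an infinite one the limit at infinity.
\<close>

definition bracket_at_left_end :: "ereal \<Rightarrow> (real \<Rightarrow> complex ^ ('m::finite + 'm)) \<Rightarrow>
    (real \<Rightarrow> complex ^ ('m + 'm)) \<Rightarrow> complex"
  where "bracket_at_left_end a f g = Lim (at_right a) (\<lambda>x. bracket f g (real_of_ereal x))"

definition bracket_at_right_end :: "ereal \<Rightarrow> (real \<Rightarrow> complex ^ ('m::finite + 'm)) \<Rightarrow>
    (real \<Rightarrow> complex ^ ('m + 'm)) \<Rightarrow> complex"
  where "bracket_at_right_end b f g = Lim (at_left b) (\<lambda>x. bracket f g (real_of_ereal x))"

text \<open>
  \<open>fund_sol a b P W c0 l i\<close> is the \<open>i\<close>-th fundamental solution for the parameter \<open>l\<close>; like every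
  solution it is determined on $(a,b)$ by its value at \<open>c0\<close>.
\<close>

definition fund_sol :: "ereal \<Rightarrow> ereal \<Rightarrow> (real \<Rightarrow> complex ^ ('m::finite + 'm) ^ ('m + 'm)) \<Rightarrow>
    (real \<Rightarrow> complex ^ ('m + 'm) ^ ('m + 'm)) \<Rightarrow> real \<Rightarrow> complex \<Rightarrow> 'm + 'm \<Rightarrow>
    real \<Rightarrow> complex ^ ('m + 'm)"
  where "fund_sol a b P W c0 l i = (SOME y. ham_solution a b P W l y \<and> y c0 = axis i 1)"

definition bc_dom :: "ereal \<Rightarrow> ereal \<Rightarrow> (real \<Rightarrow> complex ^ ('m::finite + 'm) ^ ('m + 'm)) \<Rightarrow>
    (real \<Rightarrow> complex ^ ('m + 'm) ^ ('m + 'm)) \<Rightarrow> real \<Rightarrow>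
    complex ^ ('m + 'm) ^ ('m + 'm) \<Rightarrow> complex ^ ('m + 'm) ^ ('m + 'm) \<Rightarrow>
    (real \<Rightarrow> complex ^ ('m + 'm)) set set"
  where "bc_dom a b P W c0 M N = {y \<in> max_dom a b P W.
           M *v (\<chi> i. bracket_at_left_end a (max_rep a b P W y) (fund_sol a b P W c0 0 i))
         - N *v (\<chi> i. bracket_at_right_end b (max_rep a b P W y) (fund_sol a b P W c0 0 i)) = 0}"

definition eigenspace :: "ereal \<Rightarrow> ereal \<Rightarrow> (real \<Rightarrow> complex ^ ('m::finite + 'm) ^ ('m + 'm)) \<Rightarrow>
    (real \<Rightarrow> complex ^ ('m + 'm) ^ ('m + 'm)) \<Rightarrow>
    (real \<Rightarrow> complex ^ ('m + 'm)) set set \<Rightarrow> complex \<Rightarrow> (real \<Rightarrow> complex ^ ('m + 'm)) set set"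
  where "eigenspace a b P W D l = {y \<in> D. max_op a b P W y = L2_scale a b W l y}"

definition is_eigenvalue :: "ereal \<Rightarrow> ereal \<Rightarrow> (real \<Rightarrow> complex ^ ('m::finite + 'm) ^ ('m + 'm)) \<Rightarrow>
    (real \<Rightarrow> complex ^ ('m + 'm) ^ ('m + 'm)) \<Rightarrow>
    (real \<Rightarrow> complex ^ ('m + 'm)) set set \<Rightarrow> complex \<Rightarrow> bool"
  where "is_eigenvalue a b P W D l \<longleftrightarrow> (\<exists>y\<in>eigenspace a b P W D l. y \<noteq> L2_zero a b W)"

definition geometric_multiplicity :: "ereal \<Rightarrow> ereal \<Rightarrow>
    (real \<Rightarrow> complex ^ ('m::finite + 'm) ^ ('m + 'm)) \<Rightarrow>
    (real \<Rightarrow> complex ^ ('m + 'm) ^ ('m + 'm)) \<Rightarrow>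
    (real \<Rightarrow> complex ^ ('m + 'm)) set set \<Rightarrow> complex \<Rightarrow> enat"
  where "geometric_multiplicity a b P W D l =
           (SUP B\<in>{B. finite B \<and> B \<subseteq> eigenspace a b P W D l \<and> L2_independent a b W B}. enat (card B))"

text \<open>Row index \<open>j\<close>, column index \<open>i\<close>.\<close>

definition Phi_left :: "ereal \<Rightarrow> ereal \<Rightarrow> (real \<Rightarrow> complex ^ ('m::finite + 'm) ^ ('m + 'm)) \<Rightarrow>
    (real \<Rightarrow> complex ^ ('m + 'm) ^ ('m + 'm)) \<Rightarrow> real \<Rightarrow> complex \<Rightarrow> complex ^ ('m + 'm) ^ ('m + 'm)"
  where "Phi_left a b P W c0 l =
           (\<chi> j i. bracket_at_left_end a (fund_sol a b P W c0 l i) (fund_sol a b P W c0 0 j))"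

definition Phi_right :: "ereal \<Rightarrow> ereal \<Rightarrow> (real \<Rightarrow> complex ^ ('m::finite + 'm) ^ ('m + 'm)) \<Rightarrow>
    (real \<Rightarrow> complex ^ ('m + 'm) ^ ('m + 'm)) \<Rightarrow> real \<Rightarrow> complex \<Rightarrow> complex ^ ('m + 'm) ^ ('m + 'm)"
  where "Phi_right a b P W c0 l =
           (\<chi> j i. bracket_at_right_end b (fund_sol a b P W c0 l i) (fund_sol a b P W c0 0 j))"

definition Gamma_c :: "ereal \<Rightarrow> ereal \<Rightarrow> (real \<Rightarrow> complex ^ ('m::finite + 'm) ^ ('m + 'm)) \<Rightarrow>
    (real \<Rightarrow> complex ^ ('m + 'm) ^ ('m + 'm)) \<Rightarrow> real \<Rightarrow>
    complex ^ ('m + 'm) ^ ('m + 'm) \<Rightarrow> complex ^ ('m + 'm) ^ ('m + 'm) \<Rightarrow> complex \<Rightarrow> complex"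
  where "Gamma_c a b P W c0 M N l =
           det (M ** Phi_left a b P W c0 l - N ** Phi_right a b P W c0 l)"

end

theory Submission
  imports Defs
begin

text \<open>
  Let $Y_\lambda$ be the fundamental matrix of the system that is the identity at $c_0$. Writing
  $Y_\lambda = Y_0 U_\lambda$ turns the system into $J U' = \lambda A U$ with $A = Y_0^* W Y_0$.
  In the limit circle case $A$ is integrable on all of $(a,b)$, so $U_\lambda$ has limits at both
  endpoints which are entire in $\lambda$, and $\Gamma_c(\lambda) = \det F(\lambda)$ with
  $F(\lambda) = M J U_\lambda(a) - N J U_\lambda(b)$. Eigenfunctions for $\lambda_0$ correspond to the
  kernel of $F(\lambda_0)$. The order of the zero of $\det F$ equals the dimension of this kernel
  unless there are $v \neq 0$ and $w$ with $F(\lambda_0) v = 0$ and $F'(\lambda_0) v = F(\lambda_0) w$.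
  Differentiating Green's identity in $\lambda$ at the real point $\lambda_0$ and using that the
  boundary condition is isotropic for the boundary form, such a pair would give
  $\int v^* Y_{\lambda_0}^* W Y_{\lambda_0} v = 0$, contradicting definiteness.
  Non-real eigenvalues are excluded by Green's identity itself. The limit circle hypothesis is only
  available for non-real parameters; variation of constants with respect to the parameter
  \<open>\<i>\<close> transports it to \<open>0\<close>.
\<close>

section \<open>Absolutely continuous functions\<close>

text \<open>The coefficients are only locally integrable, so equations hold almost everywhere and
  solutions are absolutely continuous. Every conservation law therefore rests on two facts: an
  absolutely continuous function is the integral of its almost everywhere derivative, and an
  indefinite integral is absolutely continuous with the integrand as its derivative almost
  everywhere. One Picard series serves twice: at parameter 1 it yields the fundamental matrices, and
  as a power series in the parameter it yields the reduced matrix U and its entire end limits. The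
  base parameter is 0 because the boundary brackets are taken against the solutions for 0: from
  Y_0^* J Y_0 = J, the brackets of the solution Y v are the coordinates of J U v, so boundary values
  are plain limits of matrices. Reality of the eigenvalue l enters through the factor (l + h) - cnj
  l in Green's identity for the pair (l, l + h): it equals h, so division by h leaves the Gram
  matrix, and for h = 0 it vanishes, which removes the contribution of w.\<close>

lemma absolutely_cont_onD:
  assumes "absolutely_cont_on S f" "e > 0"
  obtains d where "d > 0"
    "\<And>D T. \<lbrakk>D division_of T; T \<subseteq> S; (\<Sum>K\<in>D. Sup K - Inf K) < d\<rbrakk> \<Longrightarrow>
        (\<Sum>K\<in>D. norm (f (Sup K) - f (Inf K))) < e"
  using assms unfolding absolutely_cont_on_def by metis

text \<open>Two tags can share an interval only if it has empty interior, and there the increment is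
  zero, so forgetting the tags loses nothing. The auxiliary \<open>?h\<close> is zero on the empty
  set, where \<open>Sup\<close> and \<open>Inf\<close> carry no information.\<close>

lemma sum_tagged_division_increments:
  fixes f :: "real \<Rightarrow> 'a::real_normed_vector"
  assumes "p tagged_division_of T"
  shows "(\<Sum>(x,K)\<in>p. norm (f (Sup K) - f (Inf K))) = (\<Sum>K\<in>snd ` p. norm (f (Sup K) - f (Inf K)))"
proof -
  let ?h = "\<lambda>K. if K = {} then 0 else norm (f (Sup K) - f (Inf K))"
  have ne: "K \<noteq> {}" if "(x,K) \<in> p" for x K
    using tagged_division_ofD(2)[OF assms that] by auto
  have "(\<Sum>(x,K)\<in>p. norm (f (Sup K) - f (Inf K))) = (\<Sum>(x,K)\<in>p. ?h K)"
    by (rule sum.cong) (use ne in auto)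
  also have "\<dots> = (\<Sum>K\<in>snd ` p. ?h K)"
    by (rule sum.over_tagged_division_lemma[OF assms]) auto
  also have "\<dots> = (\<Sum>K\<in>snd ` p. norm (f (Sup K) - f (Inf K)))"
    by (rule sum.cong) (use ne in force)+
  finally show ?thesis .
qed

lemma sum_tagged_division_lengths:
  fixes p :: "(real \<times> real set) set"
  assumes "p tagged_division_of T"
  shows "(\<Sum>K\<in>snd ` p. Sup K - Inf K) = measure lebesgue T"
proof -
  have "(\<Sum>K\<in>snd ` p. Sup K - Inf K) = (\<Sum>K\<in>snd ` p. measure lebesgue K)"
  proof (rule sum.cong[OF refl])
    fix K assume "K \<in> snd ` p"
    then obtain x where xK: "(x,K) \<in> p" by auto
    then obtain u v where K: "K = {u..v}" "x \<in> K"
      using tagged_division_ofD(4)[OF assms xK] tagged_division_ofD(2)[OF assms xK] by auto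
    then show "Sup K - Inf K = measure lebesgue K" by auto
  qed
  then show ?thesis
    using content_division[OF division_of_tagged_division[OF assms]] by simp
qed

text \<open>In the Henstock--Kurzweil sense no covering theorem is needed: intervals tagged in the exceptional
  null set are kept inside an open set of small measure, where absolute continuity controls them.\<close>

lemma absolutely_cont_on_has_integral:
  fixes f :: "real \<Rightarrow> 'a::banach"
  assumes ac: "absolutely_cont_on {c..d} f" and cd: "c \<le> d" and S: "negligible S"
    and deriv: "\<And>t. t \<in> {c..d} - S \<Longrightarrow> (f has_vector_derivative g t) (at t within {c..d})"
  shows "(g has_integral (f d - f c)) {c..d}"
proof -
  \<comment> \<open>The values of \<open>g\<close> on \<open>S\<close> are arbitrary and could spoil
    the Riemann sums; they are set to zero here and restored at the end by the spike rule.\<close>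
  define g' where "g' t = (if t \<in> S then 0 else g t)" for t
  have "(g' has_integral (f d - f c)) (cbox c d)"
    unfolding has_integral
  proof (intro allI impI)
    fix e :: real assume e: "e > 0"
    \<comment> \<open>An error of \<open>eps\<close> per unit length adds up to less than
      \<open>e / 2\<close>; the \<open>+ 1\<close> keeps the denominator positive when
      \<open>c = d\<close>.\<close>
    define eps where "eps = e / (2 * (d - c + 1))"
    have eps: "eps > 0" "eps * (d - c) < e / 2"
      using e cd by (auto simp: eps_def field_simps)
    obtain del where del: "del > 0"
      "\<And>D T. \<lbrakk>D division_of T; T \<subseteq> {c..d}; (\<Sum>K\<in>D. Sup K - Inf K) < del\<rbrakk> \<Longrightarrow>
        (\<Sum>K\<in>D. norm (f (Sup K) - f (Inf K))) < e / 2"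
      using absolutely_cont_onD[OF ac, of "e/2"] e by auto
    have Sm: "S \<in> sets lebesgue" using S by (simp add: negligible_imp_sets)
    obtain V where V: "open V" "S \<subseteq> V" "V - S \<in> lmeasurable" "emeasure lebesgue (V - S) < ennreal del"
      using sets_lebesgue_outer_open[OF Sm del(1)] by blast
    have mVS: "measure lebesgue (V - S) < del"
      using V(3,4) del(1) by (simp add: emeasure_eq_measure2 fmeasurableD2 ennreal_less_iff)
    have Vu: "V = (V - S) \<union> S" using V(2) by auto
    have Vm: "V \<in> lmeasurable" and mV: "measure lebesgue V < del"
    proof -
      show "V \<in> lmeasurable" by (subst Vu) (intro fmeasurable.Un V negligible_imp_measurable S)
      have "measure lebesgue V = measure lebesgue (V - S)"
        using S Vu by (metis measure_Un_null_set negligible_iff_null_sets V(3) fmeasurableD)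
      then show "measure lebesgue V < del" using mVS by simp
    qed
    have "\<forall>x\<in>{c..d} - S. \<exists>r>0. \<forall>y\<in>{c..d}. norm (y - x) < r \<longrightarrow>
             norm (f y - f x - (y - x) *\<^sub>R g x) \<le> eps * norm (y - x)"
      using deriv eps(1) unfolding has_vector_derivative_def has_derivative_within_alt by auto
    then obtain r where r: "\<And>x. x \<in> {c..d} - S \<Longrightarrow> r x > 0"
       "\<And>x y. \<lbrakk>x \<in> {c..d} - S; y \<in> {c..d}; norm (y - x) < r x\<rbrakk> \<Longrightarrow>
             norm (f y - f x - (y - x) *\<^sub>R g x) \<le> eps * norm (y - x)"
      by metis
    \<comment> \<open>Tags in \<open>S\<close> confine their interval to the small open set
      \<open>V\<close>; the other tags in \<open>{c..d}\<close> use the radius of differentiability.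
      Points outside \<open>{c..d}\<close> never occur as tags, but a gauge must be defined there
      too.\<close>
    define G where "G x = (if x \<in> S then V else if x \<in> {c..d} then ball x (r x) else ball x 1)" for x
    have gG: "gauge G"
      unfolding gauge_def G_def using r(1) V by auto
    have main: "norm ((\<Sum>(x, K)\<in>p. measure lborel K *\<^sub>R g' x) - (f d - f c)) < e"
      if p: "p tagged_division_of cbox c d" and fine: "G fine p" for p
    proof -
      note pD = tagged_division_ofD[OF p]
      let ?q = "{(x,K). (x,K) \<in> p \<and> x \<in> S}"
      have fin: "finite p" using pD(1) .
      have q: "?q \<subseteq> p" by auto
      have qpart: "?q tagged_partial_division_of cbox c d"
        using p unfolding tagged_division_of_def
        by (intro tagged_partial_division_subset[OF _ q]) simp
      have qdiv: "?q tagged_division_of \<Union>(snd ` ?q)"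
        using tagged_partial_division_of_Union_self[OF qpart] .
      have qsub: "\<Union>(snd ` ?q) \<subseteq> {c..d}" 
      proof (rule Union_least)
        fix K assume "K \<in> snd ` ?q"
        then obtain x where "(x,K) \<in> p" by auto
        from pD(3)[OF this] show "K \<subseteq> {c..d}" by simp
      qed
      have qV: "\<Union>(snd ` ?q) \<subseteq> V"
        using fine unfolding fine_def G_def by fastforce
      have "measure lebesgue (\<Union>(snd ` ?q)) \<le> measure lebesgue V"
        using qV Vm lmeasurable_division[OF division_of_tagged_division[OF qdiv]]
        by (intro measure_mono_fmeasurable) auto
      then have len: "(\<Sum>K\<in>snd ` ?q. Sup K - Inf K) < del"
        using sum_tagged_division_lengths[OF qdiv] mV by linarith
      have b2: "(\<Sum>(x,K)\<in>?q. norm (f (Sup K) - f (Inf K))) < e / 2"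
        unfolding sum_tagged_division_increments[OF qdiv]
        by (rule del(2)[OF division_of_tagged_division[OF qdiv] qsub len])
      have el: "norm (measure lborel K *\<^sub>R g' x - (f (Sup K) - f (Inf K))) \<le> eps * measure lborel K"
        if xK: "(x,K) \<in> p - ?q" for x K
      proof -
        obtain u v where K: "K = {u..v}" using pD(4)[of x K] xK by auto
        have x: "u \<le> x" "x \<le> v" using pD(2)[of x K] xK K by auto
        have xnS: "x \<notin> S" using xK by auto
        have sub: "{u..v} \<subseteq> {c..d}" using pD(3)[of x K] xK K by auto
        then have xin: "x \<in> {c..d} - S" and uin: "u \<in> {c..d}" and vin: "v \<in> {c..d}"
          using x xnS by auto
        have Kb: "K \<subseteq> ball x (r x)" using fine xK xin xnS unfolding fine_def G_def by fastforce
        have "u \<in> K" "v \<in> K" using K x by simp_all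
        then have "u \<in> ball x (r x)" "v \<in> ball x (r x)" using Kb by blast+
        then have "norm (u - x) < r x" "norm (v - x) < r x" by (auto simp: dist_real_def)
        then have 1: "norm (f u - f x - (u - x) *\<^sub>R g x) \<le> eps * norm (u - x)"
          and 2: "norm (f v - f x - (v - x) *\<^sub>R g x) \<le> eps * norm (v - x)"
          using r(2)[OF xin] uin vin by auto
        \<comment> \<open>Straddling: the tag lies between the end points of \<open>K\<close>, so
          the error is the difference of two linearization errors at the tag, whose bounds add up to
          \<open>eps\<close> times the length of \<open>K\<close>.\<close>
        have "measure lborel K *\<^sub>R g' x - (f (Sup K) - f (Inf K)) =
           (f u - f x - (u - x) *\<^sub>R g x) - (f v - f x - (v - x) *\<^sub>R g x)"
          using K x xnS by (simp add: g'_def algebra_simps)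
        also have "norm \<dots> \<le> eps * norm (u - x) + eps * norm (v - x)"
          by (rule norm_triangle_le_diff[OF add_mono[OF 1 2]])
        also have "\<dots> = eps * measure lborel K" using K x by (simp add: algebra_simps)
        finally show ?thesis .
      qed
      have "norm (\<Sum>(x,K)\<in>p - ?q. measure lborel K *\<^sub>R g' x - (f (Sup K) - f (Inf K)))
          \<le> (\<Sum>(x,K)\<in>p - ?q. eps * measure lborel K)"
        by (rule sum_norm_le) (use el in auto)
      also have "\<dots> \<le> (\<Sum>(x,K)\<in>p. eps * measure lborel K)"
        by (rule sum_mono2) (use fin eps in auto)
      also have "\<dots> = eps * (\<Sum>(x,K)\<in>p. measure lborel K)"
        by (simp add: sum_distrib_left split_def)
      also have "\<dots> = eps * (d - c)"
        using additive_content_tagged_division[OF p] cd by simp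
      finally have b1: "norm (\<Sum>(x,K)\<in>p - ?q. measure lborel K *\<^sub>R g' x - (f (Sup K) - f (Inf K))) < e / 2"
        using eps by linarith
      have b2': "norm (\<Sum>(x,K)\<in>?q. measure lborel K *\<^sub>R g' x - (f (Sup K) - f (Inf K))) < e / 2"
      proof -
        have "norm (\<Sum>(x,K)\<in>?q. measure lborel K *\<^sub>R g' x - (f (Sup K) - f (Inf K)))
           \<le> (\<Sum>(x,K)\<in>?q. norm (f (Sup K) - f (Inf K)))"
          by (rule sum_norm_le) (auto simp: g'_def norm_minus_commute)
        then show ?thesis using b2 by linarith
      qed
      have "(\<Sum>(x, K)\<in>p. measure lborel K *\<^sub>R g' x) - (f d - f c) =
         (\<Sum>(x,K)\<in>p. measure lborel K *\<^sub>R g' x - (f (Sup K) - f (Inf K)))"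
        using additive_tagged_division_1[OF cd, of p f] p
        by (simp add: sum_subtractf split_def)
      also have "\<dots> = (\<Sum>(x,K)\<in>p - ?q. measure lborel K *\<^sub>R g' x - (f (Sup K) - f (Inf K)))
          + (\<Sum>(x,K)\<in>?q. measure lborel K *\<^sub>R g' x - (f (Sup K) - f (Inf K)))"
        by (rule sum.subset_diff[OF q fin])
      also have "norm \<dots> < e"
        by (rule norm_triangle_lt) (use add_strict_mono[OF b1 b2'] in \<open>simp only: field_sum_of_halves\<close>)
      finally show ?thesis .
    qed
    show "\<exists>\<gamma>. gauge \<gamma> \<and> (\<forall>p. p tagged_division_of cbox c d \<and> \<gamma> fine p \<longrightarrow>
            norm ((\<Sum>(x, K)\<in>p. measure lborel K *\<^sub>R g' x) - (f d - f c)) < e)"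
      by (intro exI[of _ G] conjI gG allI impI) (elim conjE, rule main)
  qed
  then show ?thesis
    by (subst has_integral_spike_eq[OF S, of _ g' g]) (auto simp: g'_def)
qed

lemma absolutely_cont_on_imp_continuous_on:
  fixes f :: "real \<Rightarrow> 'a::real_normed_vector"
  assumes "absolutely_cont_on {c..d} f"
  shows "continuous_on {c..d} f"
  unfolding continuous_on_iff
proof (intro ballI allI impI)
  fix x e :: real assume x: "x \<in> {c..d}" and e: "0 < e"
  obtain del where del: "del > 0"
      "\<And>D T. \<lbrakk>D division_of T; T \<subseteq> {c..d}; (\<Sum>K\<in>D. Sup K - Inf K) < del\<rbrakk> \<Longrightarrow>
        (\<Sum>K\<in>D. norm (f (Sup K) - f (Inf K))) < e"
    using absolutely_cont_onD[OF assms e] by auto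
  have *: "norm (f v - f u) < e" if "c \<le> u" "u \<le> v" "v \<le> d" "v - u < del" for u v
    using del(2)[of "{{u..v}}" "{u..v}"] that division_of_self[of u v] by auto
  show "\<exists>r>0. \<forall>y\<in>{c..d}. dist y x < r \<longrightarrow> dist (f y) (f x) < e"
  proof (intro exI[of _ del] conjI ballI impI)
    fix y assume y: "y \<in> {c..d}" "dist y x < del"
    show "dist (f y) (f x) < e"
      using *[of x y] *[of y x] x y by (cases "x \<le> y") (auto simp: dist_norm norm_minus_commute)
  qed (use del in auto)
qed

lemma absolutely_cont_on_subset:
  "absolutely_cont_on S f \<Longrightarrow> T \<subseteq> S \<Longrightarrow> absolutely_cont_on T f"
  unfolding absolutely_cont_on_def by (meson order.trans)

text \<open>The common source of the closure properties: linear images, differences, bilinear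
  products and restrictions of equality only have to bound their increments by those of two known
  functions.\<close>

lemma absolutely_cont_on_lipschitz_image:
  fixes f :: "real \<Rightarrow> 'a::real_normed_vector" and h :: "real \<Rightarrow> 'b::real_normed_vector"
  assumes f: "absolutely_cont_on {c..d} f" and g: "absolutely_cont_on {c..d} g"
    and le: "\<And>u v. u \<in> {c..d} \<Longrightarrow> v \<in> {c..d} \<Longrightarrow> norm (h v - h u) \<le> B * (norm (f v - f u) + norm (g v - g u))"
    and B: "B \<ge> 0"
  shows "absolutely_cont_on {c..d} h"
  unfolding absolutely_cont_on_def
proof (intro allI impI)
  fix e :: real assume e: "e > 0"
  \<comment> \<open>Two functions contribute, hence the factor 2; \<open>B + 1\<close> avoids
    division by zero when \<open>B = 0\<close>.\<close>
  define e' where "e' = e / (2 * (B + 1))"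
  have e': "e' > 0" using e B by (simp add: e'_def)
  obtain d1 where d1: "d1 > 0"
      "\<And>D T. \<lbrakk>D division_of T; T \<subseteq> {c..d}; (\<Sum>K\<in>D. Sup K - Inf K) < d1\<rbrakk> \<Longrightarrow>
        (\<Sum>K\<in>D. norm (f (Sup K) - f (Inf K))) < e'"
    using absolutely_cont_onD[OF f e'] by auto
  obtain d2 where d2: "d2 > 0"
      "\<And>D T. \<lbrakk>D division_of T; T \<subseteq> {c..d}; (\<Sum>K\<in>D. Sup K - Inf K) < d2\<rbrakk> \<Longrightarrow>
        (\<Sum>K\<in>D. norm (g (Sup K) - g (Inf K))) < e'"
    using absolutely_cont_onD[OF g e'] by auto
  show "\<exists>r>0. \<forall>D T. D division_of T \<and> T \<subseteq> {c..d} \<and> (\<Sum>K\<in>D. Sup K - Inf K) < r \<longrightarrow>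
              (\<Sum>K\<in>D. norm (h (Sup K) - h (Inf K))) < e"
  proof (intro exI[of _ "min d1 d2"] conjI allI impI; (elim conjE)?)
    fix D T assume D: "D division_of T" "T \<subseteq> {c..d}" "(\<Sum>K\<in>D. Sup K - Inf K) < min d1 d2"
    have mem: "Sup K \<in> {c..d} \<and> Inf K \<in> {c..d}" if K: "K \<in> D" for K
    proof -
      obtain u v where "K = {u..v}" "K \<noteq> {}" "K \<subseteq> T"
        using division_ofD(2-4)[OF D(1) K] by auto
      then have "u \<le> v" "{u..v} \<subseteq> {c..d}" "K = {u..v}" using D(2) by (simp, blast, simp)
      then show ?thesis by simp
    qed
    have "(\<Sum>K\<in>D. norm (h (Sup K) - h (Inf K))) \<le>
       (\<Sum>K\<in>D. B * (norm (f (Sup K) - f (Inf K)) + norm (g (Sup K) - g (Inf K))))"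
      by (rule sum_mono) (use le mem in blast)
    also have "\<dots> = B * ((\<Sum>K\<in>D. norm (f (Sup K) - f (Inf K))) + (\<Sum>K\<in>D. norm (g (Sup K) - g (Inf K))))"
      by (simp only: sum_distrib_left[symmetric] sum.distrib)
    also have "\<dots> \<le> B * (e' + e')"
      using d1(2)[OF D(1,2)] d2(2)[OF D(1,2)] D(3) B
      by (intro mult_left_mono add_mono) auto
    also have "\<dots> = e * (B / (B + 1))"
      using B by (simp add: e'_def divide_simps)
    also have "\<dots> < e"
      using e B by (simp add: divide_simps)
    finally show "(\<Sum>K\<in>D. norm (h (Sup K) - h (Inf K))) < e" .
  qed (use d1 d2 in auto)
qed

lemma absolutely_cont_on_const: "absolutely_cont_on S (\<lambda>t. k)"
  unfolding absolutely_cont_on_def by (auto intro: exI[of _ 1])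

lemma absolutely_cont_on_bounded_linear:
  assumes "bounded_linear L" "absolutely_cont_on {c..d} f"
  shows "absolutely_cont_on {c..d} (\<lambda>t. L (f t))"
proof -
  interpret L: bounded_linear L by fact
  obtain K where K: "K \<ge> 0" "\<And>x. norm (L x) \<le> norm x * K" using L.nonneg_bounded by auto
  show ?thesis
    by (rule absolutely_cont_on_lipschitz_image[OF assms(2) absolutely_cont_on_const[of _ 0], of _ K])
       (use K in \<open>auto simp flip: L.diff simp: mult.commute\<close>)
qed

lemma absolutely_cont_on_diff:
  assumes "absolutely_cont_on {c..d} f" "absolutely_cont_on {c..d} g"
  shows "absolutely_cont_on {c..d} (\<lambda>t. f t - g t)"
proof (rule absolutely_cont_on_lipschitz_image[OF assms, of _ 1])
  fix u v
  have "f v - g v - (f u - g u) = (f v - f u) - (g v - g u)" by simp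
  then show "norm (f v - g v - (f u - g u)) \<le> 1 * (norm (f v - f u) + norm (g v - g u))"
    using norm_triangle_ineq4[of "f v - f u" "g v - g u"] by (simp only: mult_1)
qed auto

lemma absolutely_cont_on_bilinear:
  fixes prod :: "'a::real_normed_vector \<Rightarrow> 'b::real_normed_vector \<Rightarrow> 'c::real_normed_vector"
  assumes "bounded_bilinear prod" and f: "absolutely_cont_on {c..d} f" and g: "absolutely_cont_on {c..d} g"
  shows "absolutely_cont_on {c..d} (\<lambda>t. prod (f t) (g t))"
proof -
  interpret bounded_bilinear prod by fact
  obtain K where K: "K \<ge> 0" "\<And>a b. norm (prod a b) \<le> norm a * norm b * K" using nonneg_bounded by auto
  have "bounded (f ` {c..d})" "bounded (g ` {c..d})"
    using f g by (auto intro!: compact_imp_bounded compact_continuous_image absolutely_cont_on_imp_continuous_on)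
  then obtain A B where A: "\<And>t. t \<in> {c..d} \<Longrightarrow> norm (f t) \<le> A" and B: "\<And>t. t \<in> {c..d} \<Longrightarrow> norm (g t) \<le> B"
    unfolding bounded_iff by (meson imageI)
  show ?thesis
  proof (rule absolutely_cont_on_lipschitz_image[OF f g, of _ "K * (\<bar>A\<bar> + \<bar>B\<bar>)"])
    fix u v assume uv: "u \<in> {c..d}" "v \<in> {c..d}"
    have "prod (f v) (g v) - prod (f u) (g u) = prod (f v - f u) (g v) + prod (f u) (g v - g u)"
      by (simp add: diff_left diff_right)
    also have "norm \<dots> \<le> norm (f v - f u) * norm (g v) * K + norm (f u) * norm (g v - g u) * K"
      using K(2) by (meson add_mono norm_triangle_le)
    also have "\<dots> \<le> norm (f v - f u) * (\<bar>A\<bar> + \<bar>B\<bar>) * K + (\<bar>A\<bar> + \<bar>B\<bar>) * norm (g v - g u) * K"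
      using A[OF uv(1)] B[OF uv(2)] K(1) by (intro add_mono mult_mono) auto
    also have "\<dots> = K * (\<bar>A\<bar> + \<bar>B\<bar>) * (norm (f v - f u) + norm (g v - g u))"
      by (simp add: algebra_simps)
    finally show "norm (prod (f v) (g v) - prod (f u) (g u)) \<le> \<dots>" .
  qed (use K in auto)
qed

text \<open>Truncate the norm of \<open>g\<close> at a height \<open>n\<close> for which the excess
  has integral below \<open>e / 2\<close>. The truncated part contributes at most \<open>n\<close>
  times the measure of the set, which dictates the choice of \<open>del\<close>.\<close>

lemma absolutely_integrable_small_sets:
  fixes g :: "real \<Rightarrow> 'a::euclidean_space"
  assumes g: "g absolutely_integrable_on {c..d}" and e: "e > 0"
  obtains del where "del > 0"
    "\<And>T. \<lbrakk>T \<in> lmeasurable; T \<subseteq> {c..d}; measure lebesgue T < del\<rbrakk> \<Longrightarrow> integral T (\<lambda>t. norm (g t)) < e"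
proof -
  let ?h = "\<lambda>t. norm (g t)"
  have h: "?h absolutely_integrable_on {c..d}"
    using g by (rule absolutely_integrable_norm[unfolded o_def])
  have hn: "(\<lambda>t. min (?h t) (real n)) absolutely_integrable_on {c..d}" for n
    by (intro absolutely_integrable_min_1 h) auto
  have "(\<lambda>n. integral {c..d} (\<lambda>t. min (?h t) (real n))) \<longlonglongrightarrow> integral {c..d} ?h"
  proof (rule dominated_convergence(2)[where h = ?h])
    show "(\<lambda>t. min (norm (g t)) (real n)) integrable_on {c..d}" for n
      using hn set_lebesgue_integral_eq_integral(1) by blast
    show "(\<lambda>n. min (norm (g t)) (real n)) \<longlonglongrightarrow> norm (g t)" for t
    proof (rule tendsto_eventually)
      show "\<forall>\<^sub>F n in sequentially. min (norm (g t)) (real n) = norm (g t)"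
        using eventually_ge_at_top[of "nat \<lceil>norm (g t)\<rceil>"] by eventually_elim linarith
    qed
  qed (use h set_lebesgue_integral_eq_integral(1) in auto)
  then obtain n where n: "\<bar>integral {c..d} (\<lambda>t. min (?h t) (real n)) - integral {c..d} ?h\<bar> < e / 2"
    using e by (metis LIMSEQ_iff half_gt_zero order_refl real_norm_def)
  let ?r = "\<lambda>t. ?h t - min (?h t) (real n)"
  have r: "?r absolutely_integrable_on {c..d}"
    by (intro set_integral_diff h hn)
  have ri: "integral {c..d} ?r < e / 2"
    using abs_le_D2[OF less_imp_le[OF n]] abs_le_D1[OF less_imp_le[OF n]] n h hn[of n]
    by (subst integral_diff) (auto simp: set_lebesgue_integral_eq_integral(1) abs_if split: if_splits)
  show thesis
  proof
    show "e / (2 * (real n + 1)) > 0" using e by simp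
    fix T assume T: "T \<in> lmeasurable" "T \<subseteq> {c..d}" "measure lebesgue T < e / (2 * (real n + 1))"
    have sub: "f absolutely_integrable_on T" if "f absolutely_integrable_on {c..d}" for f :: "real \<Rightarrow> real"
      using that set_integrable_subset[OF that _ T(2)] T(1) by (simp add: fmeasurableD)
    have "integral T ?h = integral T ?r + integral T (\<lambda>t. min (?h t) (real n))"
      using sub[OF r] sub[OF hn[of n]]
      by (subst integral_add[symmetric]) (auto simp: set_lebesgue_integral_eq_integral(1))
    also have "integral T ?r \<le> integral {c..d} ?r"
      using sub[OF r] r T(2) by (intro integral_subset_le) (auto simp: set_lebesgue_integral_eq_integral(1))
    also have "integral T (\<lambda>t. min (?h t) (real n)) \<le> integral T (\<lambda>t. real n)"
      using sub[OF hn[of n]] T(1)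
      by (intro integral_le) (auto simp: set_lebesgue_integral_eq_integral(1) integrable_on_const)
    also have "integral T (\<lambda>t. real n) = real n * measure lebesgue T"
      using T(1) integral_mult_right[of T "real n" "\<lambda>x. 1"] by (simp add: lmeasure_integral)
    also have "\<dots> \<le> real n * (e / (2 * (real n + 1)))"
      using T(3) by (intro mult_left_mono) auto
    also have "\<dots> < e / 2"
      using e by (simp add: field_simps)
    finally show "integral T ?h < e" using ri by simp
  qed
qed

lemma absolutely_cont_on_integral:
  fixes g :: "real \<Rightarrow> 'a::euclidean_space"
  assumes g: "g absolutely_integrable_on {c..d}"
  shows "absolutely_cont_on {c..d} (\<lambda>t. integral {c..t} g)"
  unfolding absolutely_cont_on_def
proof (intro allI impI)
  fix e :: real assume e: "e > 0"
  obtain del where del: "del > 0"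
    "\<And>T. \<lbrakk>T \<in> lmeasurable; T \<subseteq> {c..d}; measure lebesgue T < del\<rbrakk> \<Longrightarrow> integral T (\<lambda>t. norm (g t)) < e"
    using absolutely_integrable_small_sets[OF g e] by metis
  show "\<exists>r>0. \<forall>D T. D division_of T \<and> T \<subseteq> {c..d} \<and> (\<Sum>K\<in>D. Sup K - Inf K) < r \<longrightarrow>
              (\<Sum>K\<in>D. norm (integral {c..Sup K} g - integral {c..Inf K} g)) < e"
  proof (intro exI[of _ del] conjI allI impI; (elim conjE)?)
    fix D T assume D: "D division_of T" "T \<subseteq> {c..d}" "(\<Sum>K\<in>D. Sup K - Inf K) < del"
    have Tm: "T \<in> lmeasurable" using D(1) lmeasurable_division by blast
    have gT: "g absolutely_integrable_on T"
      using set_integrable_subset[OF g _ D(2)] Tm by (simp add: fmeasurableD)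
    have K: "norm (integral {c..Sup K} g - integral {c..Inf K} g) \<le> integral K (\<lambda>t. norm (g t))
        \<and> Sup K - Inf K = measure lebesgue K" if KD: "K \<in> D" for K
    proof -
      obtain u v where "K = {u..v}" "K \<noteq> {}" "K \<subseteq> T"
        using division_ofD(2-4)[OF D(1) KD] by auto
      then have uv: "u \<le> v" "{u..v} \<subseteq> {c..d}" "K = {u..v}" using D(2) by (simp, blast, simp)
      then have cuvd: "c \<le> u" "v \<le> d" by simp_all
      have gK: "g absolutely_integrable_on {u..v}"
        using set_integrable_subset[OF g _ uv(2)] by simp
      have "integral {c..u} g + integral {u..v} g = integral {c..v} g"
        using uv cuvd set_lebesgue_integral_eq_integral(1)[OF g]
        by (intro Henstock_Kurzweil_Integration.integral_combine)
           (auto intro: integrable_on_subinterval)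
      then have "integral {c..v} g - integral {c..u} g = integral {u..v} g" by (simp add: algebra_simps)
      moreover have "norm (integral {u..v} g) \<le> integral {u..v} (\<lambda>t. norm (g t))"
        using gK by (intro integral_norm_bound_integral)
          (auto intro: set_lebesgue_integral_eq_integral(1) absolutely_integrable_norm[unfolded o_def])
      ultimately show ?thesis using uv by simp
    qed
    have "measure lebesgue T = (\<Sum>K\<in>D. measure lebesgue K)"
      using content_division[OF D(1)] by simp
    also have "\<dots> < del" using D(3) K by simp
    finally have "integral T (\<lambda>t. norm (g t)) < e" using del(2)[OF Tm D(2)] by simp
    moreover have "(\<Sum>K\<in>D. integral K (\<lambda>t. norm (g t))) = integral T (\<lambda>t. norm (g t))"
      using gT D(1) by (intro integral_combine_division_topdown[symmetric])
        (auto intro: set_lebesgue_integral_eq_integral(1) absolutely_integrable_norm[unfolded o_def])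
    moreover have "(\<Sum>K\<in>D. norm (integral {c..Sup K} g - integral {c..Inf K} g))
        \<le> (\<Sum>K\<in>D. integral K (\<lambda>t. norm (g t)))"
      by (rule sum_mono) (use K in blast)
    ultimately show "(\<Sum>K\<in>D. norm (integral {c..Sup K} g - integral {c..Inf K} g)) < e" by simp
  qed (use del in auto)
qed

text \<open>Henstock's lemma makes the total length of disjoint intervals on which the difference quotient
  is off by a fixed amount arbitrarily small; Vitali's theorem selects such intervals.\<close>

lemma integral_has_vector_derivative_almost_everywhere:
  fixes g :: "real \<Rightarrow> 'a::euclidean_space"
  assumes g: "g integrable_on {c..d}"
  obtains S where "negligible S"
    "\<And>t. t \<in> {c<..<d} - S \<Longrightarrow> ((\<lambda>t. integral {c..t} g) has_vector_derivative g t) (at t)"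
proof -
  define F where "F t = integral {c..t} g" for t
  \<comment> \<open>If the derivative of \<open>F\<close> at an interior point \<open>t\<close>
    fails to be \<open>g t\<close>, then for some \<open>n\<close> there are bad partners
    \<open>y\<close> arbitrarily close to \<open>t\<close>, so \<open>t\<close> lies in
    \<open>E n\<close>.\<close>
  define bad where "bad n t del \<longleftrightarrow> (\<exists>y\<in>{c..d}. y \<noteq> t \<and> \<bar>y - t\<bar> < del \<and>
       norm (F y - F t - (y - t) *\<^sub>R g t) > \<bar>y - t\<bar> / real (Suc n))" for n :: nat and t del
  define E where "E n = {t \<in> {c<..<d}. \<forall>del>0. bad n t del}" for n
  have Fdiff: "F v - F u = integral {u..v} g" if "c \<le> u" "u \<le> v" "v \<le> d" for u v
    using that Henstock_Kurzweil_Integration.integral_combine[of c u v g]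
      integrable_on_subinterval[OF g, of c v]
    by (simp add: F_def algebra_simps)
  have neg: "negligible (E n)" for n
    unfolding negligible_outer_le
  proof (intro allI impI)
    fix e :: real assume e: "e > 0"
    \<comment> \<open>Each selected interval contributes at least its length divided by
      \<open>Suc n\<close> to the sum in Henstock's lemma, so the total length is at most
      \<open>Suc n\<close> times \<open>e'\<close>, which is \<open>e\<close>.\<close>
    define e' where "e' = e / real (Suc n)"
    have e': "e' > 0" using e by (simp add: e'_def)
    obtain G where G: "gauge G" "\<And>p. \<lbrakk>p tagged_partial_division_of cbox c d; G fine p\<rbrakk> \<Longrightarrow>
         (\<Sum>(x,k)\<in>p. norm (measure lborel k *\<^sub>R g x - integral k g)) < e'"
      using Henstock_lemma[OF _ e', of g c d] g by auto
    \<comment> \<open>The covering theorem is stated for balls, so the segment between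
      \<open>t\<close> and \<open>y\<close> is presented as the closed ball about its midpoint with
      half its length as radius.\<close>
    define I where "I = (\<lambda>(t::real,y::real). {min t y..max t y})"
    define a where "a = (\<lambda>(t::real,y::real). (t + y) / 2)"
    define r where "r = (\<lambda>(t::real,y::real). \<bar>y - t\<bar> / 2)"
    have cb: "cball (a i) (r i) = I i" for i
      by (cases i) (auto simp: a_def r_def I_def cball_eq_atLeastAtMost min_def max_def field_simps)
    define K where "K = {(t,y). t \<in> E n \<and> y \<in> {c..d} \<and> y \<noteq> t \<and> I (t,y) \<subseteq> G t \<and>
         norm (F y - F t - (y - t) *\<^sub>R g t) > \<bar>y - t\<bar> / real (Suc n)}"
    obtain C where C: "countable C" "C \<subseteq> K"
        "pairwise (\<lambda>i j. disjnt (cball (a i) (r i)) (cball (a j) (r j))) C"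
        "negligible (E n - (\<Union>i\<in>C. cball (a i) (r i)))"
    proof (rule Vitali_covering_theorem_cballs[of K r "E n" a])
      show "0 < r i" if "i \<in> K" for i
        using that by (auto simp: K_def r_def)
      fix x del :: real assume x: "x \<in> E n" and del: "0 < del"
      have "open (G x)" "x \<in> G x" using G(1) by (auto simp: gauge_def)
      then obtain s where s: "s > 0" "ball x s \<subseteq> G x" by (auto elim: openE)
      have ms: "min s del > 0" using s del by simp
      have "bad n x (min s del)" using x ms unfolding E_def by blast
      then obtain y where y: "y \<in> {c..d}" "y \<noteq> x" "\<bar>y - x\<bar> < min s del"
          "norm (F y - F x - (y - x) *\<^sub>R g x) > \<bar>y - x\<bar> / real (Suc n)"
        unfolding bad_def by blast
      have "I (x,y) \<subseteq> ball x s"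
        using y(3) by (auto simp: I_def dist_real_def)
      then have "(x,y) \<in> K" using x y s by (auto simp: K_def)
      moreover have "x \<in> cball (a (x,y)) (r (x,y))" unfolding cb by (auto simp: I_def)
      moreover have "r (x,y) < del" using y(3) by (auto simp: r_def)
      ultimately show "\<exists>i. i \<in> K \<and> x \<in> cball (a i) (r i) \<and> r i < del" by blast
    qed
    note C = C[unfolded cb]
    \<comment> \<open>Henstock's lemma speaks of finite partial divisions; a bound that is uniform
      over finite subfamilies then passes to the countable union.\<close>
    have len: "measure lebesgue (\<Union>i\<in>C'. I i) \<le> e" if C': "C' \<subseteq> C" "finite C'" for C'
    proof -
      let ?p = "(\<lambda>i. (fst i, I i)) ` C'"
      have ne: "I i \<noteq> {}" for i by (cases i) (auto simp: I_def)
      have inj: "inj_on (\<lambda>i. (fst i, I i)) C'"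
      proof (rule inj_onI)
        fix i j assume ij: "i \<in> C'" "j \<in> C'" "(fst i, I i) = (fst j, I j)"
        show "i = j"
        proof (rule ccontr)
          assume "i \<noteq> j"
          then have "I i \<inter> I j = {}"
            using C(3) C'(1) ij(1,2) unfolding pairwise_def disjnt_def by blast
          then show False using ij(3) ne[of j] by simp
        qed
      qed
      have KE: "fst i \<in> {c<..<d}" "snd i \<in> {c..d}" if "i \<in> C'" for i
      proof -
        have "i \<in> K" using that C' C(2) by blast
        then show "fst i \<in> {c<..<d}" "snd i \<in> {c..d}" by (auto simp: K_def E_def)
      qed
      have p: "?p tagged_partial_division_of cbox c d"
        unfolding tagged_partial_division_of_def
      proof (intro conjI allI impI)
        show "finite ?p" using C' by simp
      next
        fix x k assume "(x,k) \<in> ?p"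
        then obtain i where i: "i \<in> C'" "x = fst i" "k = I i" by auto
        show "x \<in> k" using i by (cases i) (auto simp: I_def)
        show "k \<subseteq> cbox c d" using i KE[OF i(1)] by (cases i) (auto simp: I_def)
        show "\<exists>a b. k = cbox a b" using i by (cases i) (auto simp: I_def)
      next
        fix x1 k1 x2 k2 assume *: "(x1,k1) \<in> ?p \<and> (x2,k2) \<in> ?p \<and> (x1,k1) \<noteq> (x2,k2)"
        then obtain i j where ij: "i \<in> C'" "j \<in> C'" "k1 = I i" "k2 = I j" "i \<noteq> j" by auto
        then have "I i \<inter> I j = {}" using C(3) C'(1) unfolding pairwise_def disjnt_def by blast
        then show "interior k1 \<inter> interior k2 = {}"
          using ij interior_subset by blast
      qed
      have fine: "G fine ?p"
        unfolding fine_def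
      proof (clarify)
        fix i y assume i: "i \<in> C'" and y: "y \<in> I i"
        have "i \<in> K" using i C' C(2) by blast
        then have "I i \<subseteq> G (fst i)" unfolding K_def by (cases i) simp
        then show "y \<in> G (fst i)" using y by blast
      qed
      have each: "measure lebesgue (I i) \<le> real (Suc n) * norm (measure lborel (I i) *\<^sub>R g (fst i) - integral (I i) g)"
        if i: "i \<in> C'" for i
      proof -
        obtain t y where ty: "i = (t,y)" by (cases i)
        have iK: "(t,y) \<in> K" using i ty C' C(2) by blast
        then have t: "c < t" "t < d" "c \<le> y" "y \<le> d" and
           big: "norm (F y - F t - (y - t) *\<^sub>R g t) > \<bar>y - t\<bar> / real (Suc n)"
          by (auto simp: K_def E_def)
        have "norm (measure lborel (I i) *\<^sub>R g t - integral (I i) g) = norm (F y - F t - (y - t) *\<^sub>R g t)"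
        proof (cases "t \<le> y")
          case True
          then show ?thesis using Fdiff[of t y] t by (simp add: I_def ty norm_minus_commute)
        next
          case False
          then have "F y - F t - (y - t) *\<^sub>R g t = (t - y) *\<^sub>R g t - integral {y..t} g"
            using Fdiff[of y t] t by (simp add: algebra_simps)
          then show ?thesis using False by (simp add: I_def ty)
        qed
        moreover have "measure lebesgue (I i) = \<bar>y - t\<bar>" by (simp add: I_def ty min_def max_def)
        ultimately show ?thesis using big ty by (simp add: field_simps)
      qed
      have "measure lebesgue (\<Union>i\<in>C'. I i) \<le> (\<Sum>i\<in>C'. measure lebesgue (I i))"
        by (rule measure_UNION_le[OF C'(2)]) (auto simp: I_def)
      also have "\<dots> \<le> (\<Sum>i\<in>C'. real (Suc n) * norm (measure lborel (I i) *\<^sub>R g (fst i) - integral (I i) g))"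
        by (rule sum_mono) (rule each)
      also have "\<dots> = real (Suc n) * (\<Sum>(x,k)\<in>?p. norm (measure lborel k *\<^sub>R g x - integral k g))"
        by (simp only: sum.reindex[OF inj] o_def case_prod_conv sum_distrib_left)
      also have "\<dots> \<le> real (Suc n) * e'"
        using G(2)[OF p fine] by (intro mult_left_mono) auto
      also have "\<dots> = e" by (simp add: e'_def)
      finally show ?thesis .
    qed
    have Im: "I i \<in> lmeasurable" for i by (cases i) (simp add: I_def)
    have Um: "(\<Union>i\<in>C. I i) \<in> lmeasurable" "measure lebesgue (\<Union>i\<in>C. I i) \<le> e"
      using fmeasurable_UN_bound[OF C(1) Im len] measure_UN_bound[OF C(1) Im len] by blast+
    let ?T = "(\<Union>i\<in>C. I i) \<union> (E n - (\<Union>i\<in>C. I i))"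
    have "measure lebesgue ?T = measure lebesgue (\<Union>i\<in>C. I i)"
      using C(4) Um(1) by (intro measure_Un_null_set) (auto simp: negligible_iff_null_sets fmeasurableD)
    then have "measure lebesgue ?T \<le> e" using Um(2) by (simp only:)
    moreover have "?T \<in> lmeasurable"
      by (rule fmeasurable.Un[OF Um(1) negligible_imp_measurable[OF C(4)]])
    moreover have "E n \<subseteq> ?T" by blast
    ultimately show "\<exists>T. E n \<subseteq> T \<and> T \<in> lmeasurable \<and> measure lebesgue T \<le> e"
      by blast
  qed
  show thesis
  proof
    show "negligible (\<Union>n. E n)" by (rule negligible_Union_nat[OF neg])
    fix t assume t: "t \<in> {c<..<d} - (\<Union>n. E n)"
    have "(F has_vector_derivative g t) (at t within {c..d})"
      unfolding has_vector_derivative_def has_derivative_within_alt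
    proof (intro conjI allI impI)
      show "bounded_linear (\<lambda>x. x *\<^sub>R g t)" by (rule bounded_linear_scaleR_left)
      fix e :: real assume "e > 0"
      then obtain n where n: "1 / real (Suc n) < e" using nat_approx_posE by blast
      have "t \<notin> E n" using t by auto
      then obtain del where "del > 0" "\<not> bad n t del"
        using t unfolding E_def by blast
      then have del: "del > 0" "\<And>y. \<lbrakk>y \<in> {c..d}; y \<noteq> t; \<bar>y - t\<bar> < del\<rbrakk> \<Longrightarrow>
          norm (F y - F t - (y - t) *\<^sub>R g t) \<le> \<bar>y - t\<bar> / real (Suc n)"
        unfolding bad_def not_less[symmetric, of "norm _"] by blast+
      have "norm (F y - F t - (y - t) *\<^sub>R g t) \<le> e * norm (y - t)" if "y \<in> {c..d}" "norm (y - t) < del" for y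
      proof (cases "y = t")
        case False
        then have "norm (F y - F t - (y - t) *\<^sub>R g t) \<le> (1 / real (Suc n)) * \<bar>y - t\<bar>"
          using del(2)[of y] that by simp
        also have "\<dots> \<le> e * \<bar>y - t\<bar>" using n by (intro mult_right_mono) auto
        finally show ?thesis by simp
      qed simp
      then show "\<exists>del>0. \<forall>y\<in>{c..d}. norm (y - t) < del \<longrightarrow>
          norm (F y - F t - (y - t) *\<^sub>R g t) \<le> e * norm (y - t)"
        using del(1) by blast
    qed
    moreover have "at t within {c..d} = at t" using t by (intro at_within_interior) auto
    ultimately show "((\<lambda>t. integral {c..t} g) has_vector_derivative g t) (at t)"
      by (simp add: F_def[abs_def])
  qed
qed

section \<open>Signed integrals and local absolute continuity on intervals with extended real end
  points\<close>

lemma AE_lebesgue_iff_negligible: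
  "(AE t in lebesgue. P t) \<longleftrightarrow> negligible {t. \<not> P t}"
proof
  assume "AE t in lebesgue. P t"
  then obtain N where "{t \<in> space lebesgue. \<not> P t} \<subseteq> N" "N \<in> null_sets lebesgue"
    unfolding eventually_ae_filter by blast
  then show "negligible {t. \<not> P t}"
    by (auto simp: negligible_iff_null_sets intro: negligible_subset[unfolded negligible_iff_null_sets])
next
  assume "negligible {t. \<not> P t}"
  then show "AE t in lebesgue. P t"
    unfolding eventually_ae_filter negligible_iff_null_sets by force
qed

text \<open>The signed integral from \<open>c\<close> to \<open>t\<close>: the integral over the
  reversed interval is zero, so a single formula covers both sides of \<open>c\<close> without a
  case distinction.\<close>

definition oriented_integral :: "real \<Rightarrow> (real \<Rightarrow> 'a::euclidean_space) \<Rightarrow> real \<Rightarrow> 'a"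
  where "oriented_integral c g t = integral {c..t} g - integral {t..c} g"

lemma oriented_integral_self [simp]: "oriented_integral c g c = 0"
  by (simp add: oriented_integral_def)

lemma oriented_integral_eq:
  assumes "g integrable_on {p..q}" "c \<in> {p..q}" "t \<in> {p..q}"
  shows "oriented_integral c g t = integral {p..t} g - integral {p..c} g"
proof (cases "c \<le> t")
  case True
  have "integral {p..c} g + integral {c..t} g = integral {p..t} g"
    using assms True by (intro Henstock_Kurzweil_Integration.integral_combine)
      (auto intro: integrable_on_subinterval)
  moreover have "integral {t..c} g = 0" using True by (cases "c = t") auto
  ultimately show ?thesis by (simp add: oriented_integral_def algebra_simps)
next
  case False
  have "integral {p..t} g + integral {t..c} g = integral {p..c} g"
    using assms False by (intro Henstock_Kurzweil_Integration.integral_combine)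
      (auto intro: integrable_on_subinterval)
  then show ?thesis using False by (simp add: oriented_integral_def algebra_simps)
qed

lemma einterval_subinterval:
  assumes "a < ereal c" "ereal d < b" shows "{c..d} \<subseteq> einterval a b"
  using assms by (auto simp: einterval_def)
     (metis ereal_less_eq(3) less_le_trans, metis ereal_less_eq(3) le_less_trans)

lemma einterval_inner:
  assumes "t \<in> einterval a b"
  obtains p q where "a < ereal p" "p < t" "t < q" "ereal q < b"
proof -
  have "a < ereal t" "ereal t < b" using assms by (auto simp: einterval_def)
  then obtain p' q' where "a < ereal p'" "ereal p' < ereal t" "ereal t < ereal q'" "ereal q' < b"
    using ereal_dense2 by meson
  then show thesis using that by auto
qed

lemma einterval_exhaustion:
  assumes "c \<in> einterval a b"
  obtains p q :: "nat \<Rightarrow> real" where "\<And>n. a < ereal (p n)" "\<And>n. ereal (q n) < b" "\<And>n. p n \<le> c" "\<And>n. c \<le> q n"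
    "\<And>t. t \<in> einterval a b \<Longrightarrow> \<exists>n. p n < t \<and> t < q n"
proof -
  have ac: "a < ereal c" "ereal c < b" using assms by (auto simp: einterval_def)
  obtain u l :: "nat \<Rightarrow> real" where ul: "einterval a b = (\<Union>i. {l i .. u i})" "incseq u" "decseq l"
    "\<And>i. l i < u i" "\<And>i. a < ereal (l i)" "\<And>i. ereal (u i) < b"
    "(\<lambda>i. ereal (l i)) \<longlonglongrightarrow> a" "(\<lambda>i. ereal (u i)) \<longlonglongrightarrow> b"
    by (rule einterval_Icc_approximation[OF less_trans[OF ac]]) (rule that; assumption)
  \<comment> \<open>Taking \<open>min\<close> and \<open>max\<close> with \<open>c\<close> puts
    \<open>c\<close> into every interval of the exhaustion, not only into the late ones.\<close>
  show thesis
  proof (rule that[of "\<lambda>n. min (l n) c" "\<lambda>n. max (u n) c"])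
    fix t assume "t \<in> einterval a b"
    then have t: "a < ereal t" "ereal t < b" by (auto simp: einterval_def)
    have "\<forall>\<^sub>F n in sequentially. ereal (l n) < ereal t \<and> ereal t < ereal (u n)"
      using order_tendstoD(2)[OF ul(7) t(1)] order_tendstoD(1)[OF ul(8) t(2)]
      by (rule eventually_conj)
    then obtain n where "l n < t" "t < u n" by (auto simp: eventually_sequentially)
    then show "\<exists>n. min (l n) c < t \<and> t < max (u n) c" by (intro exI[of _ n]) auto
  qed (use ul(5,6) ac in \<open>auto simp: min_def max_def\<close>)
qed

lemma locally_integrableD:
  "locally_integrable a b g \<Longrightarrow> a < ereal p \<Longrightarrow> ereal q < b \<Longrightarrow> g absolutely_integrable_on {p..q}"
  unfolding locally_integrable_def by blast

lemma locally_absolutely_contD: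
  "locally_absolutely_cont a b f \<Longrightarrow> a < ereal p \<Longrightarrow> ereal q < b \<Longrightarrow> absolutely_cont_on {p..q} f"
  unfolding locally_absolutely_cont_def by blast

lemma locally_absolutely_contI:
  assumes c: "c \<in> einterval a b"
    and "\<And>p q. a < ereal p \<Longrightarrow> ereal q < b \<Longrightarrow> p \<le> c \<Longrightarrow> c \<le> q \<Longrightarrow> absolutely_cont_on {p..q} f"
  shows "locally_absolutely_cont a b f"
  unfolding locally_absolutely_cont_def
proof (intro allI impI)
  fix p q assume "a < ereal p \<and> ereal q < b"
  then have "absolutely_cont_on {min p c..max q c} f"
    using c by (intro assms(2)) (auto simp: einterval_def min_def max_def)
  then show "absolutely_cont_on {p..q} f"
    by (rule absolutely_cont_on_subset) auto
qed

lemma locally_absolutely_cont_isCont: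
  fixes f :: "real \<Rightarrow> 'a::real_normed_vector"
  assumes "locally_absolutely_cont a b f" "t \<in> einterval a b"
  shows "isCont f t"
proof -
  obtain p q where pq: "a < ereal p" "p < t" "t < q" "ereal q < b"
    using einterval_inner[OF assms(2)] .
  have "continuous_on {p..q} f"
    using absolutely_cont_on_imp_continuous_on[OF locally_absolutely_contD[OF assms(1) pq(1,4)]] .
  then show ?thesis
    using pq(2,3) by (intro continuous_on_interior[of "{p..q}"]) auto
qed

lemma locally_absolutely_cont_continuous_on:
  fixes f :: "real \<Rightarrow> 'a::real_normed_vector"
  shows "locally_absolutely_cont a b f \<Longrightarrow> continuous_on (einterval a b) f"
  by (intro continuous_at_imp_continuous_on ballI) (rule locally_absolutely_cont_isCont)

lemma locally_absolutely_cont_bilinear: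
  fixes prod :: "'a::real_normed_vector \<Rightarrow> 'b::real_normed_vector \<Rightarrow> 'c::real_normed_vector"
  assumes "bounded_bilinear prod" "locally_absolutely_cont a b f" "locally_absolutely_cont a b g"
  shows "locally_absolutely_cont a b (\<lambda>t. prod (f t) (g t))"
  using assms absolutely_cont_on_bilinear unfolding locally_absolutely_cont_def by blast

lemma locally_absolutely_cont_bounded_linear:
  assumes "bounded_linear L" "locally_absolutely_cont a b f"
  shows "locally_absolutely_cont a b (\<lambda>t. L (f t))"
  using assms absolutely_cont_on_bounded_linear unfolding locally_absolutely_cont_def by blast

lemma locally_absolutely_cont_diff:
  assumes "locally_absolutely_cont a b f" "locally_absolutely_cont a b g"
  shows "locally_absolutely_cont a b (\<lambda>t. f t - g t)"
  using assms absolutely_cont_on_diff unfolding locally_absolutely_cont_def by blast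

lemma locally_absolutely_cont_const: "locally_absolutely_cont a b (\<lambda>t. k)"
  unfolding locally_absolutely_cont_def by (simp add: absolutely_cont_on_const)

lemma locally_absolutely_cont_add:
  assumes "locally_absolutely_cont a b f" "locally_absolutely_cont a b g"
  shows "locally_absolutely_cont a b (\<lambda>t. f t + g t)"
proof -
  have "locally_absolutely_cont a b (\<lambda>t. f t - (- g t))"
    by (intro locally_absolutely_cont_diff locally_absolutely_cont_bounded_linear[of uminus]
          bounded_linear_minus bounded_linear_ident assms)
  then show ?thesis by simp
qed

lemma absolutely_cont_on_transform:
  assumes "absolutely_cont_on {p..q} f" "\<And>t. t \<in> {p..q} \<Longrightarrow> g t = f t"
  shows "absolutely_cont_on {p..q} g"
  by (rule absolutely_cont_on_lipschitz_image[OF assms(1) absolutely_cont_on_const[of _ 0], of _ 1])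
     (use assms(2) in auto)

lemma locally_absolutely_cont_transform:
  assumes "locally_absolutely_cont a b f" "\<And>t. t \<in> einterval a b \<Longrightarrow> g t = f t"
  shows "locally_absolutely_cont a b g"
  unfolding locally_absolutely_cont_def
proof (intro allI impI)
  fix p q assume "a < ereal p \<and> ereal q < b"
  then show "absolutely_cont_on {p..q} g"
    using absolutely_cont_on_transform[OF locally_absolutely_contD[OF assms(1)]]
      einterval_subinterval[of a p q b] assms(2) by blast
qed

lemma locally_absolutely_cont_oriented_integral:
  assumes "locally_integrable a b g" "c \<in> einterval a b"
  shows "locally_absolutely_cont a b (oriented_integral c g)"
proof (rule locally_absolutely_contI[OF assms(2)])
  fix p q assume pq: "a < ereal p" "ereal q < b" "p \<le> c" "c \<le> q"
  have g: "g absolutely_integrable_on {p..q}" using locally_integrableD[OF assms(1) pq(1,2)] .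
  show "absolutely_cont_on {p..q} (oriented_integral c g)"
    by (rule absolutely_cont_on_transform[OF absolutely_cont_on_diff[OF absolutely_cont_on_integral[OF g]
            absolutely_cont_on_const]])
       (use oriented_integral_eq[OF set_lebesgue_integral_eq_integral(1)[OF g]] pq in auto)
qed

text \<open>Along an exhausting sequence of compact intervals the exceptional sets are null, hence
  so is their countable union; on each interval the oriented integral differs from the one with
  fixed lower limit by a constant.\<close>

lemma oriented_integral_has_vector_derivative:
  assumes "locally_integrable a b g" and c: "c \<in> einterval a b"
  shows "AE t in lebesgue. t \<in> einterval a b \<longrightarrow> (oriented_integral c g has_vector_derivative g t) (at t)"
proof -
 obtain p q :: "nat \<Rightarrow> real" where pq: "\<And>n. a < ereal (p n)" "\<And>n. ereal (q n) < b" "\<And>n. p n \<le> c" "\<And>n. c \<le> q n"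
    "\<And>t. t \<in> einterval a b \<Longrightarrow> \<exists>n. p n < t \<and> t < q n"
    by (rule einterval_exhaustion[OF c]) (rule that; assumption)
  have gi: "g integrable_on {p n..q n}" for n
    using locally_integrableD[OF assms(1) pq(1,2)] set_lebesgue_integral_eq_integral(1) by blast
  have "\<exists>S. negligible S \<and> (\<forall>t\<in>{p n<..<q n} - S. ((\<lambda>t. integral {p n..t} g) has_vector_derivative g t) (at t))" for n
    using integral_has_vector_derivative_almost_everywhere[OF gi[of n]] by metis
  then obtain S where S: "\<And>n. negligible (S n)"
    "\<And>n t. t \<in> {p n<..<q n} - S n \<Longrightarrow> ((\<lambda>t. integral {p n..t} g) has_vector_derivative g t) (at t)"
    by metis
  have "(oriented_integral c g has_vector_derivative g t) (at t)"
    if t: "t \<in> einterval a b" "t \<notin> (\<Union>n. S n)" for t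
  proof -
    obtain n where n: "p n < t" "t < q n" using pq(5)[OF t(1)] by blast
    have "((\<lambda>t. integral {p n..t} g - integral {p n..c} g) has_vector_derivative g t - 0) (at t)"
      using S(2)[of t n] t n by (intro has_vector_derivative_diff has_vector_derivative_const) auto
    then have "((\<lambda>t. integral {p n..t} g - integral {p n..c} g) has_vector_derivative g t) (at t)"
      by simp
    then show ?thesis
    proof (rule has_vector_derivative_transform_within_open)
      show "open {p n<..<q n}" "t \<in> {p n<..<q n}" using n by auto
      fix x assume "x \<in> {p n<..<q n}"
      then show "integral {p n..x} g - integral {p n..c} g = oriented_integral c g x"
        using oriented_integral_eq[OF gi[of n], of c x] pq(3,4)[of n] by auto
    qed
  qed
  then have "{t. \<not> (t \<in> einterval a b \<longrightarrow> (oriented_integral c g has_vector_derivative g t) (at t))} \<subseteq> (\<Union>n. S n)"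
    by blast
  then show ?thesis
    unfolding AE_lebesgue_iff_negligible
    by (rule negligible_subset[OF negligible_Union_nat[OF S(1)]])
qed

lemma locally_absolutely_cont_has_integral:
  fixes f :: "real \<Rightarrow> 'a::banach"
  assumes "locally_absolutely_cont a b f"
    and "AE t in lebesgue. t \<in> einterval a b \<longrightarrow> (f has_vector_derivative g t) (at t)"
    and pq: "a < ereal p" "ereal q < b" "p \<le> q"
  shows "(g has_integral (f q - f p)) {p..q}"
proof (rule absolutely_cont_on_has_integral)
  show "absolutely_cont_on {p..q} f" using assms unfolding locally_absolutely_cont_def by blast
  show "negligible {t. \<not> (t \<in> einterval a b \<longrightarrow> (f has_vector_derivative g t) (at t))}"
    using assms(2) unfolding AE_lebesgue_iff_negligible .
  fix t assume "t \<in> {p..q} - {t. \<not> (t \<in> einterval a b \<longrightarrow> (f has_vector_derivative g t) (at t))}"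
  then show "(f has_vector_derivative g t) (at t within {p..q})"
    using einterval_subinterval[OF pq(1,2)] by (auto intro: has_vector_derivative_at_within)
qed (use pq in auto)

text \<open>Absolute continuity excludes functions of Cantor type. This is how the constancy of
  pairings of solutions is derived from identities valid only almost everywhere.\<close>

lemma locally_absolutely_cont_zero_derivative:
  fixes f :: "real \<Rightarrow> 'a::banach"
  assumes "locally_absolutely_cont a b f"
    and "AE t in lebesgue. t \<in> einterval a b \<longrightarrow> (f has_vector_derivative 0) (at t)"
    and "s \<in> einterval a b" "t \<in> einterval a b"
  shows "f s = f t"
proof -
  have *: "f q = f p" if "p \<in> einterval a b" "q \<in> einterval a b" "p \<le> q" for p q
    using has_integral_unique[OF locally_absolutely_cont_has_integral[OF assms(1,2)] has_integral_0, of p q] that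
    by (auto simp: einterval_def)
  show ?thesis using *[of s t] *[of t s] assms(3,4) by (cases "s \<le> t") auto
qed

section \<open>Linear equations with locally integrable coefficients\<close>

text \<open>Complex multiples of matrices are written as products with \<open>mat l\<close>, since
  \<open>scaleR\<close> multiplies by reals only; this rule reduces such identities to
  entries.\<close>

lemma mat_mult_nth [simp]: "(mat l ** (A :: complex ^ 'n ^ 'n::finite)) $ i $ j = l * A $ i $ j"
  by (simp add: matrix_matrix_mult_def mat_def if_distrib[of "\<lambda>x. x * _"] cong: if_cong)

lemma mult_mat_nth [simp]: "((A :: complex ^ 'n ^ 'n::finite) ** mat l) $ i $ j = l * A $ i $ j"
  by (simp add: matrix_matrix_mult_def mat_def if_distrib[of "\<lambda>x. _ * x"] cong: if_cong)

lemma mat_commute: "mat l ** (A :: complex ^ 'n ^ 'n::finite) = A ** mat l"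
  by (simp add: vec_eq_iff)

lemma matrix_mult_mat_left: "(A :: complex ^ 'n ^ 'n) ** (mat x ** B) = mat x ** (A ** (B :: complex ^ 'n ^ 'n::finite))"
  by (metis mat_commute matrix_mul_assoc)

lemma mat_vector_mult: "mat l *v (x :: complex ^ 'n::finite) = l *s x"
  by (simp add: vec_eq_iff matrix_vector_mult_def mat_def if_distrib[of "\<lambda>x. x * _"] cong: if_cong)

lemma mat_mult_mat: "mat k ** mat l = (mat (k * l) :: complex ^ 'n ^ 'n::finite)"
  by (simp add: vec_eq_iff) (simp add: mat_def)

text \<open>Being an equality, it lets \<open>l ^ k\<close> enter the series bounds exactly as
  \<open>norm l ^ k\<close>, with no constant raised to the power \<open>k\<close>.\<close>

lemma norm_mat_mult: "norm (mat l ** (A :: complex ^ 'n ^ 'n::finite)) = norm l * norm A"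
proof -
  have row: "norm ((mat l ** A) $ i) = norm l * norm (A $ i)" for i
    by (simp add: norm_vec_def norm_mult L2_set_right_distrib)
  show ?thesis
    by (simp add: norm_vec_def[of "mat l ** A"] norm_vec_def[of A] row L2_set_right_distrib)
qed

lemma bounded_bilinear_matrix_mult:
  "bounded_bilinear ((**) :: complex ^ 'n ^ 'm \<Rightarrow> complex ^ 'k ^ 'n \<Rightarrow> complex ^ 'k::finite ^ 'm::finite)"
  unfolding bilinear_conv_bounded_bilinear[symmetric] bilinear_def
  by (auto intro!: linearI simp: vec_eq_iff matrix_matrix_mult_def sum.distrib algebra_simps scaleR_sum_right)

lemma bounded_bilinear_matrix_vector_mult:
  "bounded_bilinear ((*v) :: complex ^ 'n ^ 'm \<Rightarrow> complex ^ 'n \<Rightarrow> complex ^ 'm::finite)"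
  unfolding bilinear_conv_bounded_bilinear[symmetric] bilinear_def
  by (auto intro!: linearI simp: vec_eq_iff matrix_vector_mult_def sum.distrib algebra_simps scaleR_sum_right)

lemma bounded_bilinear_cdot: "bounded_bilinear (cdot :: complex ^ 'n::finite \<Rightarrow> _)"
  unfolding bilinear_conv_bounded_bilinear[symmetric] bilinear_def
  by (auto intro!: linearI simp: cdot_def sum.distrib algebra_simps scaleR_sum_right)

lemma bounded_linear_ctranspose: "bounded_linear (ctranspose :: complex ^ 'n ^ 'm \<Rightarrow> complex ^ 'm ^ 'n)"
  unfolding linear_conv_bounded_linear[symmetric]
  by (auto intro!: linearI simp: vec_eq_iff ctranspose_def)

lemma bounded_linear_matrix_nth: "bounded_linear (\<lambda>A :: complex ^ 'n ^ 'm. A $ i $ j)"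
  unfolding linear_conv_bounded_linear[symmetric]
  by (auto intro!: linearI)

lemma matrix_mult_norm_bound:
  obtains K where "K > 0" "\<And>(A :: complex ^ 'n ^ 'n::finite) (B :: complex ^ 'n ^ 'n). norm (A ** B) \<le> K * norm A * norm B"
proof -
  obtain K where "K > 0" "\<And>(A :: complex ^ 'n ^ 'n) (B :: complex ^ 'n ^ 'n). norm (A ** B) \<le> norm A * norm B * K"
    using bounded_bilinear.pos_bounded[OF bounded_bilinear_matrix_mult[where 'n='n and 'm='n and 'k='n]]
    by auto
  then show thesis using that by (simp add: algebra_simps)
qed

lemmas matrix_mult_left_linear = bounded_bilinear.bounded_linear_right[OF bounded_bilinear_matrix_mult]

lemma absolutely_integrable_bilinear_continuous:
  fixes prod :: "'a::euclidean_space \<Rightarrow> 'b::euclidean_space \<Rightarrow> 'c::euclidean_space"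
  assumes "bounded_bilinear prod" "B absolutely_integrable_on S" "S \<in> sets lebesgue"
    "continuous_on S Z" "bounded (Z ` S)"
  shows "(\<lambda>t. prod (B t) (Z t)) absolutely_integrable_on S"
proof -
  have "bilinear (\<lambda>x y. prod y x)"
    unfolding bilinear_conv_bounded_bilinear by (rule bounded_bilinear.flip[OF assms(1)])
  then show ?thesis
    by (rule absolutely_integrable_bounded_measurable_product
        [OF _ continuous_imp_measurable_on_sets_lebesgue[OF assms(4,3)] assms(3,5,2)])
qed

lemma locally_integrable_bilinear_continuous:
  fixes prod :: "'a::euclidean_space \<Rightarrow> 'b::euclidean_space \<Rightarrow> 'c::euclidean_space"
  assumes "bounded_bilinear prod" "locally_integrable a b B" "continuous_on (einterval a b) Z"
  shows "locally_integrable a b (\<lambda>t. prod (B t) (Z t))"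
  unfolding locally_integrable_def
proof (intro allI impI)
  fix p q assume pq: "a < ereal p \<and> ereal q < b"
  then have c: "continuous_on {p..q} Z"
    using einterval_subinterval assms(3) continuous_on_subset by blast
  show "(\<lambda>t. prod (B t) (Z t)) absolutely_integrable_on {p..q}"
    using pq locally_integrableD[OF assms(2)] c
    by (intro absolutely_integrable_bilinear_continuous[OF assms(1)])
       (auto intro!: compact_imp_bounded compact_continuous_image)
qed

lemma locally_integrable_bounded_linear:
  fixes L :: "'a::euclidean_space \<Rightarrow> 'b::euclidean_space"
  assumes "bounded_linear L" "locally_integrable a b B"
  shows "locally_integrable a b (\<lambda>t. L (B t))"
  unfolding locally_integrable_def
  by (intro allI impI, rule absolutely_integrable_linear[OF _ assms(1), unfolded o_def])
     (auto intro: locally_integrableD[OF assms(2)])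

lemma locally_integrable_integrable_on:
  fixes g :: "real \<Rightarrow> 'a::euclidean_space"
  shows "locally_integrable a b g \<Longrightarrow> a < ereal p \<Longrightarrow> ereal q < b \<Longrightarrow> g integrable_on {p..q}"
  by (rule set_lebesgue_integral_eq_integral(1)[OF locally_integrableD])

lemma locally_integrable_norm:
  fixes B :: "real \<Rightarrow> 'a::euclidean_space"
  assumes "locally_integrable a b B"
  shows "locally_integrable a b (\<lambda>t. norm (B t))"
  unfolding locally_integrable_def
  by (intro allI impI, rule absolutely_integrable_norm[unfolded o_def])
     (auto intro: locally_integrableD[OF assms])

lemma oriented_integral_bounded_linear:
  assumes "bounded_linear L" "locally_integrable a b g" "c \<in> einterval a b" "t \<in> einterval a b"
  shows "oriented_integral c (\<lambda>s. L (g s)) t = L (oriented_integral c g t)"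
proof -
  interpret L: bounded_linear L by fact
  have i: "g integrable_on {c..t}" "g integrable_on {t..c}"
    using assms(3,4) locally_integrable_integrable_on[OF assms(2)]
    by (simp_all add: einterval_def)
  show ?thesis
    using integral_linear[OF i(1) assms(1)] integral_linear[OF i(2) assms(1)]
    by (simp add: oriented_integral_def L.diff o_def)
qed

lemma oriented_integral_add:
  assumes "locally_integrable a b f" "locally_integrable a b g" "c \<in> einterval a b" "t \<in> einterval a b"
  shows "oriented_integral c (\<lambda>s. f s + g s) t = oriented_integral c f t + oriented_integral c g t"
proof -
  have "f integrable_on {c..t}" "f integrable_on {t..c}" "g integrable_on {c..t}" "g integrable_on {t..c}"
    using assms(3,4) locally_integrable_integrable_on[OF assms(1)] locally_integrable_integrable_on[OF assms(2)]
    by (simp_all add: einterval_def)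
  then show ?thesis by (simp add: oriented_integral_def integral_add)
qed

lemma locally_integrable_add:
  assumes "locally_integrable a b f" "locally_integrable a b g"
  shows "locally_integrable a b (\<lambda>s. f s + g s)"
  using assms unfolding locally_integrable_def by (auto intro: set_integral_add(1))

section \<open>Picard iteration with integrable coefficients\<close>

lemma locally_absolutely_cont_power:
  fixes f :: "real \<Rightarrow> real"
  assumes "locally_absolutely_cont a b f" shows "locally_absolutely_cont a b (\<lambda>t. f t ^ k)"
proof (induction k)
  case (Suc k)
  then show ?case
    using locally_absolutely_cont_bilinear[OF bounded_bilinear_mult assms Suc] by simp
qed (simp add: locally_absolutely_cont_const)

text \<open>The chain rule for a power of \<open>\<sigma>\<close> holds only almost everywhere, and
  absolute continuity turns it into an integral formula. The divisor \<open>Suc k\<close> is what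
  accumulates to the factorial in the Picard bounds.\<close>

lemma has_integral_power_of_integral:
  fixes h :: "real \<Rightarrow> real"
  assumes h: "locally_integrable a b h" and c: "c \<in> einterval a b" and pq: "a < ereal p" "ereal q < b" "p \<le> q"
  defines "\<sigma> \<equiv> oriented_integral c h"
  shows "((\<lambda>s. h s * \<sigma> s ^ k) has_integral (\<sigma> q ^ Suc k - \<sigma> p ^ Suc k) / Suc k) {p..q}"
proof -
  let ?f = "\<lambda>s. \<sigma> s ^ Suc k * (1 / real (Suc k))"
  have "locally_absolutely_cont a b ?f"
    unfolding \<sigma>_def
    by (rule locally_absolutely_cont_bounded_linear[OF bounded_linear_mult_left
        locally_absolutely_cont_power[OF locally_absolutely_cont_oriented_integral[OF h c]]])
  moreover have "AE t in lebesgue. t \<in> einterval a b \<longrightarrow> (?f has_vector_derivative h t * \<sigma> t ^ k) (at t)"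
    using oriented_integral_has_vector_derivative[OF h c]
  proof eventually_elim
    case (elim t)
    then have "t \<in> einterval a b \<Longrightarrow> (\<sigma> has_real_derivative h t) (at t)"
      unfolding \<sigma>_def has_real_derivative_iff_has_vector_derivative by blast
    then have "(?f has_real_derivative h t * \<sigma> t ^ k) (at t)" if "t \<in> einterval a b"
      using that by (auto intro!: derivative_eq_intros simp del: power_Suc)
    then show ?case
      unfolding has_real_derivative_iff_has_vector_derivative by blast
  qed
  ultimately have "((\<lambda>s. h s * \<sigma> s ^ k) has_integral ?f q - ?f p) {p..q}"
    using pq by (rule locally_absolutely_cont_has_integral)
  then show ?thesis by (simp add: diff_divide_distrib)
qed

lemma norm_oriented_integral_le_power:
  fixes g :: "real \<Rightarrow> 'a::euclidean_space"
  assumes h: "locally_integrable a b h" "\<And>s. s \<in> einterval a b \<Longrightarrow> 0 \<le> h s"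
    and g: "locally_integrable a b g"
    and c: "c \<in> einterval a b" and t: "t \<in> einterval a b"
    and le: "\<And>s. s \<in> einterval a b \<Longrightarrow> norm (g s) \<le> h s * \<bar>oriented_integral c h s\<bar> ^ k"
  shows "norm (oriented_integral c g t) \<le> \<bar>oriented_integral c h t\<bar> ^ Suc k / Suc k"
proof -
  define \<sigma> where "\<sigma> = oriented_integral c h"
  define p q where "p = min c t" and "q = max c t"
  \<comment> \<open>The sign of \<open>\<sigma>\<close> on the segment between \<open>c\<close> and
    \<open>t\<close>; multiplying by it reduces absolute values to \<open>\<sigma>\<close> itself,
    so that the preceding power formula applies on either side of \<open>c\<close>.\<close>
  define e :: real where "e = (if c \<le> t then 1 else - 1)"
  have pq: "a < ereal p" "ereal q < b" "p \<le> q"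
    using c t by (auto simp: einterval_def p_def q_def min_def max_def)
  have hi: "0 \<le> integral {u..v} h" if "a < ereal u" "ereal v < b" for u v
    using h(2) einterval_subinterval[OF that]
    by (intro integral_nonneg locally_integrable_integrable_on[OF h(1) that]) auto
  have sign: "\<bar>\<sigma> s\<bar> = e * \<sigma> s" if s: "s \<in> {p..q}" for s
  proof -
    have "s \<in> einterval a b" using einterval_subinterval[OF pq(1,2)] s by blast
    then have "0 \<le> integral {c..s} h" "0 \<le> integral {s..c} h"
      using c by (auto intro!: hi simp: einterval_def)
    moreover have "c \<le> s \<and> c \<le> t \<or> s \<le> c \<and> \<not> c \<le> t \<or> s = c"
      using s by (auto simp: p_def q_def)
    moreover have "integral {s..c} h = 0" if "c \<le> s" using that by (cases "c = s") auto
    moreover have "integral {c..s} h = 0" if "s \<le> c" using that by (cases "c = s") auto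
    ultimately show ?thesis
      by (auto simp: \<sigma>_def oriented_integral_def e_def)
  qed
  have "((\<lambda>s. e ^ k * (h s * \<sigma> s ^ k)) has_integral e ^ k * ((\<sigma> q ^ Suc k - \<sigma> p ^ Suc k) / Suc k)) {p..q}"
    unfolding \<sigma>_def by (intro has_integral_mult_right has_integral_power_of_integral[OF h(1) c pq])
  \<comment> \<open>One of the two boundary terms is taken at \<open>c\<close>, where
    \<open>\<sigma>\<close> vanishes; for \<open>t\<close> left of \<open>c\<close> the minus sign
    of the remaining term is the missing factor \<open>e\<close>.\<close>
  moreover have "e ^ k * ((\<sigma> q ^ Suc k - \<sigma> p ^ Suc k) / Suc k) = \<bar>\<sigma> t\<bar> ^ Suc k / Suc k"
  proof -
    have "\<bar>\<sigma> t\<bar> ^ Suc k = e ^ Suc k * \<sigma> t ^ Suc k"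
      unfolding sign[of t, unfolded p_def q_def, simplified] by (rule power_mult_distrib)
    then show ?thesis by (simp add: e_def p_def q_def min_def max_def \<sigma>_def)
  qed
  ultimately have I: "((\<lambda>s. e ^ k * (h s * \<sigma> s ^ k)) has_integral \<bar>\<sigma> t\<bar> ^ Suc k / Suc k) {p..q}"
    by (simp only:)
  have "norm (oriented_integral c g t) = norm (integral {p..q} g)"
    by (cases c t rule: linorder_cases) (auto simp: oriented_integral_def p_def q_def min_def max_def)
  also have "\<dots> \<le> integral {p..q} (\<lambda>s. e ^ k * (h s * \<sigma> s ^ k))"
  proof (rule integral_norm_bound_integral[OF locally_integrable_integrable_on[OF g pq(1,2)]])
    show "(\<lambda>s. e ^ k * (h s * \<sigma> s ^ k)) integrable_on {p..q}" using I by blast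
    fix s assume s: "s \<in> {p..q}"
    then have "norm (g s) \<le> h s * (e * \<sigma> s) ^ k"
      using le[of s] sign[OF s] einterval_subinterval[OF pq(1,2)] by (auto simp: \<sigma>_def)
    then show "norm (g s) \<le> e ^ k * (h s * \<sigma> s ^ k)" by (simp add: power_mult_distrib mult_ac)
  qed
  finally show ?thesis using integral_unique[OF I] by (simp add: \<sigma>_def)
qed

text \<open>The individual terms, not the partial sums, of the Peano-Baker series for Y' = B Y with
  Y(c) = I.\<close>

primrec picard :: "real \<Rightarrow> (real \<Rightarrow> complex ^ 'n ^ 'n::finite) \<Rightarrow> nat \<Rightarrow> real \<Rightarrow> complex ^ 'n ^ 'n"
  where "picard c B 0 = (\<lambda>t. mat 1)"
  | "picard c B (Suc k) = oriented_integral c (\<lambda>t. B t ** picard c B k t)"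

text \<open>Solves Y' = l B Y with Y(c) = I. Keeping the parameter outside the iterated integrals
  exhibits the solution as a power series in \<open>l\<close>, from which entire dependence is read
  off.\<close>

definition evolution :: "real \<Rightarrow> (real \<Rightarrow> complex ^ 'n ^ 'n::finite) \<Rightarrow> complex \<Rightarrow> real \<Rightarrow> complex ^ 'n ^ 'n"
  where "evolution c B l t = (\<Sum>k. mat (l ^ k) ** picard c B k t)"

lemma picard_regularity:
  assumes B: "locally_integrable a b B" and c: "c \<in> einterval a b"
  shows "locally_absolutely_cont a b (picard c B k)"
    and "locally_integrable a b (\<lambda>t. B t ** picard c B k t)"
proof -
  have *: "locally_integrable a b (\<lambda>t. B t ** Z t)" if "locally_absolutely_cont a b Z" for Z
    by (rule locally_integrable_bilinear_continuous[OF bounded_bilinear_matrix_mult B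
          locally_absolutely_cont_continuous_on[OF that]])
  show 1: "locally_absolutely_cont a b (picard c B k)"
  proof (induction k)
    case (Suc k)
    show ?case
      using locally_absolutely_cont_oriented_integral[OF *[OF Suc] c] by simp
  qed (simp add: locally_absolutely_cont_const)
  show "locally_integrable a b (\<lambda>t. B t ** picard c B k t)"
    by (rule *[OF 1])
qed

text \<open>Each integration against \<open>K * norm (B s)\<close> raises the power by one and
  divides by the new exponent. The norm of matrices is entrywise Euclidean, so the constant
  \<open>K\<close> of the product is absorbed into the integrand and the norm of the identity, which
  need not be 1, stays in front.\<close>

lemma picard_bound:
  fixes B :: "real \<Rightarrow> complex ^ 'n ^ 'n::finite"
  assumes B: "locally_integrable a b B" and c: "c \<in> einterval a b" and t: "t \<in> einterval a b"
    and K: "K \<ge> 0" "\<And>(A :: complex ^ 'n ^ 'n) (C :: complex ^ 'n ^ 'n). norm (A ** C) \<le> K * norm A * norm C"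
  shows "norm (picard c B k t) \<le>
    norm (mat 1 :: complex ^ 'n ^ 'n) * (\<bar>oriented_integral c (\<lambda>s. K * norm (B s)) t\<bar> ^ k / fact k)"
  using t
proof (induction k arbitrary: t)
  case (Suc k)
  define h where "h s = K * norm (B s)" for s
  define C0 where "C0 = norm (mat 1 :: complex ^ 'n ^ 'n)"
  have h: "locally_integrable a b h"
    unfolding h_def
    by (rule locally_integrable_bounded_linear[OF bounded_linear_mult_right locally_integrable_norm[OF B]])
  \<comment> \<open>Dividing by the constant of the induction hypothesis brings the integrand to the
    normalized form required by \<open>norm_oriented_integral_le_power\<close>.\<close>
  define w where "w = C0 / fact k"
  have w: "w > 0"
  proof -
    have "(mat 1 :: complex ^ 'n ^ 'n) \<noteq> 0" by (simp add: vec_eq_iff mat_def)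
    then show ?thesis by (simp add: w_def C0_def)
  qed
  have g: "locally_integrable a b (\<lambda>t. (1 / w) *\<^sub>R (B t ** picard c B k t))"
    by (rule locally_integrable_bounded_linear[OF bounded_linear_scaleR_right picard_regularity(2)[OF B c]])
  have "norm (oriented_integral c (\<lambda>t. (1 / w) *\<^sub>R (B t ** picard c B k t)) t) \<le> \<bar>oriented_integral c h t\<bar> ^ Suc k / Suc k"
  proof (rule norm_oriented_integral_le_power[OF h _ g c Suc.prems])
    show "0 \<le> h s" for s using K by (simp add: h_def)
    fix s assume s: "s \<in> einterval a b"
    have "norm (B s ** picard c B k s) \<le> h s * norm (picard c B k s)"
      using K(2) by (simp add: h_def)
    also have "\<dots> \<le> h s * (C0 * (\<bar>oriented_integral c h s\<bar> ^ k / fact k))"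
      using Suc.IH[OF s] K(1) by (intro mult_left_mono) (auto simp: h_def[abs_def] C0_def)
    also have "\<dots> = w * (h s * \<bar>oriented_integral c h s\<bar> ^ k)"
      by (simp add: w_def)
    finally show "norm ((1 / w) *\<^sub>R (B s ** picard c B k s)) \<le> h s * \<bar>oriented_integral c h s\<bar> ^ k"
      using w by (simp add: field_simps)
  qed
  moreover have "oriented_integral c (\<lambda>t. (1 / w) *\<^sub>R (B t ** picard c B k t)) t = (1 / w) *\<^sub>R picard c B (Suc k) t"
    using oriented_integral_bounded_linear[OF bounded_linear_scaleR_right picard_regularity(2)[OF B c] c Suc.prems]
    by simp
  ultimately have "norm (picard c B (Suc k) t) / w \<le> \<bar>oriented_integral c h t\<bar> ^ Suc k / Suc k"
    using w by (simp del: picard.simps)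
  then have "norm (picard c B (Suc k) t) \<le> w * (\<bar>oriented_integral c h t\<bar> ^ Suc k / Suc k)"
    using w by (simp add: field_simps del: picard.simps)
  also have "\<dots> = C0 * (\<bar>oriented_integral c h t\<bar> ^ Suc k / fact (Suc k))"
    by (simp add: w_def)
  finally show ?case by (simp add: h_def[abs_def] C0_def)
qed simp

lemma evolution_term_bound:
  fixes Z :: "nat \<Rightarrow> complex ^ 'n ^ 'n::finite"
  assumes "norm (Z k) \<le> C0 * (s ^ k / fact k)"
  shows "norm (mat (l ^ k) ** Z k) \<le> C0 * ((norm l * s) ^ k /\<^sub>R fact k)"
proof -
  have "norm (mat (l ^ k) ** Z k) \<le> norm l ^ k * (C0 * (s ^ k / fact k))"
    unfolding norm_mat_mult norm_power by (rule mult_left_mono[OF assms]) simp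
  then show ?thesis by (simp add: power_mult_distrib divide_inverse mult_ac)
qed

text \<open>Stated for an arbitrary coefficient sequence because it is applied both to Picard terms
  at a point and to their limits at an end. The bound on partial sums supplies the majorant for
  dominated convergence.\<close>

lemma evolution_summable:
  fixes Z :: "nat \<Rightarrow> complex ^ 'n ^ 'n::finite"
  assumes Z: "\<And>k. norm (Z k) \<le> C0 * (s ^ k / fact k)"
  shows "summable (\<lambda>k. norm (mat (l ^ k) ** Z k))"
    and "norm (\<Sum>k. mat (l ^ k) ** Z k) \<le> C0 * exp (norm l * s)"
    and "norm (\<Sum>k<N. mat (l ^ k) ** Z k) \<le> C0 * exp (norm l * s)"
proof -
  have sums: "(\<lambda>k. C0 * ((norm l * s) ^ k /\<^sub>R fact k)) sums (C0 * exp (norm l * s))"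
    by (intro sums_mult exp_converges)
  have trm: "norm (mat (l ^ k) ** Z k) \<le> C0 * ((norm l * s) ^ k /\<^sub>R fact k)" for k
    by (rule evolution_term_bound[OF Z])
  show 1: "summable (\<lambda>k. norm (mat (l ^ k) ** Z k))"
    using sums trm by (intro summable_comparison_test'[OF sums_summable[OF sums], of 0]) auto
  have "norm (\<Sum>k. mat (l ^ k) ** Z k) \<le> (\<Sum>k. norm (mat (l ^ k) ** Z k))"
    by (rule summable_norm[OF 1])
  also have "\<dots> \<le> (\<Sum>k. C0 * ((norm l * s) ^ k /\<^sub>R fact k))"
    by (rule suminf_le[OF trm 1 sums_summable[OF sums]])
  also have "\<dots> = C0 * exp (norm l * s)" by (rule sums_unique[OF sums, symmetric])
  finally show "norm (\<Sum>k. mat (l ^ k) ** Z k) \<le> C0 * exp (norm l * s)" .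
  have "norm (\<Sum>k<N. mat (l ^ k) ** Z k) \<le> (\<Sum>k<N. norm (mat (l ^ k) ** Z k))"
    by (rule norm_sum)
  also have "\<dots> \<le> (\<Sum>k<N. C0 * ((norm l * s) ^ k /\<^sub>R fact k))"
    by (rule sum_mono[OF trm])
  also have "\<dots> \<le> (\<Sum>k. C0 * ((norm l * s) ^ k /\<^sub>R fact k))"
    by (rule sum_le_suminf[OF sums_summable[OF sums]])
       (use order_trans[OF norm_ge_zero trm] in auto)
  also have "\<dots> = C0 * exp (norm l * s)" by (rule sums_unique[OF sums, symmetric])
  finally show "norm (\<Sum>k<N. mat (l ^ k) ** Z k) \<le> C0 * exp (norm l * s)" .
qed

lemma evolution_entries_holomorphic:
  fixes Z :: "nat \<Rightarrow> complex ^ 'n ^ 'n::finite"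
  assumes Z: "\<And>k. norm (Z k) \<le> C0 * (s ^ k / fact k)"
  shows "(\<lambda>l. (\<Sum>k. mat (l ^ k) ** Z k) $ i $ j) holomorphic_on UNIV"
proof -
  have sums: "(\<lambda>k. Z k $ i $ j * (l - 0) ^ k) sums ((\<Sum>k. mat (l ^ k) ** Z k) $ i $ j)" for l
  proof -
    have "(\<lambda>k. mat (l ^ k) ** Z k) sums (\<Sum>k. mat (l ^ k) ** Z k)"
      by (rule summable_sums[OF summable_norm_cancel[OF evolution_summable(1)[OF Z]]])
    from bounded_linear.sums[OF bounded_linear_matrix_nth this, of i j] show ?thesis
      by (simp add: mult.commute)
  qed
  have "(\<lambda>l. (\<Sum>k. mat (l ^ k) ** Z k) $ i $ j) field_differentiable at x" for x
  proof (rule holomorphic_on_imp_differentiable_at)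
    show "(\<lambda>l. (\<Sum>k. mat (l ^ k) ** Z k) $ i $ j) holomorphic_on ball 0 (norm x + 1)"
      by (rule power_series_holomorphic[OF sums])
  qed auto
  then show ?thesis by (simp add: holomorphic_on_def)
qed

lemma oriented_integral_tendsto:
  fixes g :: "nat \<Rightarrow> real \<Rightarrow> 'a::euclidean_space"
  assumes g: "\<And>n. locally_integrable a b (g n)" and h: "locally_integrable a b h"
    and c: "c \<in> einterval a b" and t: "t \<in> einterval a b"
    and le: "\<And>n s. s \<in> {c..t} \<union> {t..c} \<Longrightarrow> norm (g n s) \<le> h s"
    and lim: "\<And>s. s \<in> einterval a b \<Longrightarrow> (\<lambda>n. g n s) \<longlonglongrightarrow> g' s"
  shows "(\<lambda>n. oriented_integral c (g n) t) \<longlonglongrightarrow> oriented_integral c g' t"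
proof -
  have ab: "a < ereal c" "ereal c < b" "a < ereal t" "ereal t < b"
    using c t by (auto simp: einterval_def)
  note i = locally_integrable_integrable_on[OF g] locally_integrable_integrable_on[OF h]
  note sub = einterval_subinterval[OF ab(1,4)] einterval_subinterval[OF ab(3,2)]
  have "(\<lambda>n. integral {c..t} (g n)) \<longlonglongrightarrow> integral {c..t} g'"
    by (rule dominated_convergence(2)[OF i(1)[OF ab(1,4)] i(2)[OF ab(1,4)]]) (use le lim sub in auto)
  moreover have "(\<lambda>n. integral {t..c} (g n)) \<longlonglongrightarrow> integral {t..c} g'"
    by (rule dominated_convergence(2)[OF i(1)[OF ab(3,2)] i(2)[OF ab(3,2)]]) (use le lim sub in auto)
  ultimately show ?thesis unfolding oriented_integral_def by (rule tendsto_diff)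
qed

lemma absolutely_integrable_dominated_limit:
  fixes g :: "nat \<Rightarrow> real \<Rightarrow> 'a::euclidean_space"
  assumes g: "\<And>n. g n absolutely_integrable_on S" and h: "h absolutely_integrable_on S"
    and le: "\<And>n s. s \<in> S \<Longrightarrow> norm (g n s) \<le> h s"
    and lim: "\<And>s. s \<in> S \<Longrightarrow> (\<lambda>n. g n s) \<longlonglongrightarrow> g' s"
  shows "g' absolutely_integrable_on S"
proof (rule absolutely_integrable_integrable_bound)
  show "h integrable_on S" using h set_lebesgue_integral_eq_integral(1) by blast
  show "g' integrable_on S"
    by (rule dominated_convergence(1)[OF _ \<open>h integrable_on S\<close> le lim])
       (rule set_lebesgue_integral_eq_integral(1)[OF g])
  show "norm (g' s) \<le> h s" if "s \<in> S" for s
    using Lim_bounded[OF tendsto_norm[OF lim[OF that]], of 0 "h s"] le[OF that] by auto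
qed

lemma absolutely_integrable_mat_mult:
  fixes B :: "real \<Rightarrow> complex ^ 'n ^ 'n::finite"
  shows "B absolutely_integrable_on S \<Longrightarrow> (\<lambda>t. A ** B t) absolutely_integrable_on S"
  using absolutely_integrable_linear[OF _ matrix_mult_left_linear, unfolded o_def] .

text \<open>The partial sums satisfy the integral equation with a shift of the index, and dominated
  convergence passes to the limit. Integrability of the limiting integrand comes from the same
  majorant.\<close>

lemma evolution_integral_equation:
  fixes B :: "real \<Rightarrow> complex ^ 'n ^ 'n::finite"
  assumes B: "locally_integrable a b B" and c: "c \<in> einterval a b"
  shows "locally_integrable a b (\<lambda>s. mat l ** (B s ** evolution c B l s))"
    and "\<And>t. t \<in> einterval a b \<Longrightarrow>
      evolution c B l t = mat 1 + oriented_integral c (\<lambda>s. mat l ** (B s ** evolution c B l s)) t"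
proof -
  obtain K where K: "K > 0" "\<And>(A :: complex ^ 'n ^ 'n) (C :: complex ^ 'n ^ 'n). norm (A ** C) \<le> K * norm A * norm C"
    using matrix_mult_norm_bound by blast
  define \<sigma> where "\<sigma> = oriented_integral c (\<lambda>s. K * norm (B s))"
  define C0 where "C0 = norm (mat 1 :: complex ^ 'n ^ 'n)"
  define S where "S N t = (\<Sum>k<N. mat (l ^ k) ** picard c B k t)" for N t
  have bound: "norm (picard c B k t) \<le> C0 * (\<bar>\<sigma> t\<bar> ^ k / fact k)" if "t \<in> einterval a b" for k t
    using picard_bound[OF B c that less_imp_le[OF K(1)] K(2)] by (simp add: C0_def \<sigma>_def)
  have S_lim: "(\<lambda>N. S N t) \<longlonglongrightarrow> evolution c B l t" if "t \<in> einterval a b" for t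
    unfolding S_def evolution_def
    by (rule summable_LIMSEQ[OF summable_norm_cancel[OF evolution_summable(1)[OF bound[OF that]]]])
  have S_ac: "locally_absolutely_cont a b (S N)" for N
  proof (induction N)
    case 0
    then show ?case by (simp add: S_def[abs_def] locally_absolutely_cont_const)
  next
    case (Suc N)
    have "locally_absolutely_cont a b (\<lambda>t. S N t + mat (l ^ N) ** picard c B N t)"
      by (rule locally_absolutely_cont_add[OF Suc locally_absolutely_cont_bounded_linear
            [OF matrix_mult_left_linear picard_regularity(1)[OF B c]]])
    then show ?case by (simp add: S_def[abs_def])
  qed
  have \<sigma>_ac: "locally_absolutely_cont a b \<sigma>"
    unfolding \<sigma>_def
    by (rule locally_absolutely_cont_oriented_integral[OF locally_integrable_bounded_linear
          [OF bounded_linear_mult_right locally_integrable_norm[OF B]] c])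
  have int: "locally_integrable a b (\<lambda>s. mat l ** (B s ** S N s))" for N
    by (rule locally_integrable_bounded_linear[OF matrix_mult_left_linear
          locally_integrable_bilinear_continuous[OF bounded_bilinear_matrix_mult B
            locally_absolutely_cont_continuous_on[OF S_ac]]])
  have lim: "(\<lambda>N. mat l ** (B s ** S N s)) \<longlonglongrightarrow> mat l ** (B s ** evolution c B l s)"
    if "s \<in> einterval a b" for s
    by (rule bounded_linear.tendsto[OF matrix_mult_left_linear
          bounded_linear.tendsto[OF matrix_mult_left_linear S_lim[OF that]]])
  \<comment> \<open>On a compact subinterval \<open>\<sigma>\<close> is bounded, so the exponential
    bound on the partial sums is uniform and a multiple of \<open>norm (B s)\<close> dominates for
    all \<open>N\<close>.\<close>
  have dom: "\<exists>M. \<forall>s\<in>{p..q}. \<forall>N. norm (mat l ** (B s ** S N s)) \<le> M * norm (B s)"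
    if pq: "a < ereal p" "ereal q < b" for p q
  proof -
    have "bounded (\<sigma> ` {p..q})"
      using absolutely_cont_on_imp_continuous_on[OF locally_absolutely_contD[OF \<sigma>_ac pq]]
      by (intro compact_imp_bounded compact_continuous_image) auto
    then obtain M where M: "\<And>s. s \<in> {p..q} \<Longrightarrow> \<bar>\<sigma> s\<bar> \<le> M"
      unfolding bounded_iff by fastforce
    have "norm (mat l ** (B s ** S N s)) \<le> (norm l * (K * (C0 * exp (norm l * M)))) * norm (B s)"
      if s: "s \<in> {p..q}" for s N
    proof -
      have s': "s \<in> einterval a b" using einterval_subinterval[OF pq] s by blast
      have "norm (S N s) \<le> C0 * exp (norm l * \<bar>\<sigma> s\<bar>)"
        unfolding S_def by (rule evolution_summable(3)[OF bound[OF s']])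
      also have "\<dots> \<le> C0 * exp (norm l * M)"
        using M[OF s] by (intro mult_left_mono) (auto simp: C0_def mult_left_mono)
      finally have *: "norm (S N s) \<le> C0 * exp (norm l * M)" .
      have "norm (mat l ** (B s ** S N s)) \<le> norm l * (K * norm (B s) * norm (S N s))"
        unfolding norm_mat_mult by (rule mult_left_mono[OF K(2)]) simp
      also have "\<dots> \<le> norm l * (K * norm (B s) * (C0 * exp (norm l * M)))"
        using * K(1) by (intro mult_left_mono) auto
      finally show ?thesis by (simp add: mult_ac)
    qed
    then show ?thesis by blast
  qed
  have normB: "(\<lambda>s. M * norm (B s)) absolutely_integrable_on {p..q}" if "a < ereal p" "ereal q < b" for M p q
    by (rule locally_integrableD[OF locally_integrable_bounded_linear
          [OF bounded_linear_mult_right locally_integrable_norm[OF B]] that])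
  show "locally_integrable a b (\<lambda>s. mat l ** (B s ** evolution c B l s))"
    unfolding locally_integrable_def
  proof (intro allI impI, elim conjE)
    fix p q assume pq: "a < ereal p" "ereal q < b"
    obtain M where M: "\<And>s N. s \<in> {p..q} \<Longrightarrow> norm (mat l ** (B s ** S N s)) \<le> M * norm (B s)"
      using dom[OF pq] by blast
    show "(\<lambda>s. mat l ** (B s ** evolution c B l s)) absolutely_integrable_on {p..q}"
    proof (rule absolutely_integrable_dominated_limit[OF _ normB[OF pq] M])
      show "(\<lambda>s. mat l ** (B s ** S N s)) absolutely_integrable_on {p..q}" for N
        by (rule locally_integrableD[OF int pq])
      show "(\<lambda>N. mat l ** (B s ** S N s)) \<longlonglongrightarrow> mat l ** (B s ** evolution c B l s)"
        if "s \<in> {p..q}" for s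
        using lim einterval_subinterval[OF pq] that by blast
    qed
  qed
  fix t assume t: "t \<in> einterval a b"
  have ab: "a < ereal c" "ereal c < b" "a < ereal t" "ereal t < b"
    using c t by (auto simp: einterval_def)
  have step: "S (Suc N) t = mat 1 + oriented_integral c (\<lambda>s. mat l ** (B s ** S N s)) t" for N
  proof (induction N)
    case 0
    have "oriented_integral c (\<lambda>s. 0 :: complex ^ 'n ^ 'n) t = 0"
      by (simp add: oriented_integral_def)
    then show ?case
      by (simp add: S_def bounded_bilinear.zero_right[OF bounded_bilinear_matrix_mult])
  next
    case (Suc N)
    let ?g = "\<lambda>s. mat (l ^ Suc N) ** (B s ** picard c B N s)"
    have gi: "locally_integrable a b ?g"
      by (rule locally_integrable_bounded_linear[OF matrix_mult_left_linear picard_regularity(2)[OF B c]])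
    have "S (Suc (Suc N)) t = S (Suc N) t + mat (l ^ Suc N) ** oriented_integral c (\<lambda>s. B s ** picard c B N s) t"
      by (simp add: S_def)
    also have "mat (l ^ Suc N) ** oriented_integral c (\<lambda>s. B s ** picard c B N s) t = oriented_integral c ?g t"
      by (rule oriented_integral_bounded_linear[OF matrix_mult_left_linear picard_regularity(2)[OF B c] c t, symmetric])
    also have "S (Suc N) t + oriented_integral c ?g t =
        mat 1 + oriented_integral c (\<lambda>s. mat l ** (B s ** S N s) + ?g s) t"
      by (simp only: Suc oriented_integral_add[OF int gi c t] add.assoc)
    also have "(\<lambda>s. mat l ** (B s ** S N s) + ?g s) = (\<lambda>s. mat l ** (B s ** S (Suc N) s))"
    proof
      fix s
      have "mat l ** (B s ** (mat (l ^ N) ** picard c B N s)) = ?g s"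
        by (simp only: matrix_mul_assoc power_Suc mat_mult_mat[symmetric] mat_commute[of "l ^ N" "B s", symmetric])
      then show "mat l ** (B s ** S N s) + ?g s = mat l ** (B s ** S (Suc N) s)"
        by (simp add: S_def matrix_add_ldistrib del: picard.simps)
    qed
    finally show ?case .
  qed
  obtain M where M: "\<And>s N. s \<in> {min c t..max c t} \<Longrightarrow> norm (mat l ** (B s ** S N s)) \<le> M * norm (B s)"
  proof -
    have "a < ereal (min c t)" "ereal (max c t) < b" using ab by (simp_all add: min_def max_def)
    from dom[OF this] show thesis using that by blast
  qed
  have "(\<lambda>N. oriented_integral c (\<lambda>s. mat l ** (B s ** S N s)) t) \<longlonglongrightarrow>
        oriented_integral c (\<lambda>s. mat l ** (B s ** evolution c B l s)) t"
  proof (rule oriented_integral_tendsto[OF int _ c t _ lim])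
    show "locally_integrable a b (\<lambda>s. M * norm (B s))"
      by (rule locally_integrable_bounded_linear[OF bounded_linear_mult_right locally_integrable_norm[OF B]])
    show "norm (mat l ** (B s ** S n s)) \<le> M * norm (B s)" if "s \<in> {c..t} \<union> {t..c}" for n s
      using that by (intro M) auto
  qed
  then have "(\<lambda>N. S (Suc N) t) \<longlonglongrightarrow> mat 1 + oriented_integral c (\<lambda>s. mat l ** (B s ** evolution c B l s)) t"
    unfolding step by (intro tendsto_add tendsto_const)
  moreover have "(\<lambda>N. S (Suc N) t) \<longlonglongrightarrow> evolution c B l t"
    by (rule LIMSEQ_Suc[OF S_lim[OF t]])
  ultimately show "evolution c B l t = mat 1 + oriented_integral c (\<lambda>s. mat l ** (B s ** evolution c B l s)) t"
    by (rule LIMSEQ_unique[rotated])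
qed

lemma evolution_solves:
  fixes B :: "real \<Rightarrow> complex ^ 'n ^ 'n::finite"
  assumes B: "locally_integrable a b B" and c: "c \<in> einterval a b"
  shows "evolution c B l c = mat 1"
    and "locally_absolutely_cont a b (evolution c B l)"
    and "AE t in lebesgue. t \<in> einterval a b \<longrightarrow>
      (evolution c B l has_vector_derivative mat l ** (B t ** evolution c B l t)) (at t)"
proof -
  let ?g = "\<lambda>s. mat l ** (B s ** evolution c B l s)"
  note eq = evolution_integral_equation(2)[OF B c, of _ l]
  note int = evolution_integral_equation(1)[OF B c, of l]
  show "evolution c B l c = mat 1" using eq[OF c] by simp
  show "locally_absolutely_cont a b (evolution c B l)"
    by (rule locally_absolutely_cont_transform[OF locally_absolutely_cont_add[OF locally_absolutely_cont_const
            locally_absolutely_cont_oriented_integral[OF int c]]]) (rule eq)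
  show "AE t in lebesgue. t \<in> einterval a b \<longrightarrow> (evolution c B l has_vector_derivative ?g t) (at t)"
    using oriented_integral_has_vector_derivative[OF int c]
  proof eventually_elim
    case (elim t)
    show ?case
    proof
      assume t': "t \<in> einterval a b"
      have "((\<lambda>s. mat 1 + oriented_integral c ?g s) has_vector_derivative 0 + ?g t) (at t)"
        using elim t' by (intro has_vector_derivative_add has_vector_derivative_const) blast
      then have "((\<lambda>s. mat 1 + oriented_integral c ?g s) has_vector_derivative ?g t) (at t)" by simp
      then show "(evolution c B l has_vector_derivative ?g t) (at t)"
        by (rule has_vector_derivative_transform_within_open[OF _ open_einterval t']) (rule eq[symmetric])
    qed
  qed
qed

section \<open>Limits at the ends when the coefficient is integrable on the whole interval\<close>

lemma absolutely_integrable_imp_locally_integrable: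
  "g absolutely_integrable_on einterval a b \<Longrightarrow> locally_integrable a b g"
  unfolding locally_integrable_def
  using einterval_subinterval by (intro allI impI) (erule set_integrable_subset, auto)

text \<open>The predicate \<open>Q\<close> names the set towards which the intervals converge
  pointwise, so one dominated convergence argument serves both ends.\<close>

lemma integral_Icc_tendsto:
  fixes g :: "real \<Rightarrow> 'a::euclidean_space"
  assumes g: "g absolutely_integrable_on einterval a b"
    and pq: "\<And>n. a < ereal (p n)" "\<And>n. ereal (q n) < b"
    and Q: "\<And>s. s \<in> einterval a b \<Longrightarrow> \<forall>\<^sub>F n in sequentially. s \<in> {p n..q n} \<longleftrightarrow> Q s"
  shows "(\<lambda>n. integral {p n..q n} g) \<longlonglongrightarrow> integral (einterval a b) (\<lambda>s. if Q s then g s else 0)"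
proof -
  have restr: "((\<lambda>s. if s \<in> {p n..q n} then g s else 0) has_integral integral {p n..q n} g) (einterval a b)" for n
    unfolding has_integral_restrict[OF einterval_subinterval[OF pq]]
    by (intro integrable_integral locally_integrable_integrable_on[OF absolutely_integrable_imp_locally_integrable[OF g]] pq)
  have "(\<lambda>n. integral (einterval a b) (\<lambda>s. if s \<in> {p n..q n} then g s else 0)) \<longlonglongrightarrow>
      integral (einterval a b) (\<lambda>s. if Q s then g s else 0)"
  proof (rule dominated_convergence(2))
    show "(\<lambda>s. norm (g s)) integrable_on einterval a b"
      using set_lebesgue_integral_eq_integral(1)[OF absolutely_integrable_norm[OF g]] by (simp add: o_def)
    fix s assume "s \<in> einterval a b"
    from Q[OF this] have "\<forall>\<^sub>F n in sequentially. (if s \<in> {p n..q n} then g s else 0) = (if Q s then g s else 0)"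
      by (rule eventually_mono) simp
    then show "(\<lambda>n. if s \<in> {p n..q n} then g s else 0) \<longlonglongrightarrow> (if Q s then g s else 0)"
      by (rule tendsto_eventually)
  qed (use restr in auto)
  then show ?thesis unfolding integral_unique[OF restr] .
qed

text \<open>The two limits are integrals over the halves right and left of \<open>c\<close>, which
  overlap only in the null set \<open>{c}\<close>. The third clause therefore makes the difference
  of the boundary values an integral over the whole interval.\<close>

lemma oriented_integral_end_limits:
  fixes g :: "real \<Rightarrow> 'a::euclidean_space"
  assumes g: "g absolutely_integrable_on einterval a b" and c: "c \<in> einterval a b"
  shows "((\<lambda>x. oriented_integral c g (real_of_ereal x)) \<longlongrightarrow>
      integral (einterval a b) (\<lambda>s. if c \<le> s then g s else 0)) (at_left b)"
    and "((\<lambda>x. oriented_integral c g (real_of_ereal x)) \<longlongrightarrow>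
      - integral (einterval a b) (\<lambda>s. if s \<le> c then g s else 0)) (at_right a)"
    and "integral (einterval a b) (\<lambda>s. if c \<le> s then g s else 0) +
      integral (einterval a b) (\<lambda>s. if s \<le> c then g s else 0) = integral (einterval a b) g"
proof -
  let ?A = "einterval a b"
  have ab: "a < ereal c" "ereal c < b" using c by (auto simp: einterval_def)
  show "((\<lambda>x. oriented_integral c g (real_of_ereal x)) \<longlongrightarrow> integral ?A (\<lambda>s. if c \<le> s then g s else 0)) (at_left b)"
  proof (rule tendsto_at_left_sequentially[OF ab(2)])
    \<comment> \<open>Each \<open>S n\<close> lies strictly between two extended reals, hence is
      finite, and the limit becomes one over real upper bounds.\<close>
    fix S :: "nat \<Rightarrow> ereal" assume S: "\<And>n. S n < b" "\<And>n. ereal c < S n" "S \<longlonglongrightarrow> b"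
    define x where "x n = real_of_ereal (S n)" for n
    have x: "S n = ereal (x n)" for n using S(1,2)[of n] by (cases "S n") (auto simp: x_def)
    have xc: "c < x n" "ereal (x n) < b" for n using S(1,2)[of n] by (auto simp: x)
    have "(\<lambda>n. integral {c..x n} g) \<longlonglongrightarrow> integral ?A (\<lambda>s. if c \<le> s then g s else 0)"
    proof (rule integral_Icc_tendsto[OF g ab(1) xc(2)])
      fix s assume "s \<in> ?A"
      then have "ereal s < b" by (auto simp: einterval_def)
      from order_tendstoD(1)[OF S(3) this]
      show "\<forall>\<^sub>F n in sequentially. s \<in> {c..x n} \<longleftrightarrow> c \<le> s" by eventually_elim (auto simp: x)
    qed
    moreover have "integral {c..x n} g = oriented_integral c g (real_of_ereal (S n))" for n
      using xc(1)[of n] by (simp add: oriented_integral_def x)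
    ultimately show "(\<lambda>n. oriented_integral c g (real_of_ereal (S n))) \<longlonglongrightarrow> integral ?A (\<lambda>s. if c \<le> s then g s else 0)"
      by simp
  qed
  show "((\<lambda>x. oriented_integral c g (real_of_ereal x)) \<longlongrightarrow> - integral ?A (\<lambda>s. if s \<le> c then g s else 0)) (at_right a)"
  proof (rule tendsto_at_right_sequentially[OF ab(1)])
    fix S :: "nat \<Rightarrow> ereal" assume S: "\<And>n. a < S n" "\<And>n. S n < ereal c" "S \<longlonglongrightarrow> a"
    define x where "x n = real_of_ereal (S n)" for n
    have x: "S n = ereal (x n)" for n using S(1,2)[of n] by (cases "S n") (auto simp: x_def)
    have xc: "x n < c" "a < ereal (x n)" for n using S(1,2)[of n] by (auto simp: x)
    have "(\<lambda>n. integral {x n..c} g) \<longlonglongrightarrow> integral ?A (\<lambda>s. if s \<le> c then g s else 0)"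
    proof (rule integral_Icc_tendsto[OF g xc(2) ab(2)])
      fix s assume "s \<in> ?A"
      then have "a < ereal s" by (auto simp: einterval_def)
      from order_tendstoD(2)[OF S(3) this]
      show "\<forall>\<^sub>F n in sequentially. s \<in> {x n..c} \<longleftrightarrow> s \<le> c" by eventually_elim (auto simp: x)
    qed
    from tendsto_minus[OF this]
    show "(\<lambda>n. oriented_integral c g (real_of_ereal (S n))) \<longlonglongrightarrow> - integral ?A (\<lambda>s. if s \<le> c then g s else 0)"
      using xc(1) by (simp add: oriented_integral_def x)
  qed
  have half: "(\<lambda>s. if s \<in> H then g s else 0) integrable_on ?A" if "closed H" for H
  proof -
    have "g absolutely_integrable_on (H \<inter> ?A)"
      using sets_completionI_sets[of H lborel] borel_closed[OF that]
      by (intro set_integrable_subset[OF g] sets.Int) auto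
    then show ?thesis by (simp add: integrable_restrict_Int set_lebesgue_integral_eq_integral(1))
  qed
  have "integral ?A (\<lambda>s. if c \<le> s then g s else 0) + integral ?A (\<lambda>s. if s \<le> c then g s else 0) =
      integral ?A (\<lambda>s. (if c \<le> s then g s else 0) + (if s \<le> c then g s else 0))"
    using half[of "{c..}"] half[of "{..c}"] by (intro integral_add[symmetric]) auto
  also have "\<dots> = integral ?A g"
    by (rule integral_spike[of "{c}"]) auto
  finally show "integral ?A (\<lambda>s. if c \<le> s then g s else 0) + integral ?A (\<lambda>s. if s \<le> c then g s else 0) = integral ?A g" .
qed

lemma eventually_at_left_einterval:
  assumes "c \<in> einterval a b" "\<And>t. t \<in> einterval a b \<Longrightarrow> c < t \<Longrightarrow> P t"
  shows "\<forall>\<^sub>F x in at_left b. P (real_of_ereal x)"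
proof -
  have ab: "a < ereal c" "ereal c < b" using assms(1) by (auto simp: einterval_def)
  show ?thesis
    unfolding eventually_at_left[OF ab(2)]
  proof (intro exI[of _ "ereal c"] conjI allI impI)
    fix y assume y: "ereal c < y" "y < b"
    then obtain r where r: "y = ereal r" by (cases y) auto
    then show "P (real_of_ereal y)"
      using y ab assms(2)[of r] less_trans[of a "ereal c" "ereal r"] by (auto simp: einterval_def)
  qed (rule ab)
qed

lemma eventually_at_right_einterval:
  assumes "c \<in> einterval a b" "\<And>t. t \<in> einterval a b \<Longrightarrow> t < c \<Longrightarrow> P t"
  shows "\<forall>\<^sub>F x in at_right a. P (real_of_ereal x)"
proof -
  have ab: "a < ereal c" "ereal c < b" using assms(1) by (auto simp: einterval_def)
  show ?thesis
    unfolding eventually_at_right[OF ab(1)]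
  proof (intro exI[of _ "ereal c"] conjI allI impI)
    fix y assume y: "a < y" "y < ereal c"
    then obtain r where r: "y = ereal r" by (cases y) auto
    then show "P (real_of_ereal y)"
      using y ab assms(2)[of r] less_trans[of "ereal r" "ereal c" b] by (auto simp: einterval_def)
  qed (rule ab)
qed

lemma at_left_einterval_nontrivial:
  assumes "c \<in> einterval a b" shows "at_left b \<noteq> bot"
proof -
  have ab: "ereal c < b" using assms(1) by (auto simp: einterval_def)
  have "\<not> eventually (\<lambda>x. False) (at_left b)"
    unfolding eventually_at_left[OF ab] by (auto intro: dense)
  then show ?thesis by (simp add: trivial_limit_def)
qed

lemma at_right_einterval_nontrivial:
  assumes "c \<in> einterval a b" shows "at_right a \<noteq> bot"
proof -
  have ab: "a < ereal c" using assms(1) by (auto simp: einterval_def)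
  have "\<not> eventually (\<lambda>x. False) (at_right a)"
    unfolding eventually_at_right[OF ab] by (auto intro: dense)
  then show ?thesis by (simp add: trivial_limit_def)
qed

text \<open>With \<open>B\<close> integrable up to the ends, the total integral \<open>T\<close>
  replaces the oriented integral, and the factorial bound no longer depends on
  \<open>t\<close>.\<close>

lemma picard_global_bound:
  fixes B :: "real \<Rightarrow> complex ^ 'n ^ 'n::finite"
  assumes B: "B absolutely_integrable_on einterval a b" and c: "c \<in> einterval a b"
  obtains C T where "C \<ge> 0" "T \<ge> 0"
    "\<And>k t. t \<in> einterval a b \<Longrightarrow> norm (picard c B k t) \<le> C * (T ^ k / fact k)"
proof -
  obtain K where K: "K > 0" "\<And>(A :: complex ^ 'n ^ 'n) (C :: complex ^ 'n ^ 'n). norm (A ** C) \<le> K * norm A * norm C"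
    using matrix_mult_norm_bound by blast
  have h: "(\<lambda>s. K * norm (B s)) absolutely_integrable_on einterval a b"
    using absolutely_integrable_linear[OF absolutely_integrable_norm[OF B] bounded_linear_mult_right[of K]]
    by (simp add: o_def)
  note hi = set_lebesgue_integral_eq_integral(1)[OF h]
  define T where "T = integral (einterval a b) (\<lambda>s. K * norm (B s))"
  have T: "T \<ge> 0" unfolding T_def by (rule integral_nonneg[OF hi]) (use K(1) in auto)
  have le: "\<bar>oriented_integral c (\<lambda>s. K * norm (B s)) t\<bar> \<le> T" if t: "t \<in> einterval a b" for t
  proof -
    have ab: "a < ereal c" "ereal c < b" "a < ereal t" "ereal t < b"
      using c t by (auto simp: einterval_def)
    have sub: "integral {p..q} (\<lambda>s. K * norm (B s)) \<le> T \<and> 0 \<le> integral {p..q} (\<lambda>s. K * norm (B s))"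
      if "a < ereal p" "ereal q < b" for p q
    proof -
      have i: "(\<lambda>s. K * norm (B s)) integrable_on {p..q}"
        by (rule locally_integrable_integrable_on[OF absolutely_integrable_imp_locally_integrable[OF h] that])
      have "integral {p..q} (\<lambda>s. K * norm (B s)) \<le> T"
        unfolding T_def by (rule integral_subset_le[OF einterval_subinterval[OF that] i hi]) (use K(1) in auto)
      moreover have "0 \<le> integral {p..q} (\<lambda>s. K * norm (B s))"
        by (rule integral_nonneg[OF i]) (use K(1) in auto)
      ultimately show ?thesis by blast
    qed
    have "integral {c..t} (\<lambda>s. K * norm (B s)) = 0 \<or> integral {t..c} (\<lambda>s. K * norm (B s)) = 0"
      by (cases c t rule: linorder_cases) auto
    then show ?thesis
      using sub[OF ab(1,4)] sub[OF ab(3,2)] unfolding oriented_integral_def by linarith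
  qed
  show thesis
  proof (rule that[of "norm (mat 1 :: complex ^ 'n ^ 'n)" T])
    fix k t assume t: "t \<in> einterval a b"
    have "norm (picard c B k t) \<le> norm (mat 1 :: complex ^ 'n ^ 'n) *
        (\<bar>oriented_integral c (\<lambda>s. K * norm (B s)) t\<bar> ^ k / fact k)"
      by (rule picard_bound[OF absolutely_integrable_imp_locally_integrable[OF B] c t less_imp_le[OF K(1)] K(2)])
    also have "\<dots> \<le> norm (mat 1 :: complex ^ 'n ^ 'n) * (T ^ k / fact k)"
      by (intro mult_left_mono divide_right_mono power_mono le t) auto
    finally show "norm (picard c B k t) \<le> norm (mat 1 :: complex ^ 'n ^ 'n) * (T ^ k / fact k)" .
  qed (use T in auto)
qed

lemma picard_end_limits:
  fixes B :: "real \<Rightarrow> complex ^ 'n ^ 'n::finite"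
  assumes B: "B absolutely_integrable_on einterval a b" and c: "c \<in> einterval a b"
  shows "\<exists>L. ((\<lambda>x. picard c B k (real_of_ereal x)) \<longlongrightarrow> L) (at_left b)"
    and "\<exists>L. ((\<lambda>x. picard c B k (real_of_ereal x)) \<longlongrightarrow> L) (at_right a)"
proof -
  have int: "(\<lambda>t. B t ** picard c B k t) absolutely_integrable_on einterval a b" for k
  proof (rule absolutely_integrable_bilinear_continuous[OF bounded_bilinear_matrix_mult B])
    obtain C T where "C \<ge> 0" "T \<ge> 0" and CT: "\<And>k t. t \<in> einterval a b \<Longrightarrow> norm (picard c B k t) \<le> C * (T ^ k / fact k)"
      by (rule picard_global_bound[OF B c]) (rule that; assumption)
    show "bounded (picard c B k ` einterval a b)"
      by (rule boundedI[of _ "C * (T ^ k / fact k)"]) (use CT in auto)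
    show "continuous_on (einterval a b) (picard c B k)"
      by (rule locally_absolutely_cont_continuous_on[OF picard_regularity(1)
            [OF absolutely_integrable_imp_locally_integrable[OF B] c]])
  qed simp
  show "\<exists>L. ((\<lambda>x. picard c B k (real_of_ereal x)) \<longlongrightarrow> L) (at_left b)"
    using oriented_integral_end_limits(1)[OF int c] by (cases k) (auto intro: tendsto_const)
  show "\<exists>L. ((\<lambda>x. picard c B k (real_of_ereal x)) \<longlongrightarrow> L) (at_right a)"
    using oriented_integral_end_limits(2)[OF int c] by (cases k) (auto intro: tendsto_const)
qed

lemma evolution_global_bound:
  fixes B :: "real \<Rightarrow> complex ^ 'n ^ 'n::finite"
  assumes B: "B absolutely_integrable_on einterval a b" and c: "c \<in> einterval a b"
  obtains C T where "C \<ge> 0" "T \<ge> 0"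
    "\<And>l t. t \<in> einterval a b \<Longrightarrow> norm (evolution c B l t) \<le> C * exp (norm l * T)"
proof -
  obtain C T where CT: "C \<ge> 0" "T \<ge> 0"
    "\<And>k t. t \<in> einterval a b \<Longrightarrow> norm (picard c B k t) \<le> C * (T ^ k / fact k)"
    by (rule picard_global_bound[OF B c]) (rule that; assumption)
  show thesis
    by (rule that[OF CT(1,2)]) (unfold evolution_def, rule evolution_summable(2)[OF CT(3)])
qed

lemma evolution_holomorphic:
  fixes B :: "real \<Rightarrow> complex ^ 'n ^ 'n::finite"
  assumes B: "B absolutely_integrable_on einterval a b" and c: "c \<in> einterval a b" and t: "t \<in> einterval a b"
  shows "(\<lambda>l. evolution c B l t $ i $ j) holomorphic_on UNIV"
proof -
  obtain C T where CT: "C \<ge> 0" "T \<ge> 0"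
    "\<And>k t. t \<in> einterval a b \<Longrightarrow> norm (picard c B k t) \<le> C * (T ^ k / fact k)"
    by (rule picard_global_bound[OF B c]) (rule that; assumption)
  show ?thesis
    unfolding evolution_def by (rule evolution_entries_holomorphic[OF CT(3)[OF t]])
qed

text \<open>The bound uniform in \<open>t\<close> dominates the series, so Tannery's theorem
  exchanges limit and sum. The limits of the Picard terms inherit the bound, hence their power
  series is entire. The filter is left abstract to cover both ends.\<close>

lemma evolution_end_limit_aux:
  fixes B :: "real \<Rightarrow> complex ^ 'n ^ 'n::finite"
  assumes B: "B absolutely_integrable_on einterval a b" and c: "c \<in> einterval a b"
    and F: "F \<noteq> bot" "\<forall>\<^sub>F x in F. real_of_ereal x \<in> einterval a b"
    and lim: "\<And>k. \<exists>L. ((\<lambda>x. picard c B k (real_of_ereal x)) \<longlongrightarrow> L) F"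
  shows "\<exists>E. (\<forall>l. ((\<lambda>x. evolution c B l (real_of_ereal x)) \<longlongrightarrow> E l) F) \<and>
             (\<forall>i j. (\<lambda>l. E l $ i $ j) holomorphic_on UNIV)"
proof -
  obtain C T where CT: "C \<ge> 0" "T \<ge> 0"
    "\<And>k t. t \<in> einterval a b \<Longrightarrow> norm (picard c B k t) \<le> C * (T ^ k / fact k)"
    by (rule picard_global_bound[OF B c]) (rule that; assumption)
  obtain Z where Z: "\<And>k. ((\<lambda>x. picard c B k (real_of_ereal x)) \<longlongrightarrow> Z k) F"
    using lim by metis
  have bZ: "norm (Z k) \<le> C * (T ^ k / fact k)" for k
  proof (rule tendsto_upperbound[OF tendsto_norm[OF Z] _ F(1)])
    show "\<forall>\<^sub>F x in F. norm (picard c B k (real_of_ereal x)) \<le> C * (T ^ k / fact k)"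
      using F(2) by eventually_elim (rule CT(3))
  qed
  have "((\<lambda>x. evolution c B l (real_of_ereal x)) \<longlongrightarrow> (\<Sum>k. mat (l ^ k) ** Z k)) F" for l
  proof (intro vec_tendstoI)
    fix i j
    have nth_suminf: "(\<Sum>k. mat (l ^ k) ** Y k) $ i $ j = (\<Sum>k. (mat (l ^ k) ** Y k) $ i $ j)"
      if "\<And>k. norm (Y k) \<le> C * (T ^ k / fact k)" for Y :: "nat \<Rightarrow> complex ^ 'n ^ 'n"
      by (rule bounded_linear.suminf[OF bounded_linear_matrix_nth
            summable_norm_cancel[OF evolution_summable(1)[OF that]]])
    have term_le: "norm ((mat (l ^ k) ** Y) $ i $ j) \<le> C * ((norm l * T) ^ k /\<^sub>R fact k)"
      if "norm Y \<le> C * (T ^ k / fact k)" for Y :: "complex ^ 'n ^ 'n" and k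
      using Finite_Cartesian_Product.norm_nth_le[of "(mat (l ^ k) ** Y) $ i" j]
        Finite_Cartesian_Product.norm_nth_le[of "mat (l ^ k) ** Y" i]
        evolution_term_bound[of "\<lambda>_. Y" k, OF that, of l]
      by linarith
    have "((\<lambda>x. \<Sum>k. (mat (l ^ k) ** picard c B k (real_of_ereal x)) $ i $ j) \<longlongrightarrow>
        (\<Sum>k. (mat (l ^ k) ** Z k) $ i $ j)) F"
    proof (rule conjunct2[OF conjunct2[OF tannerys_theorem]])
      show "((\<lambda>x. (mat (l ^ k) ** picard c B k (real_of_ereal x)) $ i $ j) \<longlongrightarrow> (mat (l ^ k) ** Z k) $ i $ j) F" for k
        by (intro tendsto_vec_nth bounded_linear.tendsto[OF matrix_mult_left_linear Z])
      show "\<forall>\<^sub>F (k, x) in sequentially \<times>\<^sub>F F. norm ((mat (l ^ k) ** picard c B k (real_of_ereal x)) $ i $ j) \<le>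
          C * ((norm l * T) ^ k /\<^sub>R fact k)"
        unfolding eventually_prod_filter
      proof (rule exI[of _ "\<lambda>_. True"], rule exI[of _ "\<lambda>x. real_of_ereal x \<in> einterval a b"],
          intro conjI allI impI)
        fix k x assume "real_of_ereal x \<in> einterval a b"
        then show "case (k, x) of (k, x) \<Rightarrow> norm ((mat (l ^ k) ** picard c B k (real_of_ereal x)) $ i $ j) \<le>
            C * ((norm l * T) ^ k /\<^sub>R fact k)"
          unfolding prod.case by (intro term_le CT(3))
      qed (use F(2) in simp_all)
      show "summable (\<lambda>k. C * ((norm l * T) ^ k /\<^sub>R fact k))"
        by (rule summable_mult[OF sums_summable[OF exp_converges]])
    qed (rule F(1))
    then have "((\<lambda>x. \<Sum>k. (mat (l ^ k) ** picard c B k (real_of_ereal x)) $ i $ j) \<longlongrightarrow>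
        (\<Sum>k. mat (l ^ k) ** Z k) $ i $ j) F"
      unfolding nth_suminf[OF bZ] .
    moreover have "\<forall>\<^sub>F x in F. (\<Sum>k. (mat (l ^ k) ** picard c B k (real_of_ereal x)) $ i $ j) =
        evolution c B l (real_of_ereal x) $ i $ j"
      using F(2)
    proof eventually_elim
      fix x assume "real_of_ereal x \<in> einterval a b"
      then show "(\<Sum>k. (mat (l ^ k) ** picard c B k (real_of_ereal x)) $ i $ j) =
          evolution c B l (real_of_ereal x) $ i $ j"
        unfolding evolution_def by (intro nth_suminf[symmetric] CT(3))
    qed
    ultimately show "((\<lambda>x. evolution c B l (real_of_ereal x) $ i $ j) \<longlongrightarrow> (\<Sum>k. mat (l ^ k) ** Z k) $ i $ j) F"
      by (rule Lim_transform_eventually)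
  qed
  then show ?thesis
    using evolution_entries_holomorphic[OF bZ]
    by (intro exI[of _ "\<lambda>l. \<Sum>k. mat (l ^ k) ** Z k"]) blast
qed

lemma evolution_end_limits:
  fixes B :: "real \<Rightarrow> complex ^ 'n ^ 'n::finite"
  assumes B: "B absolutely_integrable_on einterval a b" and c: "c \<in> einterval a b"
  shows "\<exists>E. (\<forall>l. ((\<lambda>x. evolution c B l (real_of_ereal x)) \<longlongrightarrow> E l) (at_left b)) \<and>
             (\<forall>i j. (\<lambda>l. E l $ i $ j) holomorphic_on UNIV)"
    and "\<exists>E. (\<forall>l. ((\<lambda>x. evolution c B l (real_of_ereal x)) \<longlongrightarrow> E l) (at_right a)) \<and>
             (\<forall>i j. (\<lambda>l. E l $ i $ j) holomorphic_on UNIV)"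
   by (rule evolution_end_limit_aux[OF B c at_left_einterval_nontrivial[OF c]
         eventually_at_left_einterval[OF c] picard_end_limits(1)[OF B c]], assumption)
      (rule evolution_end_limit_aux[OF B c at_right_einterval_nontrivial[OF c]
         eventually_at_right_einterval[OF c] picard_end_limits(2)[OF B c]], assumption)

section \<open>Solutions of the Hamiltonian system\<close>

lemmas matrix_bilinear_simps =
  bounded_bilinear.minus_left[OF bounded_bilinear_matrix_mult]
  bounded_bilinear.minus_right[OF bounded_bilinear_matrix_mult]
  bounded_bilinear.diff_left[OF bounded_bilinear_matrix_mult]
  bounded_bilinear.diff_right[OF bounded_bilinear_matrix_mult]
  bounded_bilinear.add_left[OF bounded_bilinear_matrix_mult]
  bounded_bilinear.add_right[OF bounded_bilinear_matrix_mult]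

lemma ctranspose_mult: "ctranspose (A ** B) = ctranspose B ** ctranspose (A :: complex ^ 'n::finite ^ 'm)"
  by (simp add: vec_eq_iff ctranspose_def matrix_matrix_mult_def mult.commute)

lemma ctranspose_ctranspose [simp]: "ctranspose (ctranspose A) = A"
  by (simp add: vec_eq_iff ctranspose_def)

lemma ctranspose_add: "ctranspose (A + B) = ctranspose A + ctranspose B"
  by (simp add: vec_eq_iff ctranspose_def)

lemma ctranspose_mat: "ctranspose (mat l :: complex ^ 'n ^ 'n::finite) = mat (cnj l)"
  by (simp add: vec_eq_iff ctranspose_def mat_def)

lemma cdot_ctranspose: "cdot (A *v x) y = cdot x (ctranspose A *v y)"
proof -
  have "cdot (A *v x) y = (\<Sum>i\<in>UNIV. \<Sum>j\<in>UNIV. cnj (A $ i $ j) * cnj (x $ j) * y $ i)"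
    by (simp add: cdot_def matrix_vector_mult_def sum_distrib_right)
  also have "\<dots> = (\<Sum>j\<in>UNIV. \<Sum>i\<in>UNIV. cnj (A $ i $ j) * cnj (x $ j) * y $ i)"
    by (rule sum.swap)
  also have "\<dots> = cdot x (ctranspose A *v y)"
    by (simp add: cdot_def matrix_vector_mult_def ctranspose_def sum_distrib_left mult_ac)
  finally show ?thesis .
qed

lemma cdot_axis_left: "cdot (axis i 1) x = x $ i"
  by (simp add: cdot_def axis_def if_distrib[of cnj] if_distrib[of "\<lambda>x. x * _"] cong: if_cong)

lemma matrix_mult_axis_nth: "(A *v axis i (1 :: complex)) $ j = A $ j $ i"
  by (simp add: matrix_vector_mult_def axis_def if_distrib[of "\<lambda>x. _ * x"] cong: if_cong)

lemma sum_UNIV_sum: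
  fixes f :: "'a::finite + 'b::finite \<Rightarrow> 'c::comm_monoid_add"
  shows "sum f UNIV = (\<Sum>i\<in>UNIV. f (Inl i)) + (\<Sum>i\<in>UNIV. f (Inr i))"
  by (subst UNIV_Plus_UNIV[symmetric], subst sum.Plus) auto

lemma symp_J_square: "symp_J ** symp_J = (- mat 1 :: complex ^ ('m::finite + 'm) ^ ('m + 'm))"
proof -
  have "(symp_J ** symp_J) $ p $ q = (- mat 1 :: complex ^ ('m + 'm) ^ ('m + 'm)) $ p $ q" for p q
    unfolding matrix_matrix_mult_def symp_J_def mat_def
    by (cases p; cases q)
       (simp_all add: sum_UNIV_sum if_distrib[of "\<lambda>x. x * _"] cong: if_cong)
  then show ?thesis by (simp add: vec_eq_iff)
qed

lemma ctranspose_symp_J: "ctranspose symp_J = (- symp_J :: complex ^ ('m::finite + 'm) ^ ('m + 'm))"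
proof -
  have "ctranspose symp_J $ p $ q = (- symp_J :: complex ^ ('m + 'm) ^ ('m + 'm)) $ p $ q" for p q
    unfolding ctranspose_def symp_J_def by (cases p; cases q) auto
  then show ?thesis by (simp add: vec_eq_iff)
qed

lemma symp_J_cancel [simp]: "symp_J ** (symp_J ** A) = - A"
  for A :: "complex ^ 'k::finite ^ ('m::finite + 'm)"
  by (simp add: matrix_mul_assoc symp_J_square matrix_bilinear_simps matrix_mul_lid)

text \<open>The matrix form lets one identity carry the pairings of all columns at once.\<close>

definition matrix_solution :: "ereal \<Rightarrow> ereal \<Rightarrow> (real \<Rightarrow> complex ^ ('m::finite + 'm) ^ ('m + 'm)) \<Rightarrow>
    (real \<Rightarrow> complex ^ ('m + 'm) ^ ('m + 'm)) \<Rightarrow> complex \<Rightarrow>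
    (real \<Rightarrow> complex ^ ('m + 'm) ^ ('m + 'm)) \<Rightarrow> bool"
  where "matrix_solution a b P W l Y \<longleftrightarrow> locally_absolutely_cont a b Y \<and>
           (AE t in lebesgue. t \<in> einterval a b \<longrightarrow>
              (\<exists>Y'. (Y has_vector_derivative Y') (at t) \<and> symp_J ** Y' = (P t + mat l ** W t) ** Y t))"

text \<open>Lagrange's identity. Since \<open>symp_J\<close> is skew and \<open>P t\<close>,
  \<open>W t\<close> are Hermitian, the terms with \<open>P\<close> cancel and only the difference
  of \<open>l\<close> and \<open>cnj k\<close> survives in front of the weight.\<close>

lemma matrix_solution_lagrange:
  assumes P: "\<And>t. t \<in> einterval a b \<Longrightarrow> hermitian (P t)" and W: "\<And>t. t \<in> einterval a b \<Longrightarrow> hermitian (W t)"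
    and F: "matrix_solution a b P W l F" and G: "matrix_solution a b P W k G"
  shows "locally_absolutely_cont a b (\<lambda>t. ctranspose (G t) ** (symp_J ** F t))"
    and "AE t in lebesgue. t \<in> einterval a b \<longrightarrow>
      ((\<lambda>t. ctranspose (G t) ** (symp_J ** F t)) has_vector_derivative
         mat (l - cnj k) ** (ctranspose (G t) ** (W t ** F t))) (at t)"
proof -
  have ac: "locally_absolutely_cont a b F" "locally_absolutely_cont a b G"
    using F G by (auto simp: matrix_solution_def)
  show "locally_absolutely_cont a b (\<lambda>t. ctranspose (G t) ** (symp_J ** F t))"
    by (rule locally_absolutely_cont_bilinear[OF bounded_bilinear_matrix_mult
          locally_absolutely_cont_bounded_linear[OF bounded_linear_ctranspose ac(2)]
          locally_absolutely_cont_bounded_linear[OF matrix_mult_left_linear ac(1)]])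
  have "AE t in lebesgue. t \<in> einterval a b \<longrightarrow>
              (\<exists>Y'. (F has_vector_derivative Y') (at t) \<and> symp_J ** Y' = (P t + mat l ** W t) ** F t)"
    "AE t in lebesgue. t \<in> einterval a b \<longrightarrow>
              (\<exists>Y'. (G has_vector_derivative Y') (at t) \<and> symp_J ** Y' = (P t + mat k ** W t) ** G t)"
    using F G by (auto simp: matrix_solution_def)
  then show "AE t in lebesgue. t \<in> einterval a b \<longrightarrow>
      ((\<lambda>t. ctranspose (G t) ** (symp_J ** F t)) has_vector_derivative
         mat (l - cnj k) ** (ctranspose (G t) ** (W t ** F t))) (at t)"
  proof eventually_elim
    case (elim t)
    show ?case
    proof
      assume t: "t \<in> einterval a b"
      then obtain F' G' where F': "(F has_vector_derivative F') (at t)" "symp_J ** F' = (P t + mat l ** W t) ** F t"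
        and G': "(G has_vector_derivative G') (at t)" "symp_J ** G' = (P t + mat k ** W t) ** G t"
        using elim by blast
      have "((\<lambda>t. ctranspose (G t) ** (symp_J ** F t)) has_vector_derivative
          ctranspose (G t) ** (symp_J ** F') + ctranspose G' ** (symp_J ** F t)) (at t)"
        by (rule bounded_bilinear.has_vector_derivative[OF bounded_bilinear_matrix_mult
              bounded_linear.has_vector_derivative[OF bounded_linear_ctranspose G'(1)]
              bounded_linear.has_vector_derivative[OF matrix_mult_left_linear F'(1)]])
      moreover have "ctranspose G' ** (symp_J ** F t) = - (ctranspose (symp_J ** G') ** F t)"
        by (simp add: ctranspose_mult ctranspose_symp_J matrix_bilinear_simps matrix_mul_assoc)
      moreover have "ctranspose (symp_J ** G') = ctranspose (G t) ** (P t + mat (cnj k) ** W t)"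
        using P[OF t] W[OF t]
        by (simp add: G'(2) ctranspose_mult ctranspose_add ctranspose_mat hermitian_def mat_commute)
      moreover have "mat (l - cnj k) ** (ctranspose (G t) ** (W t ** F t)) =
          ctranspose (G t) ** (mat l ** (W t ** F t)) - ctranspose (G t) ** (mat (cnj k) ** (W t ** F t))"
      proof -
        show ?thesis unfolding matrix_mult_mat_left by (simp add: vec_eq_iff algebra_simps)
      qed
      ultimately show "((\<lambda>t. ctranspose (G t) ** (symp_J ** F t)) has_vector_derivative
           mat (l - cnj k) ** (ctranspose (G t) ** (W t ** F t))) (at t)"
        by (simp add: F'(2) matrix_bilinear_simps matrix_mul_assoc[symmetric])
    qed
  qed
qed

lemma locally_integrable_mat_mult:
  fixes B :: "real \<Rightarrow> complex ^ 'n ^ 'n::finite"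
  shows "locally_integrable a b B \<Longrightarrow> locally_integrable a b (\<lambda>t. A ** B t)"
  by (rule locally_integrable_bounded_linear[OF matrix_mult_left_linear])

text \<open>The inverse of \<open>symp_J\<close> is \<open>- symp_J\<close>, so the system is an
  explicit linear equation with locally integrable coefficient, solved by \<open>evolution\<close>
  at parameter 1.\<close>

lemma matrix_solution_exists:
  assumes P: "locally_integrable a b P" and W: "locally_integrable a b W" and c: "c \<in> einterval a b"
  shows "\<exists>Y. matrix_solution a b P W l Y \<and> Y c = mat 1"
proof -
  let ?B = "\<lambda>t. - symp_J ** (P t + mat l ** W t)"
  have B: "locally_integrable a b ?B"
    by (intro locally_integrable_mat_mult locally_integrable_add P W)
  have "matrix_solution a b P W l (evolution c ?B 1)"
    unfolding matrix_solution_def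
  proof
    show "AE t in lebesgue. t \<in> einterval a b \<longrightarrow> (\<exists>Y'. (evolution c ?B 1 has_vector_derivative Y') (at t) \<and>
            symp_J ** Y' = (P t + mat l ** W t) ** evolution c ?B 1 t)"
      using evolution_solves(3)[OF B c, of 1]
      by eventually_elim
         (auto intro!: exI simp: matrix_mul_lid matrix_bilinear_simps(1) matrix_bilinear_simps(2) matrix_mul_assoc[symmetric])
  qed (rule evolution_solves(2)[OF B c])
  then show ?thesis using evolution_solves(1)[OF B c, of 1] by blast
qed

text \<open>The assumption exhibits a left inverse of \<open>ctranspose B\<close> up to order; for
  square matrices one-sided inverses are two-sided, which moves the relation to the other
  side.\<close>

lemma symplectic_inverse:
  fixes A B :: "complex ^ ('m::finite + 'm) ^ ('m + 'm)"
  assumes "ctranspose B ** (symp_J ** A) = symp_J"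
  shows "A ** (symp_J ** ctranspose B) = symp_J"
proof -
  have "ctranspose B ** (symp_J ** A ** (- symp_J)) = mat 1"
    using assms by (simp add: matrix_bilinear_simps matrix_mul_assoc symp_J_square)
  then have "(symp_J ** A ** (- symp_J)) ** ctranspose B = mat 1"
    by (simp add: matrix_left_right_inverse)
  then have "symp_J ** (- symp_J ** A ** symp_J ** ctranspose B) = symp_J"
    by (simp add: matrix_bilinear_simps matrix_mul_assoc)
  then show ?thesis
    by (simp add: matrix_bilinear_simps matrix_mul_assoc[symmetric])
qed

lemma matrix_solution_pairing_constant:
  assumes P: "\<And>t. t \<in> einterval a b \<Longrightarrow> hermitian (P t)" and W: "\<And>t. t \<in> einterval a b \<Longrightarrow> hermitian (W t)"
    and F: "matrix_solution a b P W l F" and G: "matrix_solution a b P W (cnj l) G"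
    and "c \<in> einterval a b" "t \<in> einterval a b"
  shows "ctranspose (G t) ** (symp_J ** F t) = ctranspose (G c) ** (symp_J ** F c)"
proof (rule locally_absolutely_cont_zero_derivative[OF matrix_solution_lagrange(1)[OF P W F G] _ assms(6,5)])
  have "mat 0 ** A = (0 :: complex ^ ('a + 'a) ^ ('a + 'a))" for A
    by (simp add: vec_eq_iff)
  then show "AE t in lebesgue. t \<in> einterval a b \<longrightarrow>
      ((\<lambda>t. ctranspose (G t) ** (symp_J ** F t)) has_vector_derivative 0) (at t)"
    using matrix_solution_lagrange(2)[OF P W F G] by simp
qed auto

text \<open>No Gronwall estimate is involved: pairing with a solution for the conjugate parameter
  gives a constant, and this pairing is invertible by \<open>symplectic_inverse\<close>.\<close>

lemma matrix_solution_unique: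
  assumes P: "\<And>t. t \<in> einterval a b \<Longrightarrow> hermitian (P t)" and W: "\<And>t. t \<in> einterval a b \<Longrightarrow> hermitian (W t)"
    and "locally_integrable a b P" "locally_integrable a b W"
    and Y: "matrix_solution a b P W l Y" "Y c = mat 1" and F: "matrix_solution a b P W l F"
    and c: "c \<in> einterval a b" and t: "t \<in> einterval a b"
  shows "F t = Y t ** F c"
proof -
  obtain G where G: "matrix_solution a b P W (cnj l) G" "G c = mat 1"
    using matrix_solution_exists[OF assms(3,4) c] by blast
  have 1: "ctranspose (G t) ** (symp_J ** Y t) = symp_J"
    using matrix_solution_pairing_constant[OF P W Y(1) G(1) c t]
    by (simp add: G(2) Y(2) ctranspose_mat matrix_mul_lid matrix_mul_rid)
  have 2: "ctranspose (G t) ** (symp_J ** F t) = symp_J ** F c"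
    using matrix_solution_pairing_constant[OF P W F G(1) c t]
    by (simp add: G(2) ctranspose_mat matrix_mul_lid)
  have 3: "Y t ** (symp_J ** ctranspose (G t)) = symp_J" by (rule symplectic_inverse[OF 1])
  have "symp_J ** (symp_J ** F t) = Y t ** (symp_J ** ctranspose (G t)) ** (symp_J ** F t)"
    by (simp only: 3)
  also have "\<dots> = Y t ** (symp_J ** (symp_J ** F c))"
    by (simp only: matrix_mul_assoc[symmetric] 2)
  finally show ?thesis by (simp add: matrix_bilinear_simps)
qed

section \<open>Nonnegative weights and the weighted square integrable functions\<close>

lemma cdot_add_left: "cdot (x + y) z = cdot x z + cdot y z"
  and cdot_add_right: "cdot z (x + y) = cdot z x + cdot z y"
  and cdot_diff_left: "cdot (x - y) z = cdot x z - cdot y z"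
  and cdot_diff_right: "cdot z (x - y) = cdot z x - cdot z y"
  and cdot_scale_left: "cdot (k *s x) z = cnj k * cdot x z"
  and cdot_scale_right: "cdot z (k *s x) = k * cdot z x"
  by (simp_all add: cdot_def sum.distrib sum_subtractf sum_distrib_left algebra_simps)

lemma cdot_commute: "cdot x y = cnj (cdot y x)"
  by (simp add: cdot_def mult.commute)

lemma cdot_self_eq_0: "cdot x x = 0 \<longleftrightarrow> x = 0"
proof -
  have "cdot x x = of_real (\<Sum>i\<in>UNIV. (cmod (x $ i))\<^sup>2)"
    by (simp add: cdot_def complex_norm_square[symmetric] mult.commute)
  moreover have "(\<Sum>i\<in>UNIV. (cmod (x $ i))\<^sup>2) = 0 \<longleftrightarrow> x = 0"
    by (simp add: sum_nonneg_eq_0_iff vec_eq_iff)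
  ultimately show ?thesis by (metis of_real_eq_0_iff)
qed

lemma cdot_hermitian: "hermitian A \<Longrightarrow> cdot x (A *v y) = cnj (cdot y (A *v x))"
  by (subst cdot_commute) (simp add: cdot_ctranspose hermitian_def)

text \<open>Nonnegativity of the form at \<open>f - u *s g\<close> with a suitable phase
  \<open>u\<close>. The arithmetic mean in place of the geometric one gives directly an integrable
  majorant for products.\<close>

lemma nonneg_matrix_cauchy_schwarz:
  assumes "nonneg_matrix A"
  shows "2 * norm (cdot g (A *v f)) \<le> Re (cdot f (A *v f)) + Re (cdot g (A *v g))"
proof -
  define s where "s = cdot g (A *v f)"
  \<comment> \<open>The phase turning \<open>s\<close> into its modulus; it is 0 when
    \<open>s = 0\<close>, which explains the case distinctions below.\<close>
  define u where "u = sgn s"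
  have herm: "hermitian A" and pos: "0 \<le> Re (cdot v (A *v v))" for v
    using assms by (auto simp: nonneg_matrix_def)
  have us: "cnj u * s = of_real (norm s)"
    by (cases "s = 0") (simp_all add: u_def sgn_div_norm scaleR_conv_of_real field_simps
        complex_norm_square[symmetric] power2_eq_square flip: complex_cnj_mult)
  have uu: "cnj u * u = (if s = 0 then 0 else 1)"
    by (simp add: u_def complex_norm_square[symmetric] mult.commute norm_sgn)
  have "cdot (f - u *s g) (A *v (f - u *s g)) =
     cdot f (A *v f) - u * cdot f (A *v g) - cnj u * s + cnj u * u * cdot g (A *v g)"
    by (simp add: s_def matrix_vector_mult_diff_distrib vector_scalar_commute
        cdot_diff_left cdot_diff_right cdot_scale_left cdot_scale_right algebra_simps)
  moreover have "u * cdot f (A *v g) = cnj (cnj u * s)"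
    by (simp add: s_def cdot_hermitian[OF herm, of f g])
  ultimately have "cdot (f - u *s g) (A *v (f - u *s g)) =
     cdot f (A *v f) - 2 * of_real (norm s) + (if s = 0 then 0 else 1) * cdot g (A *v g)"
    unfolding us uu by simp
  then have "0 \<le> Re (cdot f (A *v f)) - 2 * norm s + (if s = 0 then 0 else 1) * Re (cdot g (A *v g))"
    using pos[of "f - u *s g"] by (simp split: if_splits)
  then show ?thesis using pos[of f] pos[of g] by (simp add: s_def split: if_splits)
qed

lemma nonneg_matrix_kernel:
  assumes "nonneg_matrix A" "Re (cdot f (A *v f)) = 0"
  shows "A *v f = 0"
proof -
  have herm: "hermitian A" using assms by (auto simp: nonneg_matrix_def)
  have zero: "cdot g (A *v f) = 0" for g
  proof (rule ccontr)
    assume ne: "cdot g (A *v f) \<noteq> 0"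
    define q where "q = Re (cdot g (A *v g))"
    \<comment> \<open>Scaling \<open>f\<close> makes the left side grow linearly while the form at
      \<open>f\<close> stays zero; this \<open>r\<close> makes the left side exceed
      \<open>q\<close>.\<close>
    define r where "r = (\<bar>q\<bar> + 1) / norm (cdot g (A *v f))"
    have "2 * norm (cdot g (A *v (complex_of_real r *s f))) \<le> 
       Re (cdot (complex_of_real r *s f) (A *v (complex_of_real r *s f))) + q"
      unfolding q_def by (rule nonneg_matrix_cauchy_schwarz[OF assms(1)])
    then have "2 * (\<bar>r\<bar> * norm (cdot g (A *v f))) \<le> q"
      using assms(2) by (simp add: vector_scalar_commute cdot_scale_left cdot_scale_right norm_mult
           flip: of_real_mult mult.assoc)
    moreover have "\<bar>r\<bar> * norm (cdot g (A *v f)) = \<bar>q\<bar> + 1"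
      using ne by (simp add: r_def)
    ultimately show False by linarith
  qed
  then show ?thesis using cdot_self_eq_0 by blast
qed

lemma locally_integrable_measurable:
  fixes f :: "real \<Rightarrow> 'a::euclidean_space"
  assumes f: "locally_integrable a b f"
  shows "f \<in> borel_measurable (lebesgue_on (einterval a b))"
proof (cases "einterval a b = {}")
  case False
  then obtain c where c: "c \<in> einterval a b" by auto
  obtain p q :: "nat \<Rightarrow> real" where pq: "\<And>n. a < ereal (p n)" "\<And>n. ereal (q n) < b" "\<And>n. p n \<le> c" "\<And>n. c \<le> q n"
    "\<And>t. t \<in> einterval a b \<Longrightarrow> \<exists>n. p n < t \<and> t < q n"
    by (rule einterval_exhaustion[OF c]) (rule that; assumption)
  note sub = einterval_subinterval[OF pq(1,2)]
  show ?thesis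
  proof (rule measurable_piecewise_restrict[of "range (\<lambda>n. {p n..q n})"])
    fix S assume "S \<in> range (\<lambda>n. {p n..q n})"
    then obtain n where S: "S = {p n..q n}" by blast
    show "S \<inter> space (lebesgue_on (einterval a b)) \<in> sets (lebesgue_on (einterval a b))"
      unfolding S by (auto simp: sets_restrict_space)
    have "restrict_space (lebesgue_on (einterval a b)) S = lebesgue_on S"
      using sub[of n n] by (simp add: restrict_restrict_space S Int_absorb1)
    then show "f \<in> borel_measurable (restrict_space (lebesgue_on (einterval a b)) S)"
      using absolutely_integrable_measurable[of S f] locally_integrableD[OF f pq(1,2), of n n] by (simp add: S)
  qed (use pq(5) in \<open>auto simp: space_restrict_space, meson less_imp_le\<close>)
qed (simp add: measurable_def space_restrict_space)

lemma set_borel_measurable_iff: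
  fixes f :: "real \<Rightarrow> 'a::euclidean_space"
  shows "set_borel_measurable lebesgue (einterval a b) f \<longleftrightarrow> f \<in> borel_measurable (lebesgue_on (einterval a b))"
  by (subst borel_measurable_restrict_space_iff) (auto simp: set_borel_measurable_def)

lemma bounded_bilinear_continuous_on:
  assumes "bounded_bilinear H" shows "continuous_on UNIV (\<lambda>x. H (fst x) (snd x))"
  by (intro bounded_bilinear.continuous_on[OF assms] continuous_intros)

lemma borel_measurable_bilinear:
  fixes H :: "'a::euclidean_space \<Rightarrow> 'b::euclidean_space \<Rightarrow> 'c::euclidean_space"
  assumes "bounded_bilinear H" "f \<in> borel_measurable M" "g \<in> borel_measurable M"
  shows "(\<lambda>x. H (f x) (g x)) \<in> borel_measurable M"
  by (rule borel_measurable_continuous_Pair[OF assms(2,3) bounded_bilinear_continuous_on[OF assms(1)]])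

lemma weighted_product_measurable:
  assumes "locally_integrable a b W" "f \<in> borel_measurable (lebesgue_on (einterval a b))"
    "g \<in> borel_measurable (lebesgue_on (einterval a b))"
  shows "(\<lambda>t. cdot (g t) (W t *v f t)) \<in> borel_measurable (lebesgue_on (einterval a b))"
  by (intro borel_measurable_bilinear[OF bounded_bilinear_cdot] assms
      borel_measurable_bilinear[OF bounded_bilinear_matrix_vector_mult] locally_integrable_measurable)

lemma L2hatD:
  assumes "f \<in> L2hat a b W"
  shows "f \<in> borel_measurable (lebesgue_on (einterval a b))"
    "(\<lambda>t. cdot (f t) (W t *v f t)) absolutely_integrable_on einterval a b"
  using assms by (auto simp: L2hat_def set_borel_measurable_iff)

lemma L2hatI:
  assumes "f \<in> borel_measurable (lebesgue_on (einterval a b))"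
    "(\<lambda>t. cdot (f t) (W t *v f t)) absolutely_integrable_on einterval a b"
  shows "f \<in> L2hat a b W"
  using assms by (auto simp: L2hat_def set_borel_measurable_iff)

lemma L2hat_product_integrable:
  assumes W: "locally_integrable a b W" "\<And>t. t \<in> einterval a b \<Longrightarrow> nonneg_matrix (W t)"
    and f: "f \<in> L2hat a b W" and g: "g \<in> L2hat a b W"
  shows "(\<lambda>t. cdot (g t) (W t *v f t)) absolutely_integrable_on einterval a b"
proof (rule measurable_bounded_by_integrable_imp_absolutely_integrable)
  show "(\<lambda>t. cdot (g t) (W t *v f t)) \<in> borel_measurable (lebesgue_on (einterval a b))"
    by (rule weighted_product_measurable[OF W(1) L2hatD(1)[OF f] L2hatD(1)[OF g]])
  have re: "(\<lambda>t. Re (cdot (f t) (W t *v f t))) integrable_on einterval a b" if "f \<in> L2hat a b W" for f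
    using integrable_linear[OF set_lebesgue_integral_eq_integral(1)[OF L2hatD(2)[OF that]] bounded_linear_Re]
    by (simp add: o_def)
  show "(\<lambda>t. Re (cdot (f t) (W t *v f t)) + Re (cdot (g t) (W t *v g t))) integrable_on einterval a b"
    by (rule integrable_add[OF re[OF f] re[OF g]])
  show "norm (cdot (g t) (W t *v f t)) \<le> Re (cdot (f t) (W t *v f t)) + Re (cdot (g t) (W t *v g t))"
    if "t \<in> einterval a b" for t
    using nonneg_matrix_cauchy_schwarz[OF W(2)[OF that], of "g t" "f t"] norm_ge_zero[of "cdot (g t) (W t *v f t)"]
    by linarith
qed simp

lemma L2hat_combination:
  assumes W: "locally_integrable a b W" "\<And>t. t \<in> einterval a b \<Longrightarrow> nonneg_matrix (W t)"
    and f: "f \<in> L2hat a b W" and g: "g \<in> L2hat a b W"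
  shows "(\<lambda>t. x *s f t + y *s g t) \<in> L2hat a b W"
proof (rule L2hatI)
  have lin: "bounded_linear (\<lambda>v :: complex ^ 'n. x *s v)" for x
    using bounded_bilinear.bounded_linear_right[OF bounded_bilinear_matrix_vector_mult, of "mat x"]
    by (simp add: mat_vector_mult)
  have "(\<lambda>t. x *s h t) \<in> borel_measurable (lebesgue_on (einterval a b))" if "h \<in> L2hat a b W" for h x
    by (rule borel_measurable_continuous_onI[THEN measurable_compose_rev, OF _ L2hatD(1)[OF that]])
       (rule linear_continuous_on[OF lin])
  then show "(\<lambda>t. x *s f t + y *s g t) \<in> borel_measurable (lebesgue_on (einterval a b))"
    using f g by (intro borel_measurable_add) auto
  note i = L2hat_product_integrable[OF W]
  have m: "(\<lambda>t. k * h t) absolutely_integrable_on einterval a b" if "h absolutely_integrable_on einterval a b"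
    for k :: complex and h
    using absolutely_integrable_linear[OF that bounded_linear_mult_right[of k]] by (simp add: o_def)
  have "(\<lambda>t. (cnj x * x * cdot (f t) (W t *v f t) + cnj x * y * cdot (f t) (W t *v g t)) +
       (cnj y * x * cdot (g t) (W t *v f t) + cnj y * y * cdot (g t) (W t *v g t))) absolutely_integrable_on einterval a b"
    by (intro set_integral_add(1) m i f g)
  then show "(\<lambda>t. cdot (x *s f t + y *s g t) (W t *v (x *s f t + y *s g t))) absolutely_integrable_on einterval a b"
    by (simp add: matrix_vector_right_distrib vector_scalar_commute cdot_add_left cdot_add_right
        cdot_scale_left cdot_scale_right algebra_simps)
qed

lemma absolutely_integrable_componentwise_vec:
  fixes f :: "real \<Rightarrow> 'a::euclidean_space ^ 'n"
  assumes "\<And>i. (\<lambda>t. f t $ i) absolutely_integrable_on S"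
  shows "f absolutely_integrable_on S"
proof -
  have ax: "bounded_linear (axis i :: 'a \<Rightarrow> 'a ^ 'n)" for i
    unfolding linear_conv_bounded_linear[symmetric]
    by (auto intro!: linearI simp: vec_eq_iff axis_def)
  have "(\<lambda>t. \<Sum>i\<in>UNIV. axis i (f t $ i)) absolutely_integrable_on S"
    using absolutely_integrable_linear[OF assms ax]
    by (intro absolutely_integrable_sum) (auto simp: o_def)
  moreover have "(\<Sum>i\<in>UNIV. axis i (f t $ i)) = f t" for t
    by (simp add: vec_eq_iff axis_def)
  ultimately show ?thesis by simp
qed

text \<open>Each entry pairs a column of \<open>G\<close> with a column of \<open>F\<close>, so
  integrability of products of square integrable functions suffices.\<close>

lemma gram_integrable:
  assumes W: "locally_integrable a b W" "\<And>t. t \<in> einterval a b \<Longrightarrow> nonneg_matrix (W t)"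
    and F: "\<And>v. (\<lambda>t. F t *v v) \<in> L2hat a b W" and G: "\<And>v. (\<lambda>t. G t *v v) \<in> L2hat a b W"
  shows "(\<lambda>t. ctranspose (G t) ** (W t ** F t)) absolutely_integrable_on einterval a b"
proof (intro absolutely_integrable_componentwise_vec)
  fix i j
  have "(ctranspose (G t) ** (W t ** F t)) $ i $ j = cdot (G t *v axis i 1) (W t *v (F t *v axis j 1))" for t
    by (simp add: cdot_ctranspose cdot_axis_left matrix_vector_mul_assoc matrix_mult_axis_nth)
  then show "(\<lambda>t. (ctranspose (G t) ** (W t ** F t)) $ i $ j) absolutely_integrable_on einterval a b"
    using L2hat_product_integrable[OF W F G] by simp
qed

lemma L2hat_cong:
  assumes f: "f \<in> L2hat a b W" and eq: "\<And>t. t \<in> einterval a b \<Longrightarrow> g t = f t"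
  shows "g \<in> L2hat a b W"
proof (rule L2hatI)
  show "g \<in> borel_measurable (lebesgue_on (einterval a b))"
    using L2hatD(1)[OF f] by (subst measurable_cong[of _ g f]) (auto simp: space_restrict_space eq)
  show "(\<lambda>t. cdot (g t) (W t *v g t)) absolutely_integrable_on einterval a b"
    using L2hatD(2)[OF f] by (subst set_integrable_cong[OF refl refl]) (auto simp: eq)
qed

lemma gram_integrable_imp_L2hat:
  assumes F: "continuous_on (einterval a b) F"
    and int: "(\<lambda>t. ctranspose (F t) ** (W t ** F t)) absolutely_integrable_on einterval a b"
  shows "(\<lambda>t. F t *v v) \<in> L2hat a b W"
proof (rule L2hatI)
  note mv = bounded_bilinear.bounded_linear_left[OF bounded_bilinear_matrix_vector_mult]
  show "(\<lambda>t. F t *v v) \<in> borel_measurable (lebesgue_on (einterval a b))"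
    by (rule continuous_imp_measurable_on_sets_lebesgue[OF bounded_linear.continuous_on[OF mv F]]) simp
  have "bounded_linear (\<lambda>A. cdot v (A *v v))"
    by (rule bounded_linear_compose[OF bounded_bilinear.bounded_linear_right[OF bounded_bilinear_cdot] mv])
  from absolutely_integrable_linear[OF int this]
  show "(\<lambda>t. cdot (F t *v v) (W t *v (F t *v v))) absolutely_integrable_on einterval a b"
    by (simp add: o_def cdot_ctranspose matrix_vector_mul_assoc)
qed

lemma ham_solution_of_matrix:
  assumes "matrix_solution a b P W l Y" shows "ham_solution a b P W l (\<lambda>t. Y t *v v)"
proof -
  note lin = bounded_bilinear.bounded_linear_left[OF bounded_bilinear_matrix_vector_mult]
  have "AE t in lebesgue. t \<in> einterval a b \<longrightarrow>
              (\<exists>Y'. (Y has_vector_derivative Y') (at t) \<and> symp_J ** Y' = (P t + mat l ** W t) ** Y t)"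
    using assms by (simp add: matrix_solution_def)
  then have "AE t in lebesgue. t \<in> einterval a b \<longrightarrow>
              (\<exists>y'. ((\<lambda>t. Y t *v v) has_vector_derivative y') (at t) \<and>
                    symp_J *v y' = (P t + mat l ** W t) *v (Y t *v v))"
  proof eventually_elim
    case (elim t)
    show ?case
    proof
      assume "t \<in> einterval a b"
      then obtain Y' where Y': "(Y has_vector_derivative Y') (at t)" "symp_J ** Y' = (P t + mat l ** W t) ** Y t"
        using elim by blast
      show "\<exists>y'. ((\<lambda>t. Y t *v v) has_vector_derivative y') (at t) \<and>
                    symp_J *v y' = (P t + mat l ** W t) *v (Y t *v v)"
        using bounded_linear.has_vector_derivative[OF lin Y'(1)] Y'(2)
        by (intro exI[of _ "Y' *v v"]) (simp add: matrix_vector_mul_assoc)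
    qed
  qed
  moreover have "locally_absolutely_cont a b (\<lambda>t. Y t *v v)"
    by (rule locally_absolutely_cont_bounded_linear[OF lin]) (use assms in \<open>simp add: matrix_solution_def\<close>)
  ultimately show ?thesis
    unfolding ham_solution_def by blast
qed

text \<open>Repeating the vector in every column makes uniqueness for matrix solutions applicable to
  vector solutions.\<close>

lemma matrix_solution_of_ham:
  assumes "ham_solution a b P W l y" shows "matrix_solution a b P W l (\<lambda>t. \<chi> i j. y t $ i)"
proof -
  have lin: "bounded_linear (\<lambda>v :: complex ^ 'n. (\<chi> i j. v $ i) :: complex ^ 'k ^ 'n)"
    unfolding linear_conv_bounded_linear[symmetric]
    by (auto intro!: linearI simp: vec_eq_iff)
  have mult: "A ** (\<chi> i j. v $ i) = (\<chi> i j. (A *v v) $ i)" for A :: "complex ^ 'n ^ 'n::finite" and v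
    by (simp add: vec_eq_iff matrix_matrix_mult_def matrix_vector_mult_def)
  have "AE t in lebesgue. t \<in> einterval a b \<longrightarrow>
              (\<exists>y'. (y has_vector_derivative y') (at t) \<and> symp_J *v y' = (P t + mat l ** W t) *v y t)"
    using assms by (simp add: ham_solution_def)
  then have "AE t in lebesgue. t \<in> einterval a b \<longrightarrow>
              (\<exists>Y'. ((\<lambda>t. \<chi> i j. y t $ i) has_vector_derivative Y') (at t) \<and>
                    symp_J ** Y' = (P t + mat l ** W t) ** (\<chi> i j. y t $ i))"
  proof eventually_elim
    case (elim t)
    show ?case
    proof
      assume "t \<in> einterval a b"
      then obtain y' where y': "(y has_vector_derivative y') (at t)" "symp_J *v y' = (P t + mat l ** W t) *v y t"
        using elim by blast
      show "\<exists>Y'. ((\<lambda>t. \<chi> i j. y t $ i) has_vector_derivative Y') (at t) \<and>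
                    symp_J ** Y' = (P t + mat l ** W t) ** (\<chi> i j. y t $ i)"
        using bounded_linear.has_vector_derivative[OF lin y'(1)] y'(2)
        by (intro exI[of _ "\<chi> i j. y' $ i"]) (simp add: mult)
    qed
  qed
  moreover have "locally_absolutely_cont a b (\<lambda>t. \<chi> i j. y t $ i)"
    by (rule locally_absolutely_cont_bounded_linear[OF lin]) (use assms in \<open>simp add: ham_solution_def\<close>)
  ultimately show ?thesis
    unfolding matrix_solution_def by blast
qed

section \<open>Fundamental matrices and change of the spectral parameter\<close>

locale hamiltonian_system =
  fixes a b :: ereal and c :: real
    and P W :: "real \<Rightarrow> complex ^ ('m::finite + 'm) ^ ('m + 'm)"
  assumes c: "c \<in> einterval a b"
    and herm_P: "\<And>t. t \<in> einterval a b \<Longrightarrow> hermitian (P t)"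
    and herm_W: "\<And>t. t \<in> einterval a b \<Longrightarrow> hermitian (W t)"
    and nonneg_W: "\<And>t. t \<in> einterval a b \<Longrightarrow> nonneg_matrix (W t)"
    and int_P: "locally_integrable a b P"
    and int_W: "locally_integrable a b W"
begin

definition fundamental :: "complex \<Rightarrow> real \<Rightarrow> complex ^ ('m + 'm) ^ ('m + 'm)"
  where "fundamental l = (SOME Y. matrix_solution a b P W l Y \<and> Y c = mat 1)"

lemma fundamental: "matrix_solution a b P W l (fundamental l)" "fundamental l c = mat 1"
  using someI_ex[OF matrix_solution_exists[OF int_P int_W c, of l]] by (auto simp: fundamental_def)

lemma fundamental_continuous: "continuous_on (einterval a b) (fundamental l)"
  using fundamental(1)[of l] locally_absolutely_cont_continuous_on by (auto simp: matrix_solution_def)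

lemma matrix_solution_eq:
  assumes "matrix_solution a b P W l F" "t \<in> einterval a b"
  shows "F t = fundamental l t ** F c"
  by (rule matrix_solution_unique[OF herm_P herm_W int_P int_W fundamental assms(1) c assms(2)])

lemma ham_solution_eq:
  assumes "ham_solution a b P W l y" "t \<in> einterval a b"
  shows "y t = fundamental l t *v y c"
proof -
  have "((\<chi> i j. y t $ i) :: complex ^ ('m + 'm) ^ ('m + 'm)) = fundamental l t ** (\<chi> i j. y c $ i)"
    using matrix_solution_eq[OF matrix_solution_of_ham[OF assms(1)] assms(2)] .
  then show ?thesis
    by (simp add: vec_eq_iff matrix_matrix_mult_def matrix_vector_mult_def)
qed

lemma ham_solution_fundamental: "ham_solution a b P W l (\<lambda>t. fundamental l t *v v)"
  by (rule ham_solution_of_matrix[OF fundamental(1)])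

lemma fundamental_pairing:
  assumes "t \<in> einterval a b"
  shows "ctranspose (fundamental (cnj l) t) ** (symp_J ** fundamental l t) = symp_J"
  using matrix_solution_pairing_constant[OF herm_P herm_W fundamental(1) fundamental(1) c assms, of l]
  by (simp add: fundamental(2) ctranspose_mat matrix_mul_lid matrix_mul_rid)

text \<open>Variation of constants with respect to the spectral parameter \<open>k\<close>: the coefficient of the
  equation for the remaining factor involves only the weight.\<close>

definition relative_weight :: "complex \<Rightarrow> real \<Rightarrow> complex ^ ('m + 'm) ^ ('m + 'm)"
  where "relative_weight k t = ctranspose (fundamental (cnj k) t) ** (W t ** fundamental k t)"

definition relative_evolution :: "complex \<Rightarrow> complex \<Rightarrow> real \<Rightarrow> complex ^ ('m + 'm) ^ ('m + 'm)"
  where "relative_evolution k l = evolution c (\<lambda>t. - symp_J ** relative_weight k t) (l - k)"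

definition square_integrable :: "complex \<Rightarrow> bool"
  where "square_integrable l \<longleftrightarrow> (\<forall>v. (\<lambda>t. fundamental l t *v v) \<in> L2hat a b W)"

lemma relative_weight_locally_integrable:
  "locally_integrable a b (\<lambda>t. - symp_J ** relative_weight k t)"
proof -
  have "locally_integrable a b (\<lambda>t. ctranspose (fundamental (cnj k) t) ** (W t ** fundamental k t))"
    using locally_integrable_bilinear_continuous[OF bounded_bilinear.flip[OF bounded_bilinear_matrix_mult]
      locally_integrable_bilinear_continuous[OF bounded_bilinear_matrix_mult int_W fundamental_continuous]
      bounded_linear.continuous_on[OF bounded_linear_ctranspose fundamental_continuous]] .
  then show ?thesis unfolding relative_weight_def by (rule locally_integrable_mat_mult)
qed

text \<open>By the product rule the factor U must satisfy J Y_k U' = (l - k) W Y_k U. The inverse of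
  Y_k is expressed through the fundamental matrix at \<open>cnj k\<close>, via Y_k J Y_{cnj k}^* =
  J; this is why \<open>relative_weight\<close> pairs the two conjugate parameters.\<close>

lemma fundamental_factorization:
  assumes "t \<in> einterval a b"
  shows "fundamental l t = fundamental k t ** relative_evolution k l t"
proof -
  let ?Y = "fundamental k" and ?U = "relative_evolution k l" and ?B = "\<lambda>t. - symp_J ** relative_weight k t"
  note U = evolution_solves[OF relative_weight_locally_integrable c, of k "l - k", folded relative_evolution_def]
  have Yac: "locally_absolutely_cont a b ?Y" using fundamental(1) by (simp add: matrix_solution_def)
  have "matrix_solution a b P W l (\<lambda>t. ?Y t ** ?U t)"
    unfolding matrix_solution_def
  proof
    show "locally_absolutely_cont a b (\<lambda>t. ?Y t ** ?U t)"
      by (rule locally_absolutely_cont_bilinear[OF bounded_bilinear_matrix_mult Yac U(2)])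
    have "AE t in lebesgue. t \<in> einterval a b \<longrightarrow>
        (\<exists>Y'. (?Y has_vector_derivative Y') (at t) \<and> symp_J ** Y' = (P t + mat k ** W t) ** ?Y t)"
      using fundamental(1) by (simp add: matrix_solution_def)
    then show "AE t in lebesgue. t \<in> einterval a b \<longrightarrow>
        (\<exists>Y'. ((\<lambda>t. ?Y t ** ?U t) has_vector_derivative Y') (at t) \<and>
           symp_J ** Y' = (P t + mat l ** W t) ** (?Y t ** ?U t))"
      using U(3)
    proof (eventually_elim, intro impI)
      fix t assume t: "t \<in> einterval a b" and
       "t \<in> einterval a b \<longrightarrow> (\<exists>Y'. (?Y has_vector_derivative Y') (at t) \<and> symp_J ** Y' = (P t + mat k ** W t) ** ?Y t)"
       and u: "t \<in> einterval a b \<longrightarrow> (?U has_vector_derivative mat (l - k) ** (?B t ** ?U t)) (at t)"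
      then obtain Y' where Y': "(?Y has_vector_derivative Y') (at t)" "symp_J ** Y' = (P t + mat k ** W t) ** ?Y t"
        by blast
      let ?U' = "mat (l - k) ** (?B t ** ?U t)"
      have d: "((\<lambda>t. ?Y t ** ?U t) has_vector_derivative (?Y t ** ?U' + Y' ** ?U t)) (at t)"
        using u t by (intro bounded_bilinear.has_vector_derivative[OF bounded_bilinear_matrix_mult Y'(1)]) blast
      have inv: "?Y t ** (symp_J ** ctranspose (fundamental (cnj k) t)) = symp_J"
        by (rule symplectic_inverse[OF fundamental_pairing[OF t]])
      have "?Y t ** (?B t ** ?U t) = - (?Y t ** (symp_J ** ctranspose (fundamental (cnj k) t)) ** (W t ** ?Y t ** ?U t))"
        by (simp add: relative_weight_def matrix_bilinear_simps matrix_mul_assoc)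
      then have YB: "symp_J ** (?Y t ** (?B t ** ?U t)) = W t ** (?Y t ** ?U t)"
        unfolding inv by (simp add: matrix_bilinear_simps matrix_mul_assoc symp_J_square matrix_mul_lid)
      have split: "P t + mat l ** W t = (P t + mat k ** W t) + mat (l - k) ** W t"
        by (simp add: vec_eq_iff algebra_simps)
      have "symp_J ** (?Y t ** ?U' + Y' ** ?U t) = mat (l - k) ** (symp_J ** (?Y t ** (?B t ** ?U t))) + symp_J ** Y' ** ?U t"
        by (simp only: matrix_bilinear_simps(6) matrix_mult_mat_left[of "fundamental k t"]
            matrix_mult_mat_left[of symp_J]
            matrix_mul_assoc[of symp_J Y' "?U t"])
      also have "\<dots> = (P t + mat l ** W t) ** (?Y t ** ?U t)"
        unfolding YB Y'(2) split by (simp only: matrix_bilinear_simps matrix_mul_assoc add_ac)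
      finally show "\<exists>Y'. ((\<lambda>t. ?Y t ** ?U t) has_vector_derivative Y') (at t) \<and>
           symp_J ** Y' = (P t + mat l ** W t) ** (?Y t ** ?U t)"
        using d by blast
    qed
  qed
  from matrix_solution_eq[OF this assms] show ?thesis
    by (simp add: fundamental(2) U(1) matrix_mul_rid)
qed

lemma relative_weight_integrable:
  assumes "square_integrable k" "square_integrable (cnj k)"
  shows "relative_weight k absolutely_integrable_on einterval a b"
    and "(\<lambda>t. - symp_J ** relative_weight k t) absolutely_integrable_on einterval a b"
proof -
  show 1: "relative_weight k absolutely_integrable_on einterval a b"
    using assms unfolding square_integrable_def relative_weight_def
    by (intro gram_integrable[OF int_W nonneg_W]) auto
  show "(\<lambda>t. - symp_J ** relative_weight k t) absolutely_integrable_on einterval a b"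
    by (rule absolutely_integrable_mat_mult[OF 1])
qed

text \<open>Square integrability at \<open>k\<close> and at \<open>cnj k\<close> makes
  \<open>relative_weight k\<close> integrable up to the ends. The relative evolution U is then
  bounded, and U^* (Y_k^* W Y_k) U, the Gram integrand for \<open>l\<close>, is integrable.\<close>

lemma square_integrable_all:
  assumes "square_integrable k" "square_integrable (cnj k)"
  shows "square_integrable l"
  unfolding square_integrable_def
proof
  fix v
  let ?U = "relative_evolution k l"
  have Uc: "continuous_on (einterval a b) ?U"
    unfolding relative_evolution_def
    by (rule locally_absolutely_cont_continuous_on[OF evolution_solves(2)[OF relative_weight_locally_integrable c]])
  obtain C T where CT: "C \<ge> 0" "T \<ge> 0"
    "\<And>z t. t \<in> einterval a b \<Longrightarrow> norm (evolution c (\<lambda>t. - symp_J ** relative_weight k t) z t) \<le> C * exp (norm z * T)"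
    by (rule evolution_global_bound[OF relative_weight_integrable(2)[OF assms] c]) (rule that; assumption)
  have Ub: "bounded (?U ` einterval a b)"
    unfolding relative_evolution_def
    by (rule boundedI[of _ "C * exp (norm (l - k) * T)"]) (use CT in auto)
  have Ub': "bounded ((\<lambda>t. ctranspose (?U t)) ` einterval a b)"
    using bounded_linear_image[OF Ub bounded_linear_ctranspose] by (simp add: image_image)
  have Uc': "continuous_on (einterval a b) (\<lambda>t. ctranspose (?U t))"
    by (rule bounded_linear.continuous_on[OF bounded_linear_ctranspose Uc])
  have "(\<lambda>t. ctranspose (fundamental k t) ** (W t ** fundamental k t)) absolutely_integrable_on einterval a b"
    using assms(1) unfolding square_integrable_def by (intro gram_integrable[OF int_W nonneg_W]) auto
  then have "(\<lambda>t. (ctranspose (fundamental k t) ** (W t ** fundamental k t)) ** ?U t) absolutely_integrable_on einterval a b"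
    by (rule absolutely_integrable_bilinear_continuous[OF bounded_bilinear_matrix_mult _ _ Uc Ub]) simp
  then have "(\<lambda>t. ctranspose (?U t) ** ((ctranspose (fundamental k t) ** (W t ** fundamental k t)) ** ?U t))
      absolutely_integrable_on einterval a b"
    by (rule absolutely_integrable_bilinear_continuous[OF bounded_bilinear.flip[OF bounded_bilinear_matrix_mult] _ _ Uc' Ub']) simp
  then have "(\<lambda>t. ctranspose (fundamental k t ** ?U t) ** (W t ** (fundamental k t ** ?U t)))
      absolutely_integrable_on einterval a b"
    by (simp add: ctranspose_mult matrix_mul_assoc)
  then have "(\<lambda>t. (fundamental k t ** ?U t) *v v) \<in> L2hat a b W"
    by (rule gram_integrable_imp_L2hat[rotated])
       (rule bounded_bilinear.continuous_on[OF bounded_bilinear_matrix_mult fundamental_continuous Uc])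
  moreover have "fundamental l t = fundamental k t ** ?U t" if "t \<in> einterval a b" for t
    by (rule fundamental_factorization[OF that])
  ultimately show "(\<lambda>t. fundamental l t *v v) \<in> L2hat a b W"
    by (auto intro: L2hat_cong)
qed

end

section \<open>Boundary values in the limit circle case\<close>

lemma L2hat_join:
  assumes c: "c \<in> einterval a b" and y: "continuous_on (einterval a b) y"
    and l: "y \<in> L2hat a (ereal c) W" and r: "y \<in> L2hat (ereal c) b W"
  shows "y \<in> L2hat a b W"
proof (rule L2hatI)
  show "y \<in> borel_measurable (lebesgue_on (einterval a b))"
    by (rule continuous_imp_measurable_on_sets_lebesgue[OF y]) simp
  let ?h = "\<lambda>t. cdot (y t) (W t *v y t)"
  have "?h absolutely_integrable_on {c}"
    using absolutely_integrable_continuous_real[of c c ?h] by simp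
  then have "?h absolutely_integrable_on (einterval a (ereal c) \<union> einterval (ereal c) b) \<union> {c}"
    by (intro absolutely_integrable_Un L2hatD(2)[OF l] L2hatD(2)[OF r])
  moreover have "(einterval a (ereal c) \<union> einterval (ereal c) b) \<union> {c} = einterval a b"
  proof -
    have ab: "a < ereal c" "ereal c < b" using c by (auto simp: einterval_def)
    have "t \<in> (einterval a (ereal c) \<union> einterval (ereal c) b) \<union> {c} \<longleftrightarrow> t \<in> einterval a b" for t
      using ab less_trans[of a "ereal c" "ereal t"] less_trans[of "ereal t" "ereal c" b]
      by (cases t c rule: linorder_cases) (auto simp: einterval_def)
    then show ?thesis by blast
  qed
  ultimately show "?h absolutely_integrable_on einterval a b" by simp
qed

text \<open>The integrand has nonnegative real part, so it vanishes almost everywhere, and a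
  nonnegative Hermitian matrix annihilates every null vector of its form.\<close>

lemma inner_c_eq_0_imp_AE:
  assumes W: "\<And>t. t \<in> einterval a b \<Longrightarrow> nonneg_matrix (W t)"
    and f: "f \<in> L2hat a b W" and zero: "Re (inner_c a b W f f) = 0"
  shows "AE t in lebesgue. t \<in> einterval a b \<longrightarrow> W t *v f t = 0"
proof -
  let ?h = "\<lambda>t. indicator (einterval a b) t *\<^sub>R cdot (f t) (W t *v f t)"
  have int: "integrable lebesgue ?h"
    using L2hatD(2)[OF f] by (simp add: set_integrable_def)
  have "integral\<^sup>L lebesgue (\<lambda>t. Re (?h t)) = 0"
    using zero integral_Re[OF int] by (simp add: inner_c_def set_lebesgue_integral_def)
  moreover have "AE t in lebesgue. 0 \<le> Re (?h t)"
    using W by (intro AE_I2) (auto simp: indicator_def nonneg_matrix_def)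
  ultimately have "AE t in lebesgue. Re (?h t) = 0"
    using integral_nonneg_eq_0_iff_AE[OF integrable_Re[OF int]] by simp
  then show ?thesis
  proof eventually_elim
    fix t assume "Re (?h t) = 0"
    then show "t \<in> einterval a b \<longrightarrow> W t *v f t = 0"
      using nonneg_matrix_kernel[OF W, of t "f t"] by (cases "t \<in> einterval a b") auto
  qed
qed

locale limit_circle_system = hamiltonian_system a b c P W
  for a b :: ereal and c :: real
    and P W :: "real \<Rightarrow> complex ^ ('m::finite + 'm) ^ ('m + 'm)" +
  assumes definite: "definite_on_subintervals a b P W"
    and limit_left: "limit_circle_left a b P W c"
    and limit_right: "limit_circle_right a b P W c"
begin

lemma ab: "a < ereal c" "ereal c < b" "a < b"
  using c less_trans[of a "ereal c" b] by (auto simp: einterval_def)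

lemma square_integrable: "square_integrable l"
proof (rule square_integrable_all)
  have *: "square_integrable k" if "k \<notin> \<real>" for k
    unfolding square_integrable_def
  proof
    fix v
    have sol: "ham_solution a b P W k (\<lambda>t. fundamental k t *v v)"
      by (rule ham_solution_fundamental)
    then have "continuous_on (einterval a b) (\<lambda>t. fundamental k t *v v)"
      using locally_absolutely_cont_continuous_on by (auto simp: ham_solution_def)
    then show "(\<lambda>t. fundamental k t *v v) \<in> L2hat a b W"
      using limit_left limit_right that sol unfolding limit_circle_left_def limit_circle_right_def
      by (intro L2hat_join[OF c]) blast+
  qed
  show "square_integrable \<i>" by (rule *) (simp add: complex_is_Real_iff)
  show "square_integrable (cnj \<i>)" by (rule *) (simp add: complex_is_Real_iff)
qed

lemma ham_solution_square_integrable: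
  assumes "ham_solution a b P W l y" shows "y \<in> L2hat a b W"
proof (rule L2hat_cong)
  show "(\<lambda>t. fundamental l t *v y c) \<in> L2hat a b W"
    using square_integrable[of l] unfolding square_integrable_def by blast
qed (rule ham_solution_eq[OF assms])

abbreviation weight0 :: "real \<Rightarrow> complex ^ ('m + 'm) ^ ('m + 'm)" where "weight0 \<equiv> relative_weight 0"

definition U :: "complex \<Rightarrow> real \<Rightarrow> complex ^ ('m + 'm) ^ ('m + 'm)"
  where "U l = evolution c (\<lambda>t. - symp_J ** weight0 t) l"

lemma coefficient_integrable:
  "weight0 absolutely_integrable_on einterval a b"
  "(\<lambda>t. - symp_J ** weight0 t) absolutely_integrable_on einterval a b"
  using relative_weight_integrable[OF square_integrable square_integrable, of 0] by auto

lemma fundamental_U: "t \<in> einterval a b \<Longrightarrow> fundamental l t = fundamental 0 t ** U l t"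
  using fundamental_factorization[of t l 0] by (simp add: relative_evolution_def U_def)

text \<open>The reduced equation is again a Hamiltonian system, with zero potential and weight
  \<open>weight0\<close>, so Lagrange's identity applies to \<open>U\<close> itself.\<close>

lemma U_matrix_solution: "matrix_solution a b (\<lambda>_. 0) weight0 l (U l)" "U l c = mat 1"
proof -
  note ev = evolution_solves[OF relative_weight_locally_integrable c, of 0 l, folded U_def]
  show "U l c = mat 1" by (rule ev(1))
  show "matrix_solution a b (\<lambda>_. 0) weight0 l (U l)"
    unfolding matrix_solution_def
  proof
    show "AE t in lebesgue. t \<in> einterval a b \<longrightarrow>
              (\<exists>Y'. (U l has_vector_derivative Y') (at t) \<and> symp_J ** Y' = (0 + mat l ** weight0 t) ** U l t)"
      using ev(3)
    proof eventually_elim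
      case (elim t)
      moreover have "symp_J ** (mat l ** (- symp_J ** weight0 t ** U l t)) = (0 + mat l ** weight0 t) ** U l t"
        unfolding matrix_mult_mat_left by (simp add: matrix_bilinear_simps matrix_mul_assoc symp_J_square matrix_mul_lid)
      ultimately show ?case by blast
    qed
  qed (rule ev(2))
qed

lemma U_continuous: "continuous_on (einterval a b) (U l)"
  using U_matrix_solution(1)[of l] locally_absolutely_cont_continuous_on by (auto simp: matrix_solution_def)

text \<open>The choice ranges over whole functions of the parameter, so that the limit property and
  the holomorphy of entries are obtained for the same object.\<close>

definition U_left :: "complex \<Rightarrow> complex ^ ('m + 'm) ^ ('m + 'm)"
  where "U_left = (SOME E. (\<forall>l. ((\<lambda>x. U l (real_of_ereal x)) \<longlongrightarrow> E l) (at_right a)) \<and>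
             (\<forall>i j. (\<lambda>l. E l $ i $ j) holomorphic_on UNIV))"

definition U_right :: "complex \<Rightarrow> complex ^ ('m + 'm) ^ ('m + 'm)"
  where "U_right = (SOME E. (\<forall>l. ((\<lambda>x. U l (real_of_ereal x)) \<longlongrightarrow> E l) (at_left b)) \<and>
             (\<forall>i j. (\<lambda>l. E l $ i $ j) holomorphic_on UNIV))"

lemma U_left: "((\<lambda>x. U l (real_of_ereal x)) \<longlongrightarrow> U_left l) (at_right a)"
    "(\<lambda>l. U_left l $ i $ j) holomorphic_on UNIV"
  using someI_ex[OF evolution_end_limits(2)[OF coefficient_integrable(2) c]]
  unfolding U_left_def U_def by blast+

lemma U_right: "((\<lambda>x. U l (real_of_ereal x)) \<longlongrightarrow> U_right l) (at_left b)"
    "(\<lambda>l. U_right l $ i $ j) holomorphic_on UNIV"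
  using someI_ex[OF evolution_end_limits(1)[OF coefficient_integrable(2) c]]
  unfolding U_right_def U_def by blast+

lemma U_bound:
  obtains C T where "C \<ge> 0" "T \<ge> 0" "\<And>l t. t \<in> einterval a b \<Longrightarrow> norm (U l t) \<le> C * exp (norm l * T)"
  by (rule evolution_global_bound[OF coefficient_integrable(2) c, folded U_def]) (rule that; assumption)

lemma U_holomorphic: "t \<in> einterval a b \<Longrightarrow> (\<lambda>l. U l t $ i $ j) holomorphic_on UNIV"
  unfolding U_def by (rule evolution_holomorphic[OF coefficient_integrable(2) c])

lemma U_bounded: "bounded (U l ` einterval a b)"
proof -
  obtain C T where "C \<ge> 0" "T \<ge> 0" and CT: "\<And>l t. t \<in> einterval a b \<Longrightarrow> norm (U l t) \<le> C * exp (norm l * T)"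
    by (rule U_bound) (rule that; assumption)
  show ?thesis by (rule boundedI[of _ "C * exp (norm l * T)"]) (use CT in auto)
qed

lemma U_gram_integrable:
  "(\<lambda>t. ctranspose (U k t) ** (weight0 t ** U l t)) absolutely_integrable_on einterval a b"
proof -
  have b: "bounded ((\<lambda>t. ctranspose (U k t)) ` einterval a b)"
    using bounded_linear_image[OF U_bounded bounded_linear_ctranspose] by (simp add: image_image)
  have cont: "continuous_on (einterval a b) (\<lambda>t. ctranspose (U k t))"
    by (rule bounded_linear.continuous_on[OF bounded_linear_ctranspose U_continuous])
  have "(\<lambda>t. weight0 t ** U l t) absolutely_integrable_on einterval a b"
    by (rule absolutely_integrable_bilinear_continuous[OF bounded_bilinear_matrix_mult coefficient_integrable(1) _
          U_continuous U_bounded]) simp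
  then show ?thesis
    by (rule absolutely_integrable_bilinear_continuous[OF bounded_bilinear.flip[OF bounded_bilinear_matrix_mult] _ _ cont b]) simp
qed

text \<open>By \<open>fundamental_U\<close> the integrand is Y_k^* W Y_l on the interval, so this is
  the matrix of weighted inner products of solutions.\<close>

definition gram :: "complex \<Rightarrow> complex \<Rightarrow> complex ^ ('m + 'm) ^ ('m + 'm)"
  where "gram k l = integral (einterval a b) (\<lambda>t. ctranspose (U k t) ** (weight0 t ** U l t))"

lemma weight0_hermitian: "t \<in> einterval a b \<Longrightarrow> hermitian (weight0 t)"
  using herm_W[of t]
  by (simp add: relative_weight_def hermitian_def ctranspose_mult matrix_mul_assoc)

text \<open>Lagrange's identity for the reduced system, integrated from \<open>c\<close> to both
  ends. Bounded \<open>U\<close> and integrable \<open>weight0\<close> make the integrand integrable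
  up to the ends, so the boundary terms are genuine limits.\<close>

lemma U_green:
  "ctranspose (U_right k) ** (symp_J ** U_right l) - ctranspose (U_left k) ** (symp_J ** U_left l) =
     mat (l - cnj k) ** gram k l"
proof -
  let ?f = "\<lambda>t. ctranspose (U k t) ** (symp_J ** U l t)"
  let ?h = "\<lambda>t. mat (l - cnj k) ** (ctranspose (U k t) ** (weight0 t ** U l t))"
  have z: "hermitian (0 :: complex ^ ('m + 'm) ^ ('m + 'm))"
    by (simp add: hermitian_def vec_eq_iff ctranspose_def)
  have lag: "locally_absolutely_cont a b ?f"
      "AE t in lebesgue. t \<in> einterval a b \<longrightarrow> (?f has_vector_derivative ?h t) (at t)"
    by (rule matrix_solution_lagrange[OF z weight0_hermitian U_matrix_solution(1) U_matrix_solution(1)], assumption)+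
  have h: "?h absolutely_integrable_on einterval a b"
    by (rule absolutely_integrable_mat_mult[OF U_gram_integrable])
  have f: "?f t = ?f c + oriented_integral c ?h t" if t: "t \<in> einterval a b" for t
  proof -
    have hl: "locally_integrable a b ?h" by (rule absolutely_integrable_imp_locally_integrable[OF h])
    have "AE t in lebesgue. t \<in> einterval a b \<longrightarrow> ((\<lambda>t. ?f t - oriented_integral c ?h t) has_vector_derivative 0) (at t)"
      using lag(2) oriented_integral_has_vector_derivative[OF hl c]
    proof eventually_elim
      case (elim t)
      then show ?case
        using has_vector_derivative_diff[of ?f "?h t" "at t" "oriented_integral c ?h" "?h t"] by auto
    qed
    from locally_absolutely_cont_zero_derivative[OF locally_absolutely_cont_diff[OF lag(1)
          locally_absolutely_cont_oriented_integral[OF hl c]] this t c]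
    show ?thesis by (simp add: algebra_simps)
  qed
  have lim: "((\<lambda>x. ?f (real_of_ereal x)) \<longlongrightarrow> ctranspose Ek ** (symp_J ** El)) F"
    if "((\<lambda>x. U k (real_of_ereal x)) \<longlongrightarrow> Ek) F" "((\<lambda>x. U l (real_of_ereal x)) \<longlongrightarrow> El) F" for Ek El F
    by (rule bounded_bilinear.tendsto[OF bounded_bilinear_matrix_mult
          bounded_linear.tendsto[OF bounded_linear_ctranspose that(1)]
          bounded_linear.tendsto[OF matrix_mult_left_linear that(2)]])
  note ends = oriented_integral_end_limits[OF h c]
  have "((\<lambda>x. ?f (real_of_ereal x)) \<longlongrightarrow> ?f c + integral (einterval a b) (\<lambda>s. if c \<le> s then ?h s else 0)) (at_left b)"
    by (rule Lim_transform_eventually[OF tendsto_add[OF tendsto_const ends(1)]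
         eventually_at_left_einterval[OF c f[symmetric]]])
  then have r: "ctranspose (U_right k) ** (symp_J ** U_right l) = ?f c + integral (einterval a b) (\<lambda>s. if c \<le> s then ?h s else 0)"
    by (rule tendsto_unique[OF at_left_einterval_nontrivial[OF c] lim[OF U_right(1) U_right(1)]])
  have "((\<lambda>x. ?f (real_of_ereal x)) \<longlongrightarrow> ?f c + - integral (einterval a b) (\<lambda>s. if s \<le> c then ?h s else 0)) (at_right a)"
    by (rule Lim_transform_eventually[OF tendsto_add[OF tendsto_const ends(2)]
         eventually_at_right_einterval[OF c f[symmetric]]])
  then have l: "ctranspose (U_left k) ** (symp_J ** U_left l) = ?f c + - integral (einterval a b) (\<lambda>s. if s \<le> c then ?h s else 0)"
    by (rule tendsto_unique[OF at_right_einterval_nontrivial[OF c] lim[OF U_left(1) U_left(1)]])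
  have "integral (einterval a b) ?h = mat (l - cnj k) ** gram k l"
    unfolding gram_def
    using integral_linear[OF set_lebesgue_integral_eq_integral(1)[OF U_gram_integrable] matrix_mult_left_linear]
    by (simp add: o_def)
  then show ?thesis unfolding r l using ends(3) by simp
qed

end

section \<open>Definiteness of the Gram matrix and the parameter derivative of the boundary
  form\<close>

lemma ham_solution_imp_ham_eq:
  assumes "ham_solution a b P W l y"
  shows "ham_eq a b P W y (\<lambda>t. l *s y t)"
proof -
  have "AE t in lebesgue. t \<in> einterval a b \<longrightarrow>
              (\<exists>y'. (y has_vector_derivative y') (at t) \<and> symp_J *v y' = (P t + mat l ** W t) *v y t)"
    using assms by (simp add: ham_solution_def)
  then show ?thesis
    unfolding ham_eq_def
  proof eventually_elim
    case (elim t)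
    have "(P t + mat l ** W t) *v y t - P t *v y t = W t *v (l *s y t)"
      by (simp only: matrix_vector_mult_add_rdistrib matrix_vector_mul_assoc[symmetric] mat_vector_mult
          vector_scalar_commute add_diff_cancel_left')
    with elim show ?case by metis
  qed
qed

context limit_circle_system
begin

text \<open>The definiteness assumption on the whole interval, with \<open>l *s y t\<close> as
  right-hand side; this is admissible because every solution is square integrable.\<close>

lemma solution_zero:
  assumes y: "ham_solution a b P W l y" and zero: "AE t in lebesgue. t \<in> einterval a b \<longrightarrow> W t *v y t = 0"
    and t: "t \<in> einterval a b"
  shows "y t = 0"
proof -
  have "(\<lambda>t. l *s y t + 0 *s y t) \<in> L2hat a b W"
    by (rule L2hat_combination[OF int_W nonneg_W ham_solution_square_integrable[OF y] ham_solution_square_integrable[OF y]])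
  then have "(\<lambda>t. l *s y t) \<in> L2hat a b W" by (simp add: vec_eq_iff)
  moreover have "ham_eq a b P W y (\<lambda>t. l *s y t)" by (rule ham_solution_imp_ham_eq[OF y])
  moreover have "locally_absolutely_cont a b y" using y by (simp add: ham_solution_def)
  ultimately show ?thesis
    using definite ab(3) zero t unfolding definite_on_subintervals_def by blast
qed

lemma gram_quadratic:
  "cdot v (gram l l *v v) = inner_c a b W (\<lambda>t. fundamental l t *v v) (\<lambda>t. fundamental l t *v v)"
proof -
  have lin: "bounded_linear (\<lambda>A. cdot v (A *v v))"
    by (rule bounded_linear_compose[OF bounded_bilinear.bounded_linear_right[OF bounded_bilinear_cdot]
          bounded_bilinear.bounded_linear_left[OF bounded_bilinear_matrix_vector_mult]])
  have "ham_solution a b P W l (\<lambda>t. fundamental l t *v v)" by (rule ham_solution_fundamental)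
  then have "inner_c a b W (\<lambda>t. fundamental l t *v v) (\<lambda>t. fundamental l t *v v) =
      integral (einterval a b) (\<lambda>t. cdot (fundamental l t *v v) (W t *v (fundamental l t *v v)))"
    unfolding inner_c_def
    by (intro set_lebesgue_integral_eq_integral(2) L2hatD(2) ham_solution_square_integrable)
  also have "\<dots> = integral (einterval a b) (\<lambda>t. cdot v ((ctranspose (U l t) ** (weight0 t ** U l t)) *v v))"
  proof (rule integral_cong)
    fix t assume t: "t \<in> einterval a b"
    show "cdot (fundamental l t *v v) (W t *v (fundamental l t *v v)) =
        cdot v ((ctranspose (U l t) ** (weight0 t ** U l t)) *v v)"
      unfolding fundamental_U[OF t, of l]
      by (simp add: cdot_ctranspose matrix_vector_mul_assoc ctranspose_mult relative_weight_def matrix_mul_assoc)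
  qed
  also have "\<dots> = cdot v (gram l l *v v)"
    unfolding gram_def
    using integral_linear[OF set_lebesgue_integral_eq_integral(1)[OF U_gram_integrable] lin] by (simp add: o_def)
  finally show ?thesis by simp
qed

lemma gram_definite:
  assumes "cdot v (gram l l *v v) = 0" shows "v = 0"
proof -
  have sol: "ham_solution a b P W l (\<lambda>t. fundamental l t *v v)" by (rule ham_solution_fundamental)
  have "AE t in lebesgue. t \<in> einterval a b \<longrightarrow> W t *v (fundamental l t *v v) = 0"
    by (rule inner_c_eq_0_imp_AE[OF nonneg_W ham_solution_square_integrable[OF sol]])
       (use assms gram_quadratic[of v l] in auto)
  from solution_zero[OF sol this c] show ?thesis by (simp add: fundamental(2))
qed

lemma gram_tendsto:
  assumes z: "z \<longlonglongrightarrow> l" and zb: "\<And>n. norm (z n) \<le> norm l + 1"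
  shows "(\<lambda>n. gram k (z n)) \<longlonglongrightarrow> gram k l"
proof -
  obtain C T where CT: "C \<ge> 0" "T \<ge> 0" "\<And>l t. t \<in> einterval a b \<Longrightarrow> norm (U l t) \<le> C * exp (norm l * T)"
    by (rule U_bound) (rule that; assumption)
  obtain K where K: "K > 0" "\<And>(A :: complex ^ ('m + 'm) ^ ('m + 'm)) (B :: complex ^ ('m + 'm) ^ ('m + 'm)).
      norm (A ** B) \<le> K * norm A * norm B"
    using matrix_mult_norm_bound by blast
  have "bounded ((\<lambda>t. ctranspose (U k t)) ` einterval a b)"
    using bounded_linear_image[OF U_bounded bounded_linear_ctranspose] by (simp add: image_image)
  then obtain Q where Q: "Q > 0" "\<And>t. t \<in> einterval a b \<Longrightarrow> norm (ctranspose (U k t)) \<le> Q"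
    unfolding bounded_pos by auto
  \<comment> \<open>Each of the two matrix products costs a factor \<open>K\<close>;
    \<open>Q\<close> bounds the fixed factor, and the exponential bounds \<open>U (z n)\<close>
    uniformly because the parameters stay within \<open>norm l + 1\<close>.\<close>
  define R where "R = K * Q * (K * (C * exp ((norm l + 1) * T)))"
  have 1: "(\<lambda>t. ctranspose (U k t) ** (weight0 t ** U (z n) t)) integrable_on einterval a b" for n
    by (rule set_lebesgue_integral_eq_integral(1)[OF U_gram_integrable])
  have "(\<lambda>t. norm (weight0 t)) integrable_on einterval a b"
    using set_lebesgue_integral_eq_integral(1)[OF absolutely_integrable_norm[OF coefficient_integrable(1)]]
    by (simp add: o_def)
  from integrable_on_cmult_left[OF this, of R]
  have 2: "(\<lambda>t. R * norm (weight0 t)) integrable_on einterval a b" by simp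
  have 3: "norm (ctranspose (U k t) ** (weight0 t ** U (z n) t)) \<le> R * norm (weight0 t)"
    if t: "t \<in> einterval a b" for n t
  proof -
    have U: "norm (U (z n) t) \<le> C * exp ((norm l + 1) * T)"
      by (rule order_trans[OF CT(3)[OF t]]) (intro mult_left_mono, use zb[of n] CT in \<open>auto intro: mult_right_mono\<close>)
    have "norm (ctranspose (U k t) ** (weight0 t ** U (z n) t)) \<le>
        K * norm (ctranspose (U k t)) * norm (weight0 t ** U (z n) t)" by (rule K(2))
    also have "\<dots> \<le> K * Q * (K * norm (weight0 t) * norm (U (z n) t))"
      using Q(2)[OF t] Q(1) K(1) by (intro mult_mono K(2) mult_nonneg_nonneg) auto
    also have "\<dots> \<le> K * Q * (K * norm (weight0 t) * (C * exp ((norm l + 1) * T)))"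
      using U Q(1) K(1) by (intro mult_left_mono mult_nonneg_nonneg) auto
    finally show ?thesis by (simp add: R_def mult_ac)
  qed
  have 4: "(\<lambda>n. ctranspose (U k t) ** (weight0 t ** U (z n) t)) \<longlonglongrightarrow> ctranspose (U k t) ** (weight0 t ** U l t)"
    if t: "t \<in> einterval a b" for t
  proof -
    have "(\<lambda>n. U (z n) t) \<longlonglongrightarrow> U l t"
    proof (intro vec_tendstoI)
      fix i j
      have "isCont (\<lambda>l. U l t $ i $ j) l"
        using holomorphic_on_imp_continuous_on[OF U_holomorphic[OF t, of i j]]
        by (simp add: continuous_on_eq_continuous_at)
      then show "(\<lambda>n. U (z n) t $ i $ j) \<longlonglongrightarrow> U l t $ i $ j"
        by (rule isCont_tendsto_compose[OF _ z])
    qed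
    then show ?thesis
      by (rule bounded_linear.tendsto[OF matrix_mult_left_linear bounded_linear.tendsto[OF matrix_mult_left_linear]])
  qed
  show ?thesis
    unfolding gram_def by (rule dominated_convergence(2)[OF 1 2 3 4])
qed

text \<open>The boundary form of an eigenfunction with the parameter derivative of the solution matrix is
  its squared norm; this is what excludes generalized eigenvectors.\<close>

lemma boundary_form_derivative:
  assumes real: "cnj l = l"
    and dL: "\<And>i j. ((\<lambda>l. U_left l $ i $ j) has_field_derivative dL $ i $ j) (at l)"
    and dR: "\<And>i j. ((\<lambda>l. U_right l $ i $ j) has_field_derivative dR $ i $ j) (at l)"
  shows "ctranspose (U_right l) ** (symp_J ** dR) - ctranspose (U_left l) ** (symp_J ** dL) = gram l l"
proof -
  \<comment> \<open>Nonzero increments tending to 0 and of modulus at most 1, as required for the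
    bound in \<open>gram_tendsto\<close>.\<close>
  define h :: "nat \<Rightarrow> complex" where "h n = of_real (inverse (real (Suc n)))" for n
  have h0: "h \<longlonglongrightarrow> 0"
    unfolding h_def using tendsto_of_real[OF LIMSEQ_inverse_real_of_nat] by (simp only: of_real_0)
  have hn: "h n \<noteq> 0" "norm (h n) \<le> 1" for n
    unfolding h_def norm_of_real by (simp_all add: field_simps del: of_real_inverse of_nat_Suc)
  have hat: "filterlim h (at 0) sequentially"
    using h0 hn(1) by (simp add: filterlim_at)
  have quot: "(\<lambda>n. mat (1 / h n) ** (E (l + h n) - E l)) \<longlonglongrightarrow> dE"
    if d: "\<And>i j. ((\<lambda>l. E l $ i $ j) has_field_derivative dE $ i $ j) (at l)"
    for E :: "complex \<Rightarrow> complex ^ ('m + 'm) ^ ('m + 'm)" and dE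
  proof (intro vec_tendstoI)
    fix i j
    have "((\<lambda>x. (E (l + x) $ i $ j - E l $ i $ j) / x) \<longlongrightarrow> dE $ i $ j) (at 0)"
      using d[of i j] by (simp add: DERIV_def)
    from filterlim_compose[OF this hat]
    show "(\<lambda>n. (mat (1 / h n) ** (E (l + h n) - E l)) $ i $ j) \<longlonglongrightarrow> dE $ i $ j" by simp
  qed
  let ?q = "\<lambda>E n. mat (1 / h n) ** (E (l + h n) - E l :: complex ^ ('m + 'm) ^ ('m + 'm))"
  \<comment> \<open>Green's identity for the pair (l, l + h) minus the one for (l, l), divided by h.
    Reality of \<open>l\<close> turns the two scalar factors into h and 0.\<close>
  have eq: "ctranspose (U_right l) ** (symp_J ** ?q U_right n) - ctranspose (U_left l) ** (symp_J ** ?q U_left n)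
      = gram l (l + h n)" for n
  proof -
    have "ctranspose (U_right l) ** (symp_J ** ?q U_right n) - ctranspose (U_left l) ** (symp_J ** ?q U_left n)
      = mat (1 / h n) **
        ((ctranspose (U_right l) ** (symp_J ** U_right (l + h n)) - ctranspose (U_left l) ** (symp_J ** U_left (l + h n)))
        - (ctranspose (U_right l) ** (symp_J ** U_right l) - ctranspose (U_left l) ** (symp_J ** U_left l)))"
      unfolding matrix_mult_mat_left by (simp add: matrix_bilinear_simps)
    also have "\<dots> = mat (1 / h n) ** (mat (h n) ** gram l (l + h n) - mat 0 ** gram l l)"
      unfolding U_green real by simp
    also have "\<dots> = gram l (l + h n)"
      using hn(1)[of n] by (simp add: vec_eq_iff)
    finally show ?thesis .
  qed
  have "(\<lambda>n. ctranspose (U_right l) ** (symp_J ** ?q U_right n) - ctranspose (U_left l) ** (symp_J ** ?q U_left n))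
     \<longlonglongrightarrow> ctranspose (U_right l) ** (symp_J ** dR) - ctranspose (U_left l) ** (symp_J ** dL)"
    by (rule tendsto_diff[OF bounded_linear.tendsto[OF matrix_mult_left_linear bounded_linear.tendsto
            [OF matrix_mult_left_linear quot[OF dR]]] bounded_linear.tendsto[OF matrix_mult_left_linear bounded_linear.tendsto
            [OF matrix_mult_left_linear quot[OF dL]]]])
  moreover have "(\<lambda>n. gram l (l + h n)) \<longlonglongrightarrow> gram l l"
  proof (rule gram_tendsto)
    show "(\<lambda>n. l + h n) \<longlonglongrightarrow> l" using tendsto_add[OF tendsto_const h0, of l] by simp
    show "norm (l + h n) \<le> norm l + 1" for n using norm_triangle_ineq[of l "h n"] hn(2)[of n] by simp
  qed
  ultimately show ?thesis unfolding eq by (rule LIMSEQ_unique)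
qed

section \<open>Boundary brackets against the solutions for parameter zero\<close>

lemma fund_sol_eq:
  assumes "t \<in> einterval a b" shows "fund_sol a b P W c l i t = fundamental l t *v axis i 1"
proof -
  have "ham_solution a b P W l (\<lambda>t. fundamental l t *v axis i 1) \<and> fundamental l c *v axis i 1 = axis i 1"
    using ham_solution_fundamental by (simp add: fundamental(2))
  then have *: "ham_solution a b P W l (fund_sol a b P W c l i) \<and> fund_sol a b P W c l i c = axis i 1"
    unfolding fund_sol_def by (rule someI[of "\<lambda>y. ham_solution a b P W l y \<and> y c = axis i 1"])
  then show ?thesis using ham_solution_eq[OF conjunct1[OF *] assms] by simp
qed

text \<open>The factor Y_0 occurs on both sides of J and drops out by
  \<open>fundamental_pairing\<close> at 0. The bracket involves only \<open>U\<close>, which has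
  limits at the ends even where the solution itself may have none.\<close>

lemma bracket_fund_sol:
  assumes t: "t \<in> einterval a b" and y: "y t = fundamental l t *v v"
  shows "bracket y (fund_sol a b P W c 0 i) t = ((symp_J ** U l t) *v v) $ i"
proof -
  have "bracket y (fund_sol a b P W c 0 i) t =
      ((ctranspose (fundamental 0 t) ** (symp_J ** (fundamental 0 t ** U l t))) *v v) $ i"
    by (simp add: bracket_def y fund_sol_eq[OF t] cdot_ctranspose cdot_axis_left matrix_vector_mul_assoc fundamental_U[OF t, of l])
  also have "ctranspose (fundamental 0 t) ** (symp_J ** (fundamental 0 t ** U l t)) = symp_J ** U l t"
    using fundamental_pairing[OF t, of 0] by (simp add: matrix_mul_assoc)
  finally show ?thesis .
qed

lemma bracket_ends:
  assumes y: "\<And>t. t \<in> einterval a b \<Longrightarrow> y t = fundamental l t *v v"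
  shows "bracket_at_left_end a y (fund_sol a b P W c 0 i) = ((symp_J ** U_left l) *v v) $ i"
    and "bracket_at_right_end b y (fund_sol a b P W c 0 i) = ((symp_J ** U_right l) *v v) $ i"
proof -
  have lin: "bounded_linear (\<lambda>A. ((symp_J ** A) *v v) $ i)"
    by (rule bounded_linear_compose[OF bounded_linear_vec_nth bounded_linear_compose
          [OF bounded_bilinear.bounded_linear_left[OF bounded_bilinear_matrix_vector_mult] matrix_mult_left_linear]])
  have eq: "((symp_J ** U l t) *v v) $ i = bracket y (fund_sol a b P W c 0 i) t" if "t \<in> einterval a b" for t
    by (rule bracket_fund_sol[of t y l v i, OF that y[OF that], symmetric])
  have "((\<lambda>x. bracket y (fund_sol a b P W c 0 i) (real_of_ereal x)) \<longlongrightarrow> ((symp_J ** U_left l) *v v) $ i) (at_right a)"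
    by (rule Lim_transform_eventually[OF bounded_linear.tendsto[OF lin U_left(1)]
          eventually_at_right_einterval[OF c eq]])
  then show "bracket_at_left_end a y (fund_sol a b P W c 0 i) = ((symp_J ** U_left l) *v v) $ i"
    unfolding bracket_at_left_end_def by (rule tendsto_Lim[OF at_right_einterval_nontrivial[OF c]])
  have "((\<lambda>x. bracket y (fund_sol a b P W c 0 i) (real_of_ereal x)) \<longlongrightarrow> ((symp_J ** U_right l) *v v) $ i) (at_left b)"
    by (rule Lim_transform_eventually[OF bounded_linear.tendsto[OF lin U_right(1)]
          eventually_at_left_einterval[OF c eq]])
  then show "bracket_at_right_end b y (fund_sol a b P W c 0 i) = ((symp_J ** U_right l) *v v) $ i"
    unfolding bracket_at_right_end_def by (rule tendsto_Lim[OF at_left_einterval_nontrivial[OF c]])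
qed

lemma Phi_ends:
  "Phi_left a b P W c l = symp_J ** U_left l" "Phi_right a b P W c l = symp_J ** U_right l"
  unfolding Phi_left_def Phi_right_def vec_eq_iff vec_lambda_beta
  by (intro allI, subst bracket_ends, erule fund_sol_eq, rule matrix_mult_axis_nth)+

end

section \<open>Self-adjoint boundary conditions and determinants\<close>

lemma cdot_self_nonneg: "0 \<le> Re (cdot x x)"
  by (auto simp: cdot_def intro!: sum_nonneg)

text \<open>After conjugation, a kernel vector of the adjoint is a linear relation among the rows.
  Since \<open>rows A\<close> is a set, the rank condition must first exclude repeated rows before
  independence of the set can be used.\<close>

lemma full_row_rank_ctranspose_injective:
  fixes A :: "complex ^ 'n ^ 'k"
  assumes rk: "rank A = CARD('k)" and x: "ctranspose A *v x = 0"
  shows "x = 0"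
proof -
  have rows: "rows A = range (\<lambda>i. row i A)" by (auto simp: rows_def)
  have fin: "finite (rows A)" unfolding rows by simp
  have "vec.dim (rows A) = CARD('k)" using rk by (simp add: row_rank_def_gen)
  moreover have "vec.dim (rows A) \<le> card (rows A)"
    by (rule vec.dim_le_card[OF vec.span_superset fin])
  moreover have "card (rows A) \<le> CARD('k)" unfolding rows by (rule card_image_le) simp
  ultimately have card: "card (rows A) = CARD('k)" "vec.dim (rows A) \<ge> card (rows A)" by auto
  have ind: "vec.independent (rows A)"
    by (rule vec.card_le_dim_spanning[OF subset_refl vec.span_superset fin card(2)])
  have inj: "inj (\<lambda>i. row i A)"
    by (rule eq_card_imp_inj_on) (use card(1) rows in auto)
  have "(\<Sum>i\<in>UNIV. cnj (x $ i) *s row i A) = 0"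
  proof -
    have "(\<Sum>i\<in>UNIV. cnj (x $ i) *s row i A) $ j = cnj ((ctranspose A *v x) $ j)" for j
      by (simp add: row_def ctranspose_def matrix_vector_mult_def mult.commute)
    then show ?thesis using x by (simp add: vec_eq_iff)
  qed
  then have "(\<Sum>v\<in>rows A. cnj (x $ the_inv (\<lambda>i. row i A) v) *s v) = 0"
    unfolding rows by (subst sum.reindex[OF inj]) (simp add: the_inv_f_f[OF inj] o_def)
  then have "cnj (x $ the_inv (\<lambda>i. row i A) (row i A)) = 0" for i
    by (rule vec.independentD[OF ind fin subset_refl]) (auto simp: rows)
  then show ?thesis by (simp add: the_inv_f_f[OF inj] vec_eq_iff)
qed

lemma ctranspose_hcat_mult:
  "ctranspose (hcat M N) *v x = 0 \<longleftrightarrow> ctranspose M *v x = 0 \<and> ctranspose N *v x = 0"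
proof -
  have "(ctranspose (hcat M N) *v x) $ Inl i = (ctranspose M *v x) $ i"
    "(ctranspose (hcat M N) *v x) $ Inr j = (ctranspose N *v x) $ j" for i j
    by (simp_all add: ctranspose_def hcat_def matrix_vector_mult_def)
  then show ?thesis unfolding vec_eq_iff split_sum_all by simp
qed

lemma hcat_mult:
  "hcat A B *v z = A *v (\<chi> i. z $ Inl i) + B *v (\<chi> i. z $ Inr i)"
  by (simp add: vec_eq_iff hcat_def matrix_vector_mult_def sum_UNIV_sum)

text \<open>A self-adjoint boundary condition defines a Lagrangian subspace: every pair of boundary values
  satisfying it has the form $(M^*x, N^*x)$. The orthogonal decomposition of an arbitrary pair along
  this subspace and its image under the boundary form yields the representation.\<close>

lemma selfadjoint_boundary_condition_representation:
  fixes M N :: "complex ^ ('m::finite + 'm) ^ ('m + 'm)"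
  assumes rk: "rank (hcat M N) = CARD('m + 'm)"
    and sa: "M ** symp_J ** ctranspose M = N ** symp_J ** ctranspose N"
    and bc: "M *v (symp_J *v u) = N *v (symp_J *v v)"
  shows "\<exists>x. u = ctranspose M *v x \<and> v = ctranspose N *v x"
proof -
  let ?J = "symp_J :: complex ^ ('m + 'm) ^ ('m + 'm)"
  have JJ: "?J *v (?J *v y) = - y" for y
    by (simp add: matrix_vector_mul_assoc symp_J_square bounded_bilinear.minus_left[OF bounded_bilinear_matrix_vector_mult])
  have neg: "A *v (- y) = - (A *v y)" for A :: "complex ^ ('m + 'm) ^ ('m + 'm)" and y
    by (rule bounded_bilinear.minus_right[OF bounded_bilinear_matrix_vector_mult])
  have ker: "y = 0" if "ctranspose M *v y = 0" "ctranspose N *v y = 0" for y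
    by (rule full_row_rank_ctranspose_injective[OF rk]) (simp add: ctranspose_hcat_mult that)
  \<comment> \<open>Injectivity of M M^* + N N^*: its quadratic form is a sum of two squared norms,
    and full row rank excludes a common kernel of the adjoints.\<close>
  have gram0: "y = 0" if "M *v (ctranspose M *v y) + N *v (ctranspose N *v y) = 0" for y
  proof -
    have "cdot y (M *v (ctranspose M *v y) + N *v (ctranspose N *v y)) =
        cdot (ctranspose M *v y) (ctranspose M *v y) + cdot (ctranspose N *v y) (ctranspose N *v y)"
      by (simp add: cdot_add_right cdot_ctranspose[of "ctranspose _"])
    then have z: "cdot (ctranspose M *v y) (ctranspose M *v y) + cdot (ctranspose N *v y) (ctranspose N *v y) = 0"
      using that by (simp add: cdot_def)
    then have "Re (cdot (ctranspose M *v y) (ctranspose M *v y)) + Re (cdot (ctranspose N *v y) (ctranspose N *v y)) = 0"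
      by (metis plus_complex.sel(1) zero_complex.sel(1))
    moreover have im: "cdot w w = of_real (Re (cdot w w))" for w :: "complex ^ ('m + 'm)"
      using cdot_commute[of w w] by (simp add: complex_eq_iff)
    ultimately have "cdot (ctranspose M *v y) (ctranspose M *v y) = 0" "cdot (ctranspose N *v y) (ctranspose N *v y) = 0"
      using cdot_self_nonneg[of "ctranspose M *v y"] cdot_self_nonneg[of "ctranspose N *v y"]
        im[of "ctranspose M *v y"] im[of "ctranspose N *v y"]
      by (simp_all add: add_nonneg_eq_0_iff)
    then show ?thesis using ker cdot_self_eq_0 by blast
  qed
  have sa': "M *v (?J *v (ctranspose M *v x)) = N *v (?J *v (ctranspose N *v x))" for x
    using sa by (simp add: matrix_vector_mul_assoc matrix_mul_assoc)
  \<comment> \<open>For the pair (M^* x - J M^* y, N^* x + J N^* y) the \<open>x\<close> part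
    satisfies the condition by \<open>sa'\<close>; since the square of J is minus the identity, the
    rest reads M M^* y + N N^* y = 0.\<close>
  have y0: "y = 0" if "M *v (?J *v (ctranspose M *v x - ?J *v (ctranspose M *v y))) =
      N *v (?J *v (ctranspose N *v x + ?J *v (ctranspose N *v y)))" for x y
  proof (rule gram0)
    have "M *v (?J *v (ctranspose M *v x)) + M *v (ctranspose M *v y) =
        N *v (?J *v (ctranspose N *v x)) - N *v (ctranspose N *v y)"
      using that by (simp add: matrix_vector_mult_diff_distrib matrix_vector_right_distrib JJ neg)
    then show "M *v (ctranspose M *v y) + N *v (ctranspose N *v y) = 0"
      unfolding sa' by (simp add: algebra_simps)
  qed
  \<comment> \<open>The square matrix of the map sending (x, y) to the pair above; its bijectivity
    is the orthogonal decomposition.\<close>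
  define E :: "complex ^ (('m + 'm) + ('m + 'm)) ^ (('m + 'm) + ('m + 'm))" where
    "E = (\<chi> p. case p of Inl i \<Rightarrow> hcat (ctranspose M) (- (?J ** ctranspose M)) $ i
            | Inr i \<Rightarrow> hcat (ctranspose N) (?J ** ctranspose N) $ i)"
  define fs :: "complex ^ (('m + 'm) + ('m + 'm)) \<Rightarrow> complex ^ ('m + 'm)" where "fs z = (\<chi> i. z $ Inl i)" for z
  define sn :: "complex ^ (('m + 'm) + ('m + 'm)) \<Rightarrow> complex ^ ('m + 'm)" where "sn z = (\<chi> i. z $ Inr i)" for z
  have fsE: "fs (E *v z) = ctranspose M *v fs z - ?J *v (ctranspose M *v sn z)" for z
  proof -
    have "fs (E *v z) = hcat (ctranspose M) (- (?J ** ctranspose M)) *v z"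
      unfolding vec_eq_iff fs_def vec_lambda_beta E_def matrix_vector_mult_def by simp
    also have "\<dots> = ctranspose M *v fs z - ?J *v (ctranspose M *v sn z)"
      by (simp add: hcat_mult fs_def sn_def matrix_vector_mul_assoc
          bounded_bilinear.minus_left[OF bounded_bilinear_matrix_vector_mult])
    finally show ?thesis .
  qed
  have snE: "sn (E *v z) = ctranspose N *v fs z + ?J *v (ctranspose N *v sn z)" for z
  proof -
    have "sn (E *v z) = hcat (ctranspose N) (?J ** ctranspose N) *v z"
      unfolding vec_eq_iff sn_def vec_lambda_beta E_def matrix_vector_mult_def by simp
    also have "\<dots> = ctranspose N *v fs z + ?J *v (ctranspose N *v sn z)"
      by (simp add: hcat_mult fs_def sn_def matrix_vector_mul_assoc)
    finally show ?thesis .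
  qed
  \<comment> \<open>The zero pair satisfies the boundary condition, so \<open>y0\<close> removes the
    second component and full rank the first. An injective square matrix is invertible, so every
    pair decomposes.\<close>
  have "z = 0" if "E *v z = 0" for z
  proof -
    have f0: "ctranspose M *v fs z - ?J *v (ctranspose M *v sn z) = 0"
      and s0: "ctranspose N *v fs z + ?J *v (ctranspose N *v sn z) = 0"
      using fsE[of z] snE[of z] that by (simp_all add: fs_def sn_def vec_eq_iff)
    have "sn z = 0" by (rule y0[of "fs z" "sn z"]) (simp only: f0 s0 matrix_vector_mult_0_right)
    moreover from this have "ctranspose M *v fs z = 0" "ctranspose N *v fs z = 0" using f0 s0 by auto
    then have "fs z = 0" by (rule ker)
    ultimately have "z $ p = 0" for p by (cases p) (simp_all add: vec_eq_iff fs_def sn_def)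
    then show "z = 0" by (simp add: vec_eq_iff)
  qed
  then obtain B where "B ** E = mat 1" using matrix_left_invertible_ker[of E] by blast
  then have EB: "E ** B = mat 1" by (simp add: matrix_left_right_inverse)
  define w where "w = B *v (\<chi> p. case p of Inl i \<Rightarrow> u $ i | Inr i \<Rightarrow> v $ i)"
  have Ew: "E *v w = (\<chi> p. case p of Inl i \<Rightarrow> u $ i | Inr i \<Rightarrow> v $ i)"
    by (simp add: w_def matrix_vector_mul_assoc EB)
  have u: "u = ctranspose M *v fs w - ?J *v (ctranspose M *v sn w)"
    unfolding fsE[symmetric] Ew by (simp add: fs_def vec_eq_iff)
  have v: "v = ctranspose N *v fs w + ?J *v (ctranspose N *v sn w)"
    unfolding snE[symmetric] Ew by (simp add: sn_def vec_eq_iff)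
  have "sn w = 0" by (rule y0[of "fs w"]) (use bc in \<open>simp only: u[symmetric] v[symmetric]\<close>)
  then show ?thesis using u v by (intro exI[of _ "fs w"]) simp
qed

text \<open>Representing only the first pair as (M^* x, N^* x) suffices: moving M and N across
  \<open>cdot\<close> leaves the boundary condition of the second pair, tested against
  \<open>x\<close>.\<close>

lemma selfadjoint_boundary_condition_isotropic:
  fixes M N :: "complex ^ ('m::finite + 'm) ^ ('m + 'm)"
  assumes rk: "rank (hcat M N) = CARD('m + 'm)"
    and sa: "M ** symp_J ** ctranspose M = N ** symp_J ** ctranspose N"
    and bc: "M *v (symp_J *v u) = N *v (symp_J *v v)" "M *v (symp_J *v u') = N *v (symp_J *v v')"
  shows "cdot v (symp_J *v v') = cdot u (symp_J *v u')"
proof -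
  obtain x where "u = ctranspose M *v x" "v = ctranspose N *v x"
    using selfadjoint_boundary_condition_representation[OF rk sa bc(1)] by blast
  then show ?thesis using bc(2) by (simp add: cdot_ctranspose)
qed

section \<open>Order of vanishing of the determinant of a matrix function\<close>

lemma det_holomorphic:
  fixes G :: "complex \<Rightarrow> complex ^ 'n ^ 'n::finite"
  assumes "\<And>i j. (\<lambda>z. G z $ i $ j) holomorphic_on S"
  shows "(\<lambda>z. det (G z)) holomorphic_on S"
  unfolding det_def by (intro holomorphic_intros assms)

text \<open>In a basis adapted to the kernel, each kernel direction contributes one factor \<open>z - z0\<close> to the
  determinant. The cofactor does not vanish at \<open>z0\<close>, because a vector in its kernel would produce a
  generalized eigenvector.\<close>

lemma zorder_det_eq_dim_kernel:
  fixes F :: "complex \<Rightarrow> complex ^ 'n ^ 'n::finite"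
  assumes hol: "\<And>i j. (\<lambda>z. F z $ i $ j) holomorphic_on UNIV"
    and dF: "\<And>i j. ((\<lambda>z. F z $ i $ j) has_field_derivative dF $ i $ j) (at z0)"
    and simple: "\<And>v w. F z0 *v v = 0 \<Longrightarrow> dF *v v = F z0 *v w \<Longrightarrow> v = 0"
  shows "zorder (\<lambda>z. det (F z)) z0 = int (vec.dim {v. F z0 *v v = 0})"
proof -
  define K where "K = {v. F z0 *v v = 0}"
  obtain Bk where Bk: "Bk \<subseteq> K" "vec.independent Bk" "K \<subseteq> vec.span Bk" "card Bk = vec.dim K"
    by (rule vec.basis_exists[of K]) (rule that; assumption)
  obtain B where B: "Bk \<subseteq> B" "vec.independent B" "UNIV \<subseteq> vec.span B"
    by (rule vec.maximal_independent_subset_extend[OF subset_UNIV Bk(2)]) (rule that; assumption)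
  have cardB: "card B = CARD('n)"
    using vec.basis_card_eq_dim[OF subset_UNIV B(3,2)] by (simp only: vec_dim_card)
  have finB: "finite B" using cardB by (intro card_ge_0_finite) simp
  obtain \<beta> where \<beta>: "bij_betw \<beta> (UNIV :: 'n set) B"
    using finite_same_card_bij[OF finite finB, of UNIV] cardB by auto
  define P :: "complex ^ 'n ^ 'n" where "P = (\<chi> i j. \<beta> j $ i)"
  have P_mult: "P *v x = (\<Sum>j\<in>UNIV. x $ j *s \<beta> j)" for x
    by (simp add: vec_eq_iff P_def matrix_vector_mult_def mult.commute)
  have inj: "inj \<beta>" using \<beta> by (simp add: bij_betw_def)
  have P_inj: "x = 0" if "P *v x = 0" for x
  proof -
    have "(\<Sum>v\<in>B. x $ the_inv \<beta> v *s v) = 0"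
      using that unfolding P_mult
      by (subst sum.reindex_bij_betw[OF \<beta>, symmetric]) (simp add: the_inv_f_f[OF inj])
    then have "x $ the_inv \<beta> (\<beta> j) = 0" for j
      by (rule vec.independentD[OF B(2) finB subset_refl]) (use \<beta> in \<open>auto simp: bij_betw_def\<close>)
    then show ?thesis by (simp add: the_inv_f_f[OF inj] vec_eq_iff)
  qed
  have detP: "det P \<noteq> 0"
    using P_inj matrix_left_invertible_ker[of P] invertible_det_nz[of P] invertible_left_inverse[of P] by blast
  define I where "I = {j. \<beta> j \<in> Bk}"
  have I_img: "\<beta> ` I = Bk" using \<beta> B(1) unfolding I_def bij_betw_def by blast
  then have cardI: "card I = vec.dim K"
    using Bk(4) card_image[OF inj_on_subset[OF inj subset_UNIV]] by metis
  have IK: "F z0 *v \<beta> j = 0" if "j \<in> I" for j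
    using that Bk(1) unfolding I_def K_def by blast
  define f where "f i j z = (F z *v \<beta> j) $ i" for i j z
  have f_hol: "f i j holomorphic_on UNIV" for i j
    unfolding f_def matrix_vector_mult_def vec_lambda_beta by (intro holomorphic_intros hol)
  have f_deriv: "deriv (f i j) z0 = (dF *v \<beta> j) $ i" for i j
  proof (rule DERIV_imp_deriv)
    show "(f i j has_field_derivative (dF *v \<beta> j) $ i) (at z0)"
      unfolding f_def matrix_vector_mult_def vec_lambda_beta by (intro DERIV_sum DERIV_cmult_right dF)
  qed
  \<comment> \<open>Kernel columns are divided by \<open>z - z0\<close>, the value at
    \<open>z0\<close> being the derivative; the singularity is removable because \<open>F z0\<close>
    annihilates these basis vectors.\<close>
  define G :: "complex \<Rightarrow> complex ^ 'n ^ 'n" where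
    "G z = (\<chi> i j. if j \<in> I then (if z = z0 then deriv (f i j) z0 else (f i j z - f i j z0) / (z - z0)) else f i j z)" for z
  have G_hol: "(\<lambda>z. G z $ i $ j) holomorphic_on UNIV" for i j
    unfolding G_def vec_lambda_beta using pole_lemma_open[OF f_hol open_UNIV] f_hol by (cases "j \<in> I") auto
  define D :: "complex \<Rightarrow> complex ^ 'n ^ 'n" where "D z = (\<chi> i j. if i = j then (if j \<in> I then z - z0 else 1) else 0)" for z
  have detD: "det (D z) = (z - z0) ^ card I" for z
  proof -
    have "det (D z) = (\<Prod>j\<in>UNIV. if j \<in> I then z - z0 else 1)"
      by (subst det_diagonal) (auto simp: D_def)
    also have "\<dots> = (\<Prod>j\<in>I. z - z0)" by (subst prod.If_cases) auto
    finally show ?thesis by simp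
  qed
  have FP: "F z ** P = G z ** D z" if "z \<noteq> z0" for z
  proof -
    have "(F z ** P) $ i $ j = f i j z" for i j
      by (simp add: f_def P_def matrix_matrix_mult_def matrix_vector_mult_def)
    moreover have "(G z ** D z) $ i $ j = G z $ i $ j * (if j \<in> I then z - z0 else 1)" for i j
      by (simp add: matrix_matrix_mult_def D_def if_distrib[of "\<lambda>x. _ * x"] cong: if_cong)
    moreover have "f i j z0 = 0" if "j \<in> I" for i j using IK[OF that] by (simp add: f_def)
    ultimately show ?thesis using that by (simp add: vec_eq_iff G_def)
  qed
  have detG: "det (G z0) \<noteq> 0"
  proof -
    have "x = 0" if x: "G z0 *v x = 0" for x
    proof -
      \<comment> \<open>At \<open>z0\<close> kernel columns of \<open>G\<close> carry the derivative
        and the others carry \<open>F z0\<close>, so a kernel vector of \<open>G z0\<close> yields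
        the relation excluded by \<open>simple\<close>, with v = P x1 and w = - P x2.\<close>
      define x1 where "x1 = (\<chi> j. if j \<in> I then x $ j else 0)"
      define x2 where "x2 = (\<chi> j. if j \<in> I then 0 else x $ j)"
      have A: "(A *v (P *v y)) $ i = (\<Sum>j\<in>UNIV. (A *v \<beta> j) $ i * y $ j)" for A :: "complex ^ 'n ^ 'n" and y i
      proof -
        have "(A *v (P *v y)) $ i = ((A ** P) *v y) $ i" by (simp add: matrix_vector_mul_assoc)
        also have "\<dots> = (\<Sum>j\<in>UNIV. (A *v \<beta> j) $ i * y $ j)"
          by (simp add: matrix_matrix_mult_def P_def matrix_vector_mult_def)
        finally show ?thesis .
      qed
      have G0: "G z0 $ i $ j = (if j \<in> I then (dF *v \<beta> j) $ i else (F z0 *v \<beta> j) $ i)" for i j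
        by (simp add: G_def f_deriv) (simp add: f_def)
      have "(G z0 *v x) $ i = (\<Sum>j\<in>UNIV. G z0 $ i $ j * x $ j)" for i
        by (simp add: matrix_vector_mult_def)
      then have "(G z0 *v x) $ i = (dF *v (P *v x1)) $ i + (F z0 *v (P *v x2)) $ i" for i
        unfolding A x1_def x2_def G0 sum.distrib[symmetric] by (auto intro!: sum.cong)
      then have split: "dF *v (P *v x1) + F z0 *v (P *v x2) = 0" using x by (simp add: vec_eq_iff)
      have "F z0 *v (P *v x1) = 0"
        unfolding vec_eq_iff A by (auto intro!: sum.neutral simp: x1_def IK)
      moreover have "dF *v (P *v x1) = F z0 *v (- (P *v x2))"
        using split by (simp add: bounded_bilinear.minus_right[OF bounded_bilinear_matrix_vector_mult] eq_neg_iff_add_eq_0)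
      ultimately have "P *v x1 = 0" by (rule simple)
      then have x1: "x1 = 0" by (rule P_inj)
      then have "F z0 *v (P *v x2) = 0" using split by simp
      \<comment> \<open>What remains lies in the kernel and so is a combination of the basis vectors
        indexed by \<open>I\<close>, while \<open>x2\<close> is supported off \<open>I\<close>;
        uniqueness of coordinates forces it to be zero.\<close>
      then have "P *v x2 \<in> vec.span Bk" using Bk(3) by (auto simp: K_def)
      then obtain u where u: "P *v x2 = (\<Sum>v\<in>Bk. u v *s v)"
        using vec.span_finite[OF finite_subset[OF B(1) finB]] by auto
      have "(\<Sum>v\<in>Bk. u v *s v) = (\<Sum>j\<in>I. u (\<beta> j) *s \<beta> j)"
        unfolding I_img[symmetric] by (rule sum.reindex_cong[OF inj_on_subset[OF inj subset_UNIV] refl refl])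
      also have "\<dots> = P *v (\<chi> j. if j \<in> I then u (\<beta> j) else 0)"
        unfolding P_mult by (simp add: if_distrib[of "\<lambda>x. x *s _"] sum.If_cases cong: if_cong)
      finally have "P *v (x2 - (\<chi> j. if j \<in> I then u (\<beta> j) else 0)) = 0"
        using u by (simp add: matrix_vector_mult_diff_distrib)
      from P_inj[OF this] have x2: "x2 $ j = (if j \<in> I then u (\<beta> j) else 0)" for j
        by (simp add: vec_eq_iff)
      have "x2 $ j = 0" for j
      proof (cases "j \<in> I")
        case True
        then show ?thesis by (simp add: x2_def)
      next
        case False
        then show ?thesis using x2[of j] by simp
      qed
      moreover have "x $ j = x1 $ j + x2 $ j" for j by (simp add: x1_def x2_def)
      ultimately show "x = 0" using x1 by (simp add: vec_eq_iff)
    qed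
    then show ?thesis
      using matrix_left_invertible_ker[of "G z0"] invertible_det_nz[of "G z0"] invertible_left_inverse[of "G z0"] by blast
  qed
  have "zorder (\<lambda>z. det (F z)) z0 = int (card I)"
  proof (rule zorder_eqI[OF open_UNIV UNIV_I])
    show "(\<lambda>z. det (G z) / det P) holomorphic_on UNIV"
      by (intro holomorphic_intros det_holomorphic G_hol detP)
    show "det (G z0) / det P \<noteq> 0" using detG detP by simp
    fix z assume "z \<in> (UNIV :: complex set)" "z \<noteq> z0"
    then have "det (F z) * det P = det (G z) * (z - z0) ^ card I"
      using arg_cong[OF FP, of z det] by (simp add: det_mul detD)
    then show "det (F z) = det (G z) / det P * (z - z0) powi int (card I)"
      using detP by (simp add: field_simps)
  qed
  then show ?thesis by (simp add: cardI K_def)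
qed

section \<open>Eigenfunctions\<close>

lemma matrix_vector_mult_sum:
  fixes A :: "complex ^ 'n ^ 'm"
  shows "A *v (\<Sum>y\<in>B. c y *s v y) = (\<Sum>y\<in>B. c y *s (A *v v y))"
  by (simp add: bounded_bilinear.sum_right[OF bounded_bilinear_matrix_vector_mult] vector_scalar_commute)

lemma ham_eq_diff:
  assumes "ham_eq a b P W y f" "ham_eq a b P W z g"
  shows "ham_eq a b P W (\<lambda>t. y t - z t) (\<lambda>t. f t - g t)"
  using assms unfolding ham_eq_def
proof eventually_elim
  case (elim t)
  show ?case
  proof
    assume "t \<in> einterval a b"
    then obtain y' z' where d: "(y has_vector_derivative y') (at t)" "(z has_vector_derivative z') (at t)"
      and e: "symp_J *v y' - P t *v y t = W t *v f t" "symp_J *v z' - P t *v z t = W t *v g t"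
      using elim by blast
    have "symp_J *v (y' - z') - P t *v (y t - z t) = W t *v (f t - g t)"
      unfolding matrix_vector_mult_diff_distrib e[symmetric] by simp
    then show "\<exists>y'. ((\<lambda>t. y t - z t) has_vector_derivative y') (at t) \<and>
      symp_J *v y' - P t *v (y t - z t) = W t *v (f t - g t)"
      using has_vector_derivative_diff[OF d] by blast
  qed
qed

lemma ham_eq_cong_rhs:
  assumes "ham_eq a b P W y f" "AE t in lebesgue. t \<in> einterval a b \<longrightarrow> W t *v f t = W t *v g t"
  shows "ham_eq a b P W y g"
  using assms unfolding ham_eq_def by eventually_elim auto

lemma ham_eq_imp_ham_solution:
  assumes "ham_eq a b P W y (\<lambda>t. l *s y t)" "locally_absolutely_cont a b y"
  shows "ham_solution a b P W l y"
proof -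
  have eq: "(P t + mat l ** W t) *v y t = P t *v y t + W t *v (l *s y t)" for t
    by (simp only: matrix_vector_mult_add_rdistrib matrix_vector_mul_assoc[symmetric] mat_vector_mult
          vector_scalar_commute)
  have "AE t in lebesgue. t \<in> einterval a b \<longrightarrow>
        (\<exists>y'. (y has_vector_derivative y') (at t) \<and> symp_J *v y' = (P t + mat l ** W t) *v y t)"
    using assms(1) unfolding ham_eq_def eq by eventually_elim (auto simp: algebra_simps)
  then show ?thesis using assms(2) by (simp add: ham_solution_def)
qed

context limit_circle_system
begin

section \<open>Classes in the quotient space and the maximal operator\<close>

abbreviation L2_class :: "(real \<Rightarrow> complex ^ ('m + 'm)) \<Rightarrow> (real \<Rightarrow> complex ^ ('m + 'm)) set"
  where "L2_class f \<equiv> L2_rel a b W `` {f}"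

abbreviation solution :: "complex \<Rightarrow> complex ^ ('m + 'm) \<Rightarrow> real \<Rightarrow> complex ^ ('m + 'm)"
  where "solution l v \<equiv> (\<lambda>t. fundamental l t *v v)"

lemma L2hat_diff: "f \<in> L2hat a b W \<Longrightarrow> g \<in> L2hat a b W \<Longrightarrow> (\<lambda>t. f t - g t) \<in> L2hat a b W"
  using L2hat_combination[OF int_W nonneg_W, of f g 1 "- 1"] by simp

lemma L2hat_scale: "f \<in> L2hat a b W \<Longrightarrow> (\<lambda>t. l *s f t) \<in> L2hat a b W"
  using L2hat_combination[OF int_W nonneg_W, of f f l 0] by simp

text \<open>The seminorm of a difference vanishes exactly when \<open>W\<close> annihilates it
  almost everywhere. All reasoning about the quotient is thereby reduced to almost everywhere
  statements.\<close>

lemma L2_rel_iff: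
  "(f, g) \<in> L2_rel a b W \<longleftrightarrow> f \<in> L2hat a b W \<and> g \<in> L2hat a b W \<and>
     (AE t in lebesgue. t \<in> einterval a b \<longrightarrow> W t *v f t = W t *v g t)"
proof -
  have "seminorm_c a b W (\<lambda>t. f t - g t) = 0 \<longleftrightarrow> (AE t in lebesgue. t \<in> einterval a b \<longrightarrow> W t *v f t = W t *v g t)"
    if fg: "f \<in> L2hat a b W" "g \<in> L2hat a b W"
  proof
    assume "seminorm_c a b W (\<lambda>t. f t - g t) = 0"
    then have "Re (inner_c a b W (\<lambda>t. f t - g t) (\<lambda>t. f t - g t)) = 0" by (simp add: seminorm_c_def)
    from inner_c_eq_0_imp_AE[OF nonneg_W L2hat_diff[OF fg] this]
    show "AE t in lebesgue. t \<in> einterval a b \<longrightarrow> W t *v f t = W t *v g t"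
      by (simp add: matrix_vector_mult_diff_distrib)
  next
    assume "AE t in lebesgue. t \<in> einterval a b \<longrightarrow> W t *v f t = W t *v g t"
    then have "AE t in lebesgue. indicator (einterval a b) t *\<^sub>R cdot (f t - g t) (W t *v (f t - g t)) = 0"
      by eventually_elim (auto simp: matrix_vector_mult_diff_distrib cdot_def)
    then have "inner_c a b W (\<lambda>t. f t - g t) (\<lambda>t. f t - g t) = 0"
      unfolding inner_c_def set_lebesgue_integral_def by (rule integral_eq_zero_AE)
    then show "seminorm_c a b W (\<lambda>t. f t - g t) = 0" by (simp add: seminorm_c_def)
  qed
  then show ?thesis unfolding L2_rel_def by blast
qed

lemma L2_rel_refl: "f \<in> L2hat a b W \<Longrightarrow> (f, f) \<in> L2_rel a b W"
  by (simp add: L2_rel_iff)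

lemma L2_rel_sym: "(f, g) \<in> L2_rel a b W \<Longrightarrow> (g, f) \<in> L2_rel a b W"
  by (simp add: L2_rel_iff eq_commute)

lemma L2_rel_trans:
  assumes "(f, g) \<in> L2_rel a b W" "(g, h) \<in> L2_rel a b W" shows "(f, h) \<in> L2_rel a b W"
proof -
  have "AE t in lebesgue. t \<in> einterval a b \<longrightarrow> W t *v f t = W t *v g t"
    "AE t in lebesgue. t \<in> einterval a b \<longrightarrow> W t *v g t = W t *v h t"
    using assms by (simp_all add: L2_rel_iff)
  then have "AE t in lebesgue. t \<in> einterval a b \<longrightarrow> W t *v f t = W t *v h t"
    by eventually_elim simp
  then show ?thesis using assms by (simp add: L2_rel_iff)
qed

lemma L2_class_eq: "(f, g) \<in> L2_rel a b W \<Longrightarrow> L2_class f = L2_class g"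
  using L2_rel_trans L2_rel_sym by blast

lemma L2_space_class:
  assumes "y \<in> L2_space a b W" "f \<in> y" shows "y = L2_class f" "f \<in> L2hat a b W"
proof -
  obtain g where "y = L2_class g" using assms(1) unfolding L2_space_def by (rule quotientE)
  then have gf: "y = L2_class g" "(g, f) \<in> L2_rel a b W" using assms(2) by auto
  show "y = L2_class f" unfolding gf(1) by (rule L2_class_eq[OF gf(2)])
  show "f \<in> L2hat a b W" using gf(2) by (simp add: L2_rel_iff)
qed

lemma L2_class_space: "f \<in> L2hat a b W \<Longrightarrow> L2_class f \<in> L2_space a b W"
  unfolding L2_space_def by (rule quotientI)

lemma L2_space_nonempty: "y \<in> L2_space a b W \<Longrightarrow> \<exists>f. f \<in> y"
  unfolding L2_space_def by (elim quotientE) (use L2_rel_refl in blast)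

lemma L2_scale_class:
  assumes "f \<in> L2hat a b W"
  shows "L2_scale a b W l (L2_class f) = L2_class (\<lambda>t. l *s f t)"
proof -
  have "L2_class (\<lambda>t. l *s g t) = L2_class (\<lambda>t. l *s f t)" if "(f, g) \<in> L2_rel a b W" for g
  proof (rule L2_class_eq[OF L2_rel_sym])
    have "AE t in lebesgue. t \<in> einterval a b \<longrightarrow> W t *v f t = W t *v g t" using that by (simp add: L2_rel_iff)
    then have "AE t in lebesgue. t \<in> einterval a b \<longrightarrow> W t *v (l *s f t) = W t *v (l *s g t)"
      by eventually_elim (simp add: vector_scalar_commute)
    then show "(\<lambda>t. l *s f t, \<lambda>t. l *s g t) \<in> L2_rel a b W"
      using that by (simp add: L2_rel_iff L2hat_scale)
  qed
  then have "L2_scale a b W l (L2_class f) = (\<Union>g\<in>L2_class f. L2_class (\<lambda>t. l *s f t))"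
    unfolding L2_scale_def by auto
  then show ?thesis using L2_rel_refl[OF assms] by auto
qed

text \<open>Two representatives of one class differ by a function annihilated by \<open>W\<close>,
  and definiteness makes the difference zero. Then its derivative is zero as well, so the equation
  shows that the right-hand sides agree after applying \<open>W\<close>. This justifies the
  description operators in \<open>max_op\<close> and \<open>max_rep\<close>.\<close>

lemma max_graph_unique:
  assumes "max_graph a b P W y y1 f1" "max_graph a b P W y y2 f2"
  shows "t \<in> einterval a b \<Longrightarrow> y1 t = y2 t" "f1 = f2"
proof -
  have g: "y \<in> L2_space a b W" "f1 \<in> L2_space a b W" "f2 \<in> L2_space a b W" "y1 \<in> y" "y2 \<in> y"
    "locally_absolutely_cont a b y1" "locally_absolutely_cont a b y2"
    and eq: "\<And>h. h \<in> f1 \<Longrightarrow> ham_eq a b P W y1 h" "\<And>h. h \<in> f2 \<Longrightarrow> ham_eq a b P W y2 h"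
    using assms by (auto simp: max_graph_def)
  obtain h1 h2 where h: "h1 \<in> f1" "h2 \<in> f2" using L2_space_nonempty g(2,3) by blast
  have hL: "h1 \<in> L2hat a b W" "h2 \<in> L2hat a b W" using L2_space_class(2) g(2,3) h by blast+
  have ham: "ham_eq a b P W (\<lambda>t. y1 t - y2 t) (\<lambda>t. h1 t - h2 t)"
    by (rule ham_eq_diff[OF eq(1)[OF h(1)] eq(2)[OF h(2)]])
  have "(y1, y2) \<in> L2_rel a b W" using L2_space_class(1)[OF g(1,4)] g(5) by blast
  then have "AE t in lebesgue. t \<in> einterval a b \<longrightarrow> W t *v (y1 t - y2 t) = 0"
    by (simp add: L2_rel_iff matrix_vector_mult_diff_distrib)
  then have zero: "\<forall>t\<in>einterval a b. y1 t - y2 t = 0"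
    using definite ab(3) ham L2hat_diff[OF hL] locally_absolutely_cont_diff[OF g(6,7)]
    unfolding definite_on_subintervals_def by blast
  then show "t \<in> einterval a b \<Longrightarrow> y1 t = y2 t" by simp
  have "AE t in lebesgue. t \<in> einterval a b \<longrightarrow> W t *v h1 t = W t *v h2 t"
    using ham unfolding ham_eq_def
  proof (eventually_elim, intro impI)
    fix t assume t: "t \<in> einterval a b" and "t \<in> einterval a b \<longrightarrow>
      (\<exists>y'. ((\<lambda>t. y1 t - y2 t) has_vector_derivative y') (at t) \<and>
        symp_J *v y' - P t *v (y1 t - y2 t) = W t *v (h1 t - h2 t))"
    then obtain y' where y': "((\<lambda>t. y1 t - y2 t) has_vector_derivative y') (at t)"
        "symp_J *v y' - P t *v (y1 t - y2 t) = W t *v (h1 t - h2 t)" by blast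
    have "((\<lambda>t. 0) has_vector_derivative y') (at t)"
      by (rule has_vector_derivative_transform_within_open[OF y'(1) open_einterval t]) (use zero in simp)
    then have "y' = 0" by (rule vector_derivative_unique_at) simp
    then show "W t *v h1 t = W t *v h2 t"
      using y'(2) zero t by (simp add: matrix_vector_mult_diff_distrib)
  qed
  then have "(h1, h2) \<in> L2_rel a b W" using hL by (simp add: L2_rel_iff)
  then show "f1 = f2"
    using L2_space_class(1)[OF g(2) h(1)] L2_space_class(1)[OF g(3) h(2)] L2_class_eq by simp
qed

lemma solution_L2hat: "solution l v \<in> L2hat a b W"
  by (rule ham_solution_square_integrable[OF ham_solution_fundamental])

lemma solution_max_graph:
  "max_graph a b P W (L2_class (solution l v)) (solution l v) (L2_class (\<lambda>t. l *s solution l v t))"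
  unfolding max_graph_def
proof (intro conjI ballI)
  show "L2_class (solution l v) \<in> L2_space a b W" by (rule L2_class_space[OF solution_L2hat])
  show "L2_class (\<lambda>t. l *s solution l v t) \<in> L2_space a b W"
    by (rule L2_class_space[OF L2hat_scale[OF solution_L2hat]])
  show "solution l v \<in> L2_class (solution l v)" using L2_rel_refl[OF solution_L2hat] by blast
  show "locally_absolutely_cont a b (solution l v)"
    using ham_solution_fundamental by (simp add: ham_solution_def)
  fix f assume "f \<in> L2_class (\<lambda>t. l *s solution l v t)"
  then show "ham_eq a b P W (solution l v) f"
    by (intro ham_eq_cong_rhs[OF ham_solution_imp_ham_eq[OF ham_solution_fundamental]]) (simp add: L2_rel_iff)
qed

lemma max_op_eq:
  assumes "max_graph a b P W y yh f" shows "max_op a b P W y = f"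
  unfolding max_op_def
  by (rule the_equality) (use assms max_graph_unique(2) in blast)+

lemma max_rep_eq:
  assumes "max_graph a b P W y yh f" "t \<in> einterval a b" shows "max_rep a b P W y t = yh t"
proof -
  have "\<exists>f. max_graph a b P W y (max_rep a b P W y) f"
    unfolding max_rep_def by (rule someI[of "\<lambda>yh. \<exists>f. max_graph a b P W y yh f"]) (use assms(1) in blast)
  then show ?thesis using max_graph_unique(1)[OF _ assms] by blast
qed

definition boundary_matrix :: "complex ^ ('m + 'm) ^ ('m + 'm) \<Rightarrow> complex ^ ('m + 'm) ^ ('m + 'm) \<Rightarrow>
    complex \<Rightarrow> complex ^ ('m + 'm) ^ ('m + 'm)"
  where "boundary_matrix M N l = M ** (symp_J ** U_left l) - N ** (symp_J ** U_right l)"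

lemma bc_dom_solution:
  assumes y: "max_graph a b P W y yh f" and eq: "\<And>t. t \<in> einterval a b \<Longrightarrow> yh t = solution l v t"
  shows "y \<in> bc_dom a b P W c M N \<longleftrightarrow> boundary_matrix M N l *v v = 0"
proof -
  have rep: "max_rep a b P W y t = solution l v t" if "t \<in> einterval a b" for t
    using max_rep_eq[OF y that] eq[OF that] by simp
  have "y \<in> max_dom a b P W" using y by (auto simp: max_dom_def)
  moreover have "M *v (\<chi> i. bracket_at_left_end a (max_rep a b P W y) (fund_sol a b P W c 0 i))
         - N *v (\<chi> i. bracket_at_right_end b (max_rep a b P W y) (fund_sol a b P W c 0 i)) =
      boundary_matrix M N l *v v"
    by (simp add: bracket_ends[OF rep] boundary_matrix_def matrix_vector_mul_assoc
        bounded_bilinear.diff_left[OF bounded_bilinear_matrix_vector_mult])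
  ultimately show ?thesis by (simp only: bc_dom_def mem_Collect_eq simp_thms)
qed

text \<open>Since \<open>max_op\<close> is single valued, the eigenvalue equation makes
  \<open>l *s yh t\<close> an admissible right-hand side, so the representative \<open>yh\<close> is
  a solution and is determined by its value at \<open>c\<close>.\<close>

lemma eigenspace_iff:
  "y \<in> eigenspace a b P W (bc_dom a b P W c M N) l \<longleftrightarrow>
     (\<exists>v. boundary_matrix M N l *v v = 0 \<and> y = L2_class (solution l v))"
proof
  assume "y \<in> eigenspace a b P W (bc_dom a b P W c M N) l"
  then have D: "y \<in> bc_dom a b P W c M N" and op: "max_op a b P W y = L2_scale a b W l y"
    by (auto simp: eigenspace_def)
  then obtain yh f where g: "max_graph a b P W y yh f" by (auto simp: bc_dom_def max_dom_def)
  then have gy: "y \<in> L2_space a b W" "yh \<in> y" "locally_absolutely_cont a b yh"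
    and ham: "\<And>h. h \<in> f \<Longrightarrow> ham_eq a b P W yh h" by (auto simp: max_graph_def)
  note y = L2_space_class[OF gy(1,2)]
  have "f = L2_class (\<lambda>t. l *s yh t)"
    using op max_op_eq[OF g] L2_scale_class[OF y(2), of l] y(1) by simp
  then have "(\<lambda>t. l *s yh t) \<in> f" using L2_rel_refl[OF L2hat_scale[OF y(2)]] by blast
  then have "ham_solution a b P W l yh" by (rule ham_eq_imp_ham_solution[OF ham gy(3)])
  then have eq: "yh t = solution l (yh c) t" if "t \<in> einterval a b" for t
    using ham_solution_eq that by blast
  have "boundary_matrix M N l *v yh c = 0"
    using bc_dom_solution[OF g eq] D by simp
  moreover have "(yh, solution l (yh c)) \<in> L2_rel a b W"
    unfolding L2_rel_iff using y(2) solution_L2hat by (auto simp flip: eq)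
  then have "y = L2_class (solution l (yh c))" using y(1) L2_class_eq by simp
  ultimately show "\<exists>v. boundary_matrix M N l *v v = 0 \<and> y = L2_class (solution l v)" by blast
next
  assume "\<exists>v. boundary_matrix M N l *v v = 0 \<and> y = L2_class (solution l v)"
  then obtain v where v: "boundary_matrix M N l *v v = 0" "y = L2_class (solution l v)" by blast
  note g = solution_max_graph[of l v, folded v(2)]
  have "y \<in> bc_dom a b P W c M N" using bc_dom_solution[OF g refl] v(1) by blast
  moreover have "max_op a b P W y = L2_scale a b W l y"
    using max_op_eq[OF g] L2_scale_class[OF solution_L2hat, of l l v] by (simp only: v(2))
  ultimately show "y \<in> eigenspace a b P W (bc_dom a b P W c M N) l" by (simp add: eigenspace_def)
qed

section \<open>Dimension of the eigenspace\<close>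

lemma solution_null:
  assumes "AE t in lebesgue. t \<in> einterval a b \<longrightarrow> W t *v solution l v t = 0" shows "v = 0"
  using solution_zero[OF ham_solution_fundamental assms c] by (simp add: fundamental(2))

lemma solution_class_inj:
  assumes "L2_class (solution l v) = L2_class (solution l w)" shows "v = w"
proof -
  have "(solution l v, solution l w) \<in> L2_rel a b W"
    using assms L2_rel_refl[OF solution_L2hat, of l w] by blast
  then have "AE t in lebesgue. t \<in> einterval a b \<longrightarrow> W t *v solution l (v - w) t = 0"
    by (simp add: L2_rel_iff matrix_vector_mult_diff_distrib)
  then have "v - w = 0" by (rule solution_null)
  then show ?thesis by simp
qed

text \<open>The value at \<open>c\<close> recovers the class, so classes inject into kernel vectors;
  a linear relation among these values propagates to the solutions for all \<open>t\<close> and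
  hence to the quotient.\<close>

lemma independent_eigenfunctions_card_le:
  assumes B: "finite B" "B \<subseteq> eigenspace a b P W (bc_dom a b P W c M N) l" "L2_independent a b W B"
  shows "card B \<le> vec.dim {v. boundary_matrix M N l *v v = 0}"
proof -
  have "\<forall>y\<in>B. \<exists>v. boundary_matrix M N l *v v = 0 \<and> y = L2_class (solution l v)"
    using B(2) eigenspace_iff by blast
  from bchoice[OF this] obtain v where
    vB: "\<forall>y\<in>B. boundary_matrix M N l *v v y = 0 \<and> y = L2_class (solution l (v y))" by blast
  then have v: "\<And>y. y \<in> B \<Longrightarrow> boundary_matrix M N l *v v y = 0"
      "\<And>y. y \<in> B \<Longrightarrow> y = L2_class (solution l (v y))"
    by blast+
  have inj: "inj_on v B"
  proof (rule inj_onI)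
    fix y z assume "y \<in> B" "z \<in> B" "v y = v z"
    then show "y = z" using v(2)[of y] v(2)[of z] by (simp only:)
  qed
  have "vec.independent (v ` B)"
    unfolding vec.independent_explicit
  proof (intro conjI allI impI)
    show "finite (v ` B)" using B(1) by simp
    fix k assume "(\<Sum>x\<in>v ` B. k x *s x) = 0"
    then have sum0: "(\<Sum>y\<in>B. k (v y) *s v y) = 0" by (simp add: sum.reindex[OF inj])
    have "(\<lambda>t. \<Sum>y\<in>B. k (v y) *s solution l (v y) t) = (\<lambda>t. 0)"
      using sum0 by (simp add: matrix_vector_mult_sum[symmetric])
    then have "L2_class (\<lambda>t. \<Sum>y\<in>B. k (v y) *s solution l (v y) t) = L2_zero a b W"
      by (simp add: L2_zero_def)
    moreover have "\<forall>y\<in>B. solution l (v y) \<in> y"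
      using v(2) L2_rel_refl[OF solution_L2hat] by blast
    ultimately have "\<forall>y\<in>B. k (v y) = 0"
      using B(3)[unfolded L2_independent_def, rule_format, of "\<lambda>y. solution l (v y)" "\<lambda>y. k (v y)"] by blast
    then show "\<forall>x\<in>v ` B. k x = 0" by blast
  qed
  then have "card (v ` B) \<le> vec.dim {v. boundary_matrix M N l *v v = 0}"
    using v(1) by (intro vec.independent_card_le_dim) auto
  then show ?thesis by (simp add: card_image[OF inj])
qed

lemma independent_eigenfunctions_exist:
  obtains B where "finite B" "B \<subseteq> eigenspace a b P W (bc_dom a b P W c M N) l" "L2_independent a b W B"
    "card B = vec.dim {v. boundary_matrix M N l *v v = 0}"
proof -
  let ?K = "{v. boundary_matrix M N l *v v = 0}"
  obtain Bk where Bk: "Bk \<subseteq> ?K" "vec.independent Bk" "?K \<subseteq> vec.span Bk" "card Bk = vec.dim ?K"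
    by (rule vec.basis_exists[of ?K]) (rule that; assumption)
  have fin: "finite Bk" using Bk(2) by (simp add: vec.independent_explicit)
  let ?s = "\<lambda>v. L2_class (solution l v)"
  have inj: "inj_on ?s Bk" by (rule inj_onI) (rule solution_class_inj)
  show thesis
  proof (rule that[of "?s ` Bk"])
    show "finite (?s ` Bk)" using fin by simp
    show "?s ` Bk \<subseteq> eigenspace a b P W (bc_dom a b P W c M N) l" using Bk(1) eigenspace_iff by blast
    show "card (?s ` Bk) = vec.dim ?K" by (simp add: card_image[OF inj] Bk(4))
    show "L2_independent a b W (?s ` Bk)"
      unfolding L2_independent_def
    proof (intro allI impI, elim conjE)
      fix k r assume r: "\<forall>y\<in>?s ` Bk. r y \<in> y"
        and z: "L2_class (\<lambda>t. \<Sum>y\<in>?s ` Bk. k y *s r y t) = L2_zero a b W"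
      have "(\<lambda>t. 0 :: complex ^ ('m + 'm)) \<in> L2hat a b W"
        using L2hat_scale[OF solution_L2hat, of 0] by simp
      then have "(\<lambda>t. 0) \<in> L2_class (\<lambda>t. \<Sum>y\<in>?s ` Bk. k y *s r y t)"
        unfolding z L2_zero_def using L2_rel_refl by blast
      then have sum0: "AE t in lebesgue. t \<in> einterval a b \<longrightarrow> W t *v (\<Sum>y\<in>?s ` Bk. k y *s r y t) = 0"
        by (simp add: L2_rel_iff)
      \<comment> \<open>The representatives \<open>r\<close> are arbitrary members of the classes,
        so they agree with the solutions only after applying \<open>W\<close> and almost everywhere;
        finiteness of \<open>Bk\<close> allows one common null set.\<close>
      have "AE t in lebesgue. \<forall>v\<in>Bk. t \<in> einterval a b \<longrightarrow> W t *v solution l v t = W t *v r (?s v) t"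
        using r by (intro eventually_ball_finite[OF fin]) (auto simp: L2_rel_iff)
      then have "AE t in lebesgue. t \<in> einterval a b \<longrightarrow> W t *v solution l (\<Sum>v\<in>Bk. k (?s v) *s v) t = 0"
        using sum0
      proof (eventually_elim, intro impI)
        fix t assume t: "t \<in> einterval a b"
          and 1: "\<forall>v\<in>Bk. t \<in> einterval a b \<longrightarrow> W t *v solution l v t = W t *v r (?s v) t"
          and 2: "t \<in> einterval a b \<longrightarrow> W t *v (\<Sum>y\<in>?s ` Bk. k y *s r y t) = 0"
        have "W t *v solution l (\<Sum>v\<in>Bk. k (?s v) *s v) t = (\<Sum>v\<in>Bk. k (?s v) *s (W t *v solution l v t))"
          by (simp add: matrix_vector_mult_sum)
        also have "\<dots> = (\<Sum>v\<in>Bk. k (?s v) *s (W t *v r (?s v) t))"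
          by (rule sum.cong) (use 1 t in auto)
        also have "\<dots> = W t *v (\<Sum>y\<in>?s ` Bk. k y *s r y t)"
          by (simp add: sum.reindex[OF inj] matrix_vector_mult_sum)
        finally show "W t *v solution l (\<Sum>v\<in>Bk. k (?s v) *s v) t = 0" using 2 t by simp
      qed
      then have "(\<Sum>v\<in>Bk. k (?s v) *s v) = 0" by (rule solution_null)
      then show "\<forall>y\<in>?s ` Bk. k y = 0"
        using vec.independentD[OF Bk(2) fin subset_refl, of "\<lambda>v. k (?s v)"] by blast
    qed
  qed
qed

lemma geometric_multiplicity_eq:
  "geometric_multiplicity a b P W (bc_dom a b P W c M N) l = enat (vec.dim {v. boundary_matrix M N l *v v = 0})"
  (is "?gm = enat ?dim")
proof (rule antisym)
  show "?gm \<le> enat ?dim"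
    unfolding geometric_multiplicity_def by (rule SUP_least) (use independent_eigenfunctions_card_le in auto)
  obtain B where B: "finite B" "B \<subseteq> eigenspace a b P W (bc_dom a b P W c M N) l" "L2_independent a b W B"
    "card B = ?dim"
    by (rule independent_eigenfunctions_exist) (rule that; assumption)
  show "enat ?dim \<le> ?gm"
    unfolding geometric_multiplicity_def B(4)[symmetric] by (rule SUP_upper) (use B in blast)
qed

section \<open>Reality of eigenvalues, absence of generalized eigenvectors, and the
  conclusion\<close>

lemma Gamma_c_eq: "Gamma_c a b P W c M N l = det (boundary_matrix M N l)"
  by (simp add: Gamma_c_def boundary_matrix_def Phi_ends)

text \<open>The second pair is any admissible pair of boundary vectors, not only one from a
  solution. It is taken from the eigenfunction itself for reality, and from a parameter derivative
  corrected by a solution for simplicity.\<close>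

lemma boundary_form_vanishes:
  assumes rk: "rank (hcat M N) = CARD('m + 'm)"
    and sa: "M ** symp_J ** ctranspose M = N ** symp_J ** ctranspose N"
    and bc: "boundary_matrix M N l *v v = 0" "M *v (symp_J *v u') = N *v (symp_J *v v')"
  shows "cdot v (ctranspose (U_right l) *v (symp_J *v v')) = cdot v (ctranspose (U_left l) *v (symp_J *v u'))"
proof -
  have "M *v (symp_J *v (U_left l *v v)) = N *v (symp_J *v (U_right l *v v))"
    using bc(1) by (simp add: boundary_matrix_def matrix_vector_mul_assoc
        bounded_bilinear.diff_left[OF bounded_bilinear_matrix_vector_mult])
  from selfadjoint_boundary_condition_isotropic[OF rk sa this bc(2)]
  show ?thesis by (simp add: cdot_ctranspose)
qed

lemma eigenvalue_real:
  assumes rk: "rank (hcat M N) = CARD('m + 'm)"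
    and sa: "M ** symp_J ** ctranspose M = N ** symp_J ** ctranspose N"
    and v: "boundary_matrix M N l *v v = 0" "v \<noteq> 0"
  shows "cnj l = l"
proof -
  have "M *v (symp_J *v (U_left l *v v)) = N *v (symp_J *v (U_right l *v v))"
    using v(1) by (simp add: boundary_matrix_def matrix_vector_mul_assoc
        bounded_bilinear.diff_left[OF bounded_bilinear_matrix_vector_mult])
  from boundary_form_vanishes[OF rk sa v(1) this]
  have "cdot v ((ctranspose (U_right l) ** (symp_J ** U_right l) - ctranspose (U_left l) ** (symp_J ** U_left l)) *v v) = 0"
    by (simp add: matrix_vector_mul_assoc cdot_diff_right bounded_bilinear.diff_left[OF bounded_bilinear_matrix_vector_mult])
  then have "(l - cnj l) * cdot v (gram l l *v v) = 0"
    unfolding U_green matrix_vector_mul_assoc[symmetric] mat_vector_mult cdot_scale_right .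
  then show ?thesis using gram_definite[of v l] v(2) by auto
qed

lemma no_generalized_eigenvector:
  assumes rk: "rank (hcat M N) = CARD('m + 'm)"
    and sa: "M ** symp_J ** ctranspose M = N ** symp_J ** ctranspose N"
    and real: "cnj l = l"
    and dL: "\<And>i j. ((\<lambda>l. U_left l $ i $ j) has_field_derivative dL $ i $ j) (at l)"
    and dR: "\<And>i j. ((\<lambda>l. U_right l $ i $ j) has_field_derivative dR $ i $ j) (at l)"
    and v: "boundary_matrix M N l *v v = 0"
    and w: "(M ** (symp_J ** dL) - N ** (symp_J ** dR)) *v v = boundary_matrix M N l *v w"
  shows "v = 0"
proof (rule gram_definite)
  \<comment> \<open>The hypothesis on \<open>w\<close> says precisely that this corrected derivative
    pair satisfies the boundary condition, although the derivative pair alone need not.\<close>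
  let ?u = "dL *v v - U_left l *v w" and ?z = "dR *v v - U_right l *v w"
  note lin = matrix_vector_mult_diff_distrib bounded_bilinear.diff_left[OF bounded_bilinear_matrix_vector_mult]
    matrix_vector_mul_assoc
  have "M *v (symp_J *v ?u) = N *v (symp_J *v ?z)"
    using w by (simp add: boundary_matrix_def lin algebra_simps)
  from boundary_form_vanishes[OF rk sa v this]
  have "cdot v (ctranspose (U_right l) *v (symp_J *v ?z)) - cdot v (ctranspose (U_left l) *v (symp_J *v ?u)) = 0"
    by simp
  then have "cdot v ((ctranspose (U_right l) ** (symp_J ** dR) - ctranspose (U_left l) ** (symp_J ** dL)) *v v) =
      cdot v ((ctranspose (U_right l) ** (symp_J ** U_right l) - ctranspose (U_left l) ** (symp_J ** U_left l)) *v w)"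
    by (simp add: lin cdot_diff_right algebra_simps)
  \<comment> \<open>On the right stands Green's identity for (l, l), whose factor
    \<open>l - cnj l\<close> is zero, so the correction by \<open>w\<close> disappears; on the left
    only the Gram matrix remains.\<close>
  then show "cdot v (gram l l *v v) = 0"
    unfolding boundary_form_derivative[OF real dL dR] U_green real
      matrix_vector_mul_assoc[symmetric] mat_vector_mult cdot_scale_right by simp
qed

theorem analytic_eq_geometric_multiplicity:
  assumes rk: "rank (hcat M N) = CARD('m + 'm)"
    and sa: "M ** symp_J ** ctranspose M = N ** symp_J ** ctranspose N"
    and ev: "is_eigenvalue a b P W (bc_dom a b P W c M N) l"
  shows "\<exists>n::nat. zorder (Gamma_c a b P W c M N) l = int n \<and>
                  geometric_multiplicity a b P W (bc_dom a b P W c M N) l = enat n"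
proof -
  obtain v where v: "boundary_matrix M N l *v v = 0" "L2_class (solution l v) \<noteq> L2_zero a b W"
    using ev unfolding is_eigenvalue_def eigenspace_iff Bex_def by blast
  \<comment> \<open>The zero vector gives the zero function, whose class is \<open>L2_zero\<close>,
    contrary to the choice of the eigenfunction.\<close>
  have "v \<noteq> 0" using v(2) by (auto simp: L2_zero_def)
  then have real: "cnj l = l" by (rule eigenvalue_real[OF rk sa v(1)])
  define dL :: "complex ^ ('m + 'm) ^ ('m + 'm)" where "dL = (\<chi> i j. deriv (\<lambda>l. U_left l $ i $ j) l)"
  define dR :: "complex ^ ('m + 'm) ^ ('m + 'm)" where "dR = (\<chi> i j. deriv (\<lambda>l. U_right l $ i $ j) l)"
  have dL: "((\<lambda>l. U_left l $ i $ j) has_field_derivative dL $ i $ j) (at l)" for i j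
    unfolding dL_def vec_lambda_beta by (rule holomorphic_derivI[OF U_left(2) open_UNIV UNIV_I])
  have dR: "((\<lambda>l. U_right l $ i $ j) has_field_derivative dR $ i $ j) (at l)" for i j
    unfolding dR_def vec_lambda_beta by (rule holomorphic_derivI[OF U_right(2) open_UNIV UNIV_I])
  have "zorder (\<lambda>l. det (boundary_matrix M N l)) l = int (vec.dim {v. boundary_matrix M N l *v v = 0})"
  proof (rule zorder_det_eq_dim_kernel)
    show "(\<lambda>l. boundary_matrix M N l $ i $ j) holomorphic_on UNIV" for i j
      unfolding boundary_matrix_def vector_minus_component matrix_matrix_mult_def vec_lambda_beta
      by (intro holomorphic_intros U_left(2) U_right(2))
    show "((\<lambda>l. boundary_matrix M N l $ i $ j) has_field_derivative
        (M ** (symp_J ** dL) - N ** (symp_J ** dR)) $ i $ j) (at l)" for i j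
      unfolding boundary_matrix_def vector_minus_component matrix_matrix_mult_def vec_lambda_beta
      by (intro DERIV_diff DERIV_sum DERIV_cmult dL dR)
    show "v = 0" if "boundary_matrix M N l *v v = 0"
      "(M ** (symp_J ** dL) - N ** (symp_J ** dR)) *v v = boundary_matrix M N l *v w" for v w
      by (rule no_generalized_eigenvector[OF rk sa real dL dR that])
  qed
  then show ?thesis
    using geometric_multiplicity_eq[of M N l] unfolding Gamma_c_eq[abs_def] by blast
qed

end

theorem theorem3p1:
  fixes a b :: ereal and c0 :: real
    and P W :: "real \<Rightarrow> complex ^ ('m::finite + 'm) ^ ('m + 'm)"
    and M N :: "complex ^ ('m + 'm) ^ ('m + 'm)"
    and lam0 :: complex
  assumes "a < b" and "a < ereal c0" and "ereal c0 < b"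
    and "\<And>t. t \<in> einterval a b \<Longrightarrow> hermitian (P t)"
    and "\<And>t. t \<in> einterval a b \<Longrightarrow> hermitian (W t)"
    and "\<And>t. t \<in> einterval a b \<Longrightarrow> nonneg_matrix (W t)"
    and "locally_integrable a b P" and "locally_integrable a b W"
    and "definite_on_subintervals a b P W"
    and "limit_circle_left a b P W c0" and "limit_circle_right a b P W c0"
    and "rank (hcat M N) = 2 * CARD('m)"
    and "M ** symp_J ** ctranspose M = N ** symp_J ** ctranspose N"
    and "is_eigenvalue a b P W (bc_dom a b P W c0 M N) lam0"
  shows "\<exists>n::nat. zorder (Gamma_c a b P W c0 M N) lam0 = int n \<and>
                  geometric_multiplicity a b P W (bc_dom a b P W c0 M N) lam0 = enat n"
proof -
  interpret limit_circle_system a b c0 P W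
    by unfold_locales (use assms in \<open>auto simp: einterval_def\<close>)
  have "rank (hcat M N) = CARD('m + 'm)"
    using assms(12) by simp
  then show ?thesis
    by (rule analytic_eq_geometric_multiplicity[OF _ assms(13,14)])
qed

end
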